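(* Let $\mathcal M$ be a model category and let $m$ be a positive integer. (1) If $X$ is a cofibrant $m$-cosimplicial object in $\mathcal M$, then every slice of $X$ is a cofibrant cosimplicial object. (2) If $X$ is a fibrant $m$-cosimplicial object in $\mathcal M$, then every slice of $X$ is a fibrant cosimplicial object. (3) If $X$ is a cofibrant $m$-simplicial object in $\mathcal M$, then every slice of $X$ is a cofibrant simplicial object. (4) If $X$ is a fibrant $m$-simplicial object in $\mathcal M$, then every slice of $X$ is a fibrant simplicial object.
   Context: Model categories have all small limits and colimits. A Reedy category is a small category $\mathcal C$ together with subcategories $\overrightarrow{\mathcal C}$ (direct) and $\overleftarrow{\mathcal C}$ (inverse), both containing all objects, such that every object can be assigned a nonnegative integer (its degree) so that every non-identity map of $\overrightarrow{\mathcal C}$ raises degree, every non-identity map of $\overleftarrow{\mathcal C}$ lowers degree, and every map $g$ of $\mathcal C$ factors uniquely as $g=\overrightarrow g\,\overleftarrow g$ with $\overrightarrow g$ in $\overrightarrow{\mathcal C}$ and $\overleftarrow g$ in $\overleftarrow{\mathcal C}$. A finite product of Reedy categories is a Reedy category whose direct (inverse) subcategory is the product of the direct (inverse) subcategories; $\mathcal C^{\mathrm{op}}$ is a Reedy category with direct subcategory $(\overleftarrow{\mathcal C})^{\mathrm{op}}$ and inverse subcategory $(\overrightarrow{\mathcal C})^{\mathrm{op}}$. $\mathbf\Delta$ is the category with objects the ordered sets $[n]=(0,1,\dots,n)$, $n\ge 0$, and maps the weakly monotone functions; its standard Reedy structure has the injective functions as direct subcategory and the surjective functions as inverse subcategory.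 A cosimplicial (respectively simplicial) object in $\mathcal M$ is a functor $\mathbf\Delta\to\mathcal M$ (respectively $\mathbf\Delta^{\mathrm{op}}\to\mathcal M$); an $m$-cosimplicial (respectively $m$-simplicial) object is a functor $\mathbf\Delta^m\to\mathcal M$ (respectively $(\mathbf\Delta^{\mathrm{op}})^m\to\mathcal M$). A slice of an $m$-cosimplicial (respectively $m$-simplicial) object $X$ is a cosimplicial (respectively simplicial) object obtained by restricting $X$ along a functor $\mathbf\Delta\to\mathbf\Delta^m$ (respectively $\mathbf\Delta^{\mathrm{op}}\to(\mathbf\Delta^{\mathrm{op}})^m$) that is the identity in one chosen coordinate and is constant at a chosen object in each of the other coordinates. Cofibrant and fibrant refer to the Reedy model category structure on diagrams $\mathcal M^{\mathcal C}$. For a $\mathcal C$-diagram $X$ and object $\alpha$, the latching object $\mathrm L_\alpha X$ is the colimit of $X$ over the full subcategory of $(\overrightarrow{\mathcal C}\downarrow\alpha)$ on all objects except $1_\alpha$, and the matching object $\mathrm M_\alpha X$ is the limit of $X$ over the full subcategory of $(\alpha\downarrow\overleftarrow{\mathcal C})$ on all objects except $1_\alpha$. A map $X\to Y$ is a weak equivalence if it is so objectwise, a cofibration if every $X_\alpha\amalg_{\mathrm L_\alpha X}\mathrm L_\alpha Y\to Y_\alpha$ is a cofibration, and a fibration if every $X_\alpha\to Y_\alpha\times_{\mathrm M_\alpha Y}\mathrm M_\alpha X$ is a fibration. *)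

theory Defs
  imports "HOL-Library.FuncSet"
begin

section \<open>Categories, functors, diagram categories\<close>

record ('o, 'a) cat =
  Obj :: "'o set"
  Arr :: "'a set"
  Dom :: "'a \<Rightarrow> 'o"
  Cod :: "'a \<Rightarrow> 'o"
  Ide :: "'o \<Rightarrow> 'a"
  Cmp :: "'a \<Rightarrow> 'a \<Rightarrow> 'a" (infixr "\<cdot>\<index>" 70)

definition Hom :: "('o, 'a, 'z) cat_scheme \<Rightarrow> 'o \<Rightarrow> 'o \<Rightarrow> 'a set" where
  "Hom C a b = {f \<in> Arr C. Dom C f = a \<and> Cod C f = b}"

locale category =
  fixes C :: "('o, 'a, 'z) cat_scheme" (structure)
  assumes Dom_in: "f \<in> Arr C \<Longrightarrow> Dom C f \<in> Obj C"
    and Cod_in: "f \<in> Arr C \<Longrightarrow> Cod C f \<in> Obj C"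
    and Ide_in: "a \<in> Obj C \<Longrightarrow> Ide C a \<in> Hom C a a"
    and Cmp_in: "f \<in> Hom C a b \<Longrightarrow> g \<in> Hom C b c \<Longrightarrow> g \<cdot> f \<in> Hom C a c"
    and Cmp_Ide: "f \<in> Hom C a b \<Longrightarrow> f \<cdot> Ide C a = f"
    and Ide_Cmp: "f \<in> Hom C a b \<Longrightarrow> Ide C b \<cdot> f = f"
    and Cmp_assoc: "f \<in> Hom C a b \<Longrightarrow> g \<in> Hom C b c \<Longrightarrow> h \<in> Hom C c d
      \<Longrightarrow> (h \<cdot> g) \<cdot> f = h \<cdot> (g \<cdot> f)"

record ('o1, 'a1, 'o2, 'a2) fctr =
  FObj :: "'o1 \<Rightarrow> 'o2"
  FArr :: "'a1 \<Rightarrow> 'a2"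

text \<open>Functors are extensional (\<open>undefined\<close> off the carriers), so that two functors agreeing on all
  objects and arrows are equal and functors form the objects of a category.\<close>

definition is_functor ::
  "('o1, 'a1, 'y) cat_scheme \<Rightarrow> ('o2, 'a2, 'z) cat_scheme \<Rightarrow> ('o1, 'a1, 'o2, 'a2) fctr \<Rightarrow> bool"
where
  "is_functor C D F \<longleftrightarrow>
     FObj F \<in> Obj C \<rightarrow>\<^sub>E Obj D \<and> FArr F \<in> extensional (Arr C) \<and>
     (\<forall>f\<in>Arr C. FArr F f \<in> Hom D (FObj F (Dom C f)) (FObj F (Cod C f))) \<and>
     (\<forall>a\<in>Obj C. FArr F (Ide C a) = Ide D (FObj F a)) \<and>
     (\<forall>f\<in>Arr C. \<forall>g\<in>Arr C. Dom C g = Cod C f \<longrightarrow>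
        FArr F (g \<cdot>\<^bsub>C\<^esub> f) = FArr F g \<cdot>\<^bsub>D\<^esub> FArr F f)"

definition restrict_along ::
  "('o1, 'a1, 'z) cat_scheme \<Rightarrow> ('o2, 'a2, 'o3, 'a3) fctr \<Rightarrow> ('o1, 'a1, 'o2, 'a2) fctr
     \<Rightarrow> ('o1, 'a1, 'o3, 'a3) fctr"
where
  "restrict_along C X G =
     \<lparr>FObj = \<lambda>a\<in>Obj C. FObj X (FObj G a), FArr = \<lambda>f\<in>Arr C. FArr X (FArr G f)\<rparr>"

text \<open>A natural transformation is stored together with its source and target functors.\<close>

type_synonym ('o1, 'a1, 'o2, 'a2) nattr =
  "('o1, 'a1, 'o2, 'a2) fctr \<times> ('o1, 'a1, 'o2, 'a2) fctr \<times> ('o1 \<Rightarrow> 'a2)"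

definition is_nattr ::
  "('o1, 'a1, 'y) cat_scheme \<Rightarrow> ('o2, 'a2, 'z) cat_scheme \<Rightarrow> ('o1, 'a1, 'o2, 'a2) nattr \<Rightarrow> bool"
where
  "is_nattr C D = (\<lambda>(F, G, \<tau>).
     is_functor C D F \<and> is_functor C D G \<and> \<tau> \<in> extensional (Obj C) \<and>
     (\<forall>a\<in>Obj C. \<tau> a \<in> Hom D (FObj F a) (FObj G a)) \<and>
     (\<forall>f\<in>Arr C. FArr G f \<cdot>\<^bsub>D\<^esub> \<tau> (Dom C f) = \<tau> (Cod C f) \<cdot>\<^bsub>D\<^esub> FArr F f))"

definition functor_cat ::
  "('o1, 'a1, 'y) cat_scheme \<Rightarrow> ('o2, 'a2, 'z) cat_scheme
     \<Rightarrow> (('o1, 'a1, 'o2, 'a2) fctr, ('o1, 'a1, 'o2, 'a2) nattr) cat"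
where
  "functor_cat C D =
     \<lparr>Obj = {F. is_functor C D F},
      Arr = {t. is_nattr C D t},
      Dom = (\<lambda>(F, G, \<tau>). F),
      Cod = (\<lambda>(F, G, \<tau>). G),
      Ide = (\<lambda>F. (F, F, \<lambda>a\<in>Obj C. Ide D (FObj F a))),
      Cmp = (\<lambda>(G, H, \<sigma>) (F, G', \<tau>). (F, H, \<lambda>a\<in>Obj C. \<sigma> a \<cdot>\<^bsub>D\<^esub> \<tau> a))\<rparr>"


section \<open>Limits and colimits\<close>

definition is_initial :: "('o, 'a, 'z) cat_scheme \<Rightarrow> 'o \<Rightarrow> bool" where
  "is_initial C i \<longleftrightarrow> i \<in> Obj C \<and> (\<forall>x\<in>Obj C. \<exists>!f. f \<in> Hom C i x)"

definition is_terminal :: "('o, 'a, 'z) cat_scheme \<Rightarrow> 'o \<Rightarrow> bool" where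
  "is_terminal C t \<longleftrightarrow> t \<in> Obj C \<and> (\<forall>x\<in>Obj C. \<exists>!f. f \<in> Hom C x t)"

definition is_cone ::
  "('j, 'k, 'y) cat_scheme \<Rightarrow> ('o, 'a, 'z) cat_scheme \<Rightarrow> ('j, 'k, 'o, 'a) fctr
     \<Rightarrow> 'o \<Rightarrow> ('j \<Rightarrow> 'a) \<Rightarrow> bool"
where
  "is_cone J C F x \<pi> \<longleftrightarrow>
     x \<in> Obj C \<and> (\<forall>j\<in>Obj J. \<pi> j \<in> Hom C x (FObj F j)) \<and>
     (\<forall>u\<in>Arr J. FArr F u \<cdot>\<^bsub>C\<^esub> \<pi> (Dom J u) = \<pi> (Cod J u))"

definition is_cocone ::
  "('j, 'k, 'y) cat_scheme \<Rightarrow> ('o, 'a, 'z) cat_scheme \<Rightarrow> ('j, 'k, 'o, 'a) fctr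
     \<Rightarrow> 'o \<Rightarrow> ('j \<Rightarrow> 'a) \<Rightarrow> bool"
where
  "is_cocone J C F x \<iota> \<longleftrightarrow>
     x \<in> Obj C \<and> (\<forall>j\<in>Obj J. \<iota> j \<in> Hom C (FObj F j) x) \<and>
     (\<forall>u\<in>Arr J. \<iota> (Cod J u) \<cdot>\<^bsub>C\<^esub> FArr F u = \<iota> (Dom J u))"

definition is_limit ::
  "('j, 'k, 'y) cat_scheme \<Rightarrow> ('o, 'a, 'z) cat_scheme \<Rightarrow> ('j, 'k, 'o, 'a) fctr
     \<Rightarrow> 'o \<Rightarrow> ('j \<Rightarrow> 'a) \<Rightarrow> bool"
where
  "is_limit J C F l \<pi> \<longleftrightarrow> is_cone J C F l \<pi> \<and>
     (\<forall>x \<rho>. is_cone J C F x \<rho> \<longrightarrow> (\<exists>!h. h \<in> Hom C x l \<and> (\<forall>j\<in>Obj J. \<pi> j \<cdot>\<^bsub>C\<^esub> h = \<rho> j)))"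

definition is_colimit ::
  "('j, 'k, 'y) cat_scheme \<Rightarrow> ('o, 'a, 'z) cat_scheme \<Rightarrow> ('j, 'k, 'o, 'a) fctr
     \<Rightarrow> 'o \<Rightarrow> ('j \<Rightarrow> 'a) \<Rightarrow> bool"
where
  "is_colimit J C F l \<iota> \<longleftrightarrow> is_cocone J C F l \<iota> \<and>
     (\<forall>x \<rho>. is_cocone J C F x \<rho> \<longrightarrow> (\<exists>!h. h \<in> Hom C l x \<and> (\<forall>j\<in>Obj J. h \<cdot>\<^bsub>C\<^esub> \<iota> j = \<rho> j)))"

text \<open>\<open>lim\<close> and \<open>colim\<close> pick some universal (co)cone, consisting of an apex and its legs; the
  \<open>_ind\<close> functions give the arrow which the universal property associates with a (co)cone on \<open>x\<close>.\<close>

definition lim ::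
  "('j, 'k, 'y) cat_scheme \<Rightarrow> ('o, 'a, 'z) cat_scheme \<Rightarrow> ('j, 'k, 'o, 'a) fctr
     \<Rightarrow> 'o \<times> ('j \<Rightarrow> 'a)"
where
  "lim J C F = (SOME (l, \<pi>). is_limit J C F l \<pi>)"

definition colim ::
  "('j, 'k, 'y) cat_scheme \<Rightarrow> ('o, 'a, 'z) cat_scheme \<Rightarrow> ('j, 'k, 'o, 'a) fctr
     \<Rightarrow> 'o \<times> ('j \<Rightarrow> 'a)"
where
  "colim J C F = (SOME (l, \<iota>). is_colimit J C F l \<iota>)"

definition lim_ind ::
  "('j, 'k, 'y) cat_scheme \<Rightarrow> ('o, 'a, 'z) cat_scheme \<Rightarrow> ('j, 'k, 'o, 'a) fctr
     \<Rightarrow> 'o \<Rightarrow> ('j \<Rightarrow> 'a) \<Rightarrow> 'a"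
where
  "lim_ind J C F x \<rho> =
     (THE h. h \<in> Hom C x (fst (lim J C F)) \<and> (\<forall>j\<in>Obj J. snd (lim J C F) j \<cdot>\<^bsub>C\<^esub> h = \<rho> j))"

definition colim_ind ::
  "('j, 'k, 'y) cat_scheme \<Rightarrow> ('o, 'a, 'z) cat_scheme \<Rightarrow> ('j, 'k, 'o, 'a) fctr
     \<Rightarrow> 'o \<Rightarrow> ('j \<Rightarrow> 'a) \<Rightarrow> 'a"
where
  "colim_ind J C F x \<rho> =
     (THE h. h \<in> Hom C (fst (colim J C F)) x \<and> (\<forall>j\<in>Obj J. h \<cdot>\<^bsub>C\<^esub> snd (colim J C F) j = \<rho> j))"

definition is_pullback ::
  "('o, 'a, 'z) cat_scheme \<Rightarrow> 'a \<Rightarrow> 'a \<Rightarrow> 'o \<Rightarrow> 'a \<Rightarrow> 'a \<Rightarrow> bool"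
where
  "is_pullback C f g r p q \<longleftrightarrow>
     p \<in> Hom C r (Dom C f) \<and> q \<in> Hom C r (Dom C g) \<and> f \<cdot>\<^bsub>C\<^esub> p = g \<cdot>\<^bsub>C\<^esub> q \<and>
     (\<forall>x. \<forall>u\<in>Hom C x (Dom C f). \<forall>v\<in>Hom C x (Dom C g). f \<cdot>\<^bsub>C\<^esub> u = g \<cdot>\<^bsub>C\<^esub> v \<longrightarrow>
        (\<exists>!h. h \<in> Hom C x r \<and> p \<cdot>\<^bsub>C\<^esub> h = u \<and> q \<cdot>\<^bsub>C\<^esub> h = v))"

definition is_pushout ::
  "('o, 'a, 'z) cat_scheme \<Rightarrow> 'a \<Rightarrow> 'a \<Rightarrow> 'o \<Rightarrow> 'a \<Rightarrow> 'a \<Rightarrow> bool"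
where
  "is_pushout C f g r p q \<longleftrightarrow>
     p \<in> Hom C (Cod C f) r \<and> q \<in> Hom C (Cod C g) r \<and> p \<cdot>\<^bsub>C\<^esub> f = q \<cdot>\<^bsub>C\<^esub> g \<and>
     (\<forall>x. \<forall>u\<in>Hom C (Cod C f) x. \<forall>v\<in>Hom C (Cod C g) x. u \<cdot>\<^bsub>C\<^esub> f = v \<cdot>\<^bsub>C\<^esub> g \<longrightarrow>
        (\<exists>!h. h \<in> Hom C r x \<and> h \<cdot>\<^bsub>C\<^esub> p = u \<and> h \<cdot>\<^bsub>C\<^esub> q = v))"

definition pullback_ind :: "('o, 'a, 'z) cat_scheme \<Rightarrow> 'a \<Rightarrow> 'a \<Rightarrow> 'a \<Rightarrow> 'a \<Rightarrow> 'a" where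
  "pullback_ind C f g u v =
     (let (r, p, q) = (SOME (r, p, q). is_pullback C f g r p q)
      in THE h. h \<in> Hom C (Dom C u) r \<and> p \<cdot>\<^bsub>C\<^esub> h = u \<and> q \<cdot>\<^bsub>C\<^esub> h = v)"

definition pushout_ind :: "('o, 'a, 'z) cat_scheme \<Rightarrow> 'a \<Rightarrow> 'a \<Rightarrow> 'a \<Rightarrow> 'a \<Rightarrow> 'a" where
  "pushout_ind C f g u v =
     (let (r, p, q) = (SOME (r, p, q). is_pushout C f g r p q)
      in THE h. h \<in> Hom C r (Cod C u) \<and> h \<cdot>\<^bsub>C\<^esub> p = u \<and> h \<cdot>\<^bsub>C\<^esub> q = v)"


section \<open>Model categories\<close>

text \<open>HOL has no global notion of a small set, so smallness is relative to a type \<open>'u\<close> playing the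
  part of the universe: the small categories are, up to isomorphism, those whose objects and arrows
  form sets of elements of \<open>'u\<close>.\<close>

definition has_small_limits :: "'u itself \<Rightarrow> ('o, 'a, 'z) cat_scheme \<Rightarrow> bool" where
  "has_small_limits U C \<longleftrightarrow>
     (\<forall>(J :: ('u, 'u) cat) F. category J \<longrightarrow> is_functor J C F \<longrightarrow> (\<exists>l \<pi>. is_limit J C F l \<pi>))"

definition has_small_colimits :: "'u itself \<Rightarrow> ('o, 'a, 'z) cat_scheme \<Rightarrow> bool" where
  "has_small_colimits U C \<longleftrightarrow>
     (\<forall>(J :: ('u, 'u) cat) F. category J \<longrightarrow> is_functor J C F \<longrightarrow> (\<exists>l \<iota>. is_colimit J C F l \<iota>))"

record ('o, 'a) model = "('o, 'a) cat" +
  Weq :: "'a set"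
  Cof :: "'a set"
  Fib :: "'a set"

definition is_retract :: "('o, 'a, 'z) cat_scheme \<Rightarrow> 'a \<Rightarrow> 'a \<Rightarrow> bool" where
  "is_retract C f g \<longleftrightarrow> f \<in> Arr C \<and> g \<in> Arr C \<and>
     (\<exists>i\<in>Hom C (Dom C f) (Dom C g). \<exists>r\<in>Hom C (Dom C g) (Dom C f).
      \<exists>j\<in>Hom C (Cod C f) (Cod C g). \<exists>s\<in>Hom C (Cod C g) (Cod C f).
        r \<cdot>\<^bsub>C\<^esub> i = Ide C (Dom C f) \<and> s \<cdot>\<^bsub>C\<^esub> j = Ide C (Cod C f) \<and>
        g \<cdot>\<^bsub>C\<^esub> i = j \<cdot>\<^bsub>C\<^esub> f \<and> f \<cdot>\<^bsub>C\<^esub> r = s \<cdot>\<^bsub>C\<^esub> g)"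

definition has_lifting :: "('o, 'a, 'z) cat_scheme \<Rightarrow> 'a \<Rightarrow> 'a \<Rightarrow> bool" where
  "has_lifting C i p \<longleftrightarrow>
     (\<forall>u\<in>Hom C (Dom C i) (Dom C p). \<forall>v\<in>Hom C (Cod C i) (Cod C p). p \<cdot>\<^bsub>C\<^esub> u = v \<cdot>\<^bsub>C\<^esub> i \<longrightarrow>
        (\<exists>h\<in>Hom C (Cod C i) (Dom C p). h \<cdot>\<^bsub>C\<^esub> i = u \<and> p \<cdot>\<^bsub>C\<^esub> h = v))"

locale model_category = category M
  for U :: "'u itself" and M :: "('o, 'a, 'z) model_scheme" (structure) +
  assumes Weq_Arr: "Weq M \<subseteq> Arr M" and Cof_Arr: "Cof M \<subseteq> Arr M" and Fib_Arr: "Fib M \<subseteq> Arr M"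
    and limits: "has_small_limits U M"
    and colimits: "has_small_colimits U M"
    and two_of_three:
      "f \<in> Hom M a b \<Longrightarrow> g \<in> Hom M b c \<Longrightarrow> f \<in> Weq M \<Longrightarrow> g \<in> Weq M \<Longrightarrow> g \<cdot> f \<in> Weq M"
      "f \<in> Hom M a b \<Longrightarrow> g \<in> Hom M b c \<Longrightarrow> f \<in> Weq M \<Longrightarrow> g \<cdot> f \<in> Weq M \<Longrightarrow> g \<in> Weq M"
      "f \<in> Hom M a b \<Longrightarrow> g \<in> Hom M b c \<Longrightarrow> g \<in> Weq M \<Longrightarrow> g \<cdot> f \<in> Weq M \<Longrightarrow> f \<in> Weq M"
    and retracts:
      "is_retract M f g \<Longrightarrow> g \<in> Weq M \<Longrightarrow> f \<in> Weq M"
      "is_retract M f g \<Longrightarrow> g \<in> Cof M \<Longrightarrow> f \<in> Cof M"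
      "is_retract M f g \<Longrightarrow> g \<in> Fib M \<Longrightarrow> f \<in> Fib M"
    and lifting:
      "i \<in> Cof M \<Longrightarrow> p \<in> Fib M \<inter> Weq M \<Longrightarrow> has_lifting M i p"
      "i \<in> Cof M \<inter> Weq M \<Longrightarrow> p \<in> Fib M \<Longrightarrow> has_lifting M i p"
    and factorization:
      "f \<in> Arr M \<Longrightarrow> \<exists>i\<in>Cof M. \<exists>p\<in>Fib M \<inter> Weq M. Dom M p = Cod M i \<and> f = p \<cdot> i"
      "f \<in> Arr M \<Longrightarrow> \<exists>i\<in>Cof M \<inter> Weq M. \<exists>p\<in>Fib M. Dom M p = Cod M i \<and> f = p \<cdot> i"

definition cofibrant :: "('o, 'a, 'z) model_scheme \<Rightarrow> 'o \<Rightarrow> bool" where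
  "cofibrant M x \<longleftrightarrow> x \<in> Obj M \<and> (\<exists>i f. is_initial M i \<and> f \<in> Hom M i x \<and> f \<in> Cof M)"

definition fibrant :: "('o, 'a, 'z) model_scheme \<Rightarrow> 'o \<Rightarrow> bool" where
  "fibrant M x \<longleftrightarrow> x \<in> Obj M \<and> (\<exists>t f. is_terminal M t \<and> f \<in> Hom M x t \<and> f \<in> Fib M)"


section \<open>Reedy categories\<close>

text \<open>The two subcategories contain all objects, so they are given by their sets of arrows.\<close>

record ('o, 'a) reedy = "('o, 'a) cat" +
  Direct :: "'a set"
  Inverse :: "'a set"

definition wide_subcategory :: "('o, 'a, 'z) cat_scheme \<Rightarrow> 'a set \<Rightarrow> bool" where
  "wide_subcategory C S \<longleftrightarrow> S \<subseteq> Arr C \<and> (\<forall>a\<in>Obj C. Ide C a \<in> S) \<and>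
     (\<forall>f\<in>S. \<forall>g\<in>S. Dom C g = Cod C f \<longrightarrow> g \<cdot>\<^bsub>C\<^esub> f \<in> S)"

locale reedy_category = category C
  for C :: "('o, 'a, 'z) reedy_scheme" (structure) +
  assumes Direct_sub: "wide_subcategory C (Direct C)"
    and Inverse_sub: "wide_subcategory C (Inverse C)"
    and degree: "\<exists>deg :: 'o \<Rightarrow> nat.
      (\<forall>f\<in>Direct C. f \<noteq> Ide C (Dom C f) \<longrightarrow> deg (Dom C f) < deg (Cod C f)) \<and>
      (\<forall>f\<in>Inverse C. f \<noteq> Ide C (Dom C f) \<longrightarrow> deg (Cod C f) < deg (Dom C f))"
    and factors: "g \<in> Arr C \<Longrightarrow>
      \<exists>!(d, e). d \<in> Direct C \<and> e \<in> Inverse C \<and> Dom C d = Cod C e \<and> g = d \<cdot> e"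

definition op_reedy :: "('o, 'a) reedy \<Rightarrow> ('o, 'a) reedy" where
  "op_reedy C =
     \<lparr>Obj = Obj C, Arr = Arr C, Dom = Cod C, Cod = Dom C, Ide = Ide C, Cmp = (\<lambda>g f. f \<cdot>\<^bsub>C\<^esub> g),
      Direct = Inverse C, Inverse = Direct C\<rparr>"

text \<open>The \<open>m\<close>-fold product; tuples are extensional functions on \<open>{..<m}\<close>.\<close>

definition power_reedy :: "('o, 'a) reedy \<Rightarrow> nat \<Rightarrow> (nat \<Rightarrow> 'o, nat \<Rightarrow> 'a) reedy" where
  "power_reedy C m =
     \<lparr>Obj = {..<m} \<rightarrow>\<^sub>E Obj C, Arr = {..<m} \<rightarrow>\<^sub>E Arr C,
      Dom = (\<lambda>f. \<lambda>i\<in>{..<m}. Dom C (f i)), Cod = (\<lambda>f. \<lambda>i\<in>{..<m}. Cod C (f i)),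
      Ide = (\<lambda>a. \<lambda>i\<in>{..<m}. Ide C (a i)),
      Cmp = (\<lambda>g f. \<lambda>i\<in>{..<m}. g i \<cdot>\<^bsub>C\<^esub> f i),
      Direct = {..<m} \<rightarrow>\<^sub>E Direct C, Inverse = {..<m} \<rightarrow>\<^sub>E Inverse C\<rparr>"


section \<open>Latching and matching objects, and the Reedy model structure\<close>

text \<open>The full subcategory of \<open>(Direct C \<down> a)\<close> on all objects except the identity: an object is the
  structure arrow \<open>f\<close> into \<open>a\<close>, and \<open>(f, g, h)\<close> is the arrow from \<open>f\<close> to \<open>g\<close> given by \<open>h\<close>. The
  matching category is the corresponding full subcategory of \<open>(a \<down> Inverse C)\<close>.\<close>

definition latching_cat :: "('o, 'a, 'z) reedy_scheme \<Rightarrow> 'o \<Rightarrow> ('a, 'a \<times> 'a \<times> 'a) cat" where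
  "latching_cat C a =
     (let Ob = {f \<in> Direct C. Cod C f = a \<and> f \<noteq> Ide C a} in
      \<lparr>Obj = Ob,
       Arr = {(f, g, h). f \<in> Ob \<and> g \<in> Ob \<and> h \<in> Direct C \<inter> Hom C (Dom C f) (Dom C g) \<and>
                g \<cdot>\<^bsub>C\<^esub> h = f},
       Dom = (\<lambda>(f, g, h). f),
       Cod = (\<lambda>(f, g, h). g),
       Ide = (\<lambda>f. (f, f, Ide C (Dom C f))),
       Cmp = (\<lambda>(g, k, h') (f, g', h). (f, k, h' \<cdot>\<^bsub>C\<^esub> h))\<rparr>)"

definition matching_cat :: "('o, 'a, 'z) reedy_scheme \<Rightarrow> 'o \<Rightarrow> ('a, 'a \<times> 'a \<times> 'a) cat" where
  "matching_cat C a =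
     (let Ob = {f \<in> Inverse C. Dom C f = a \<and> f \<noteq> Ide C a} in
      \<lparr>Obj = Ob,
       Arr = {(f, g, h). f \<in> Ob \<and> g \<in> Ob \<and> h \<in> Inverse C \<inter> Hom C (Cod C f) (Cod C g) \<and>
                h \<cdot>\<^bsub>C\<^esub> f = g},
       Dom = (\<lambda>(f, g, h). f),
       Cod = (\<lambda>(f, g, h). g),
       Ide = (\<lambda>f. (f, f, Ide C (Cod C f))),
       Cmp = (\<lambda>(g, k, h') (f, g', h). (f, k, h' \<cdot>\<^bsub>C\<^esub> h))\<rparr>)"

definition latching_diagram ::
  "('o1, 'a1, 'z) reedy_scheme \<Rightarrow> 'o1 \<Rightarrow> ('o1, 'a1, 'o2, 'a2) fctr
     \<Rightarrow> ('a1, 'a1 \<times> 'a1 \<times> 'a1, 'o2, 'a2) fctr"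
where
  "latching_diagram C a X =
     restrict_along (latching_cat C a) X \<lparr>FObj = Dom C, FArr = (\<lambda>(f, g, h). h)\<rparr>"

definition matching_diagram ::
  "('o1, 'a1, 'z) reedy_scheme \<Rightarrow> 'o1 \<Rightarrow> ('o1, 'a1, 'o2, 'a2) fctr
     \<Rightarrow> ('a1, 'a1 \<times> 'a1 \<times> 'a1, 'o2, 'a2) fctr"
where
  "matching_diagram C a X =
     restrict_along (matching_cat C a) X \<lparr>FObj = Cod C, FArr = (\<lambda>(f, g, h). h)\<rparr>"

definition latching ::
  "('o1, 'a1, 'y) reedy_scheme \<Rightarrow> ('o2, 'a2, 'z) cat_scheme \<Rightarrow> 'o1
     \<Rightarrow> ('o1, 'a1, 'o2, 'a2) fctr \<Rightarrow> 'o2 \<times> ('a1 \<Rightarrow> 'a2)"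
where
  "latching C M a X = colim (latching_cat C a) M (latching_diagram C a X)"

definition matching ::
  "('o1, 'a1, 'y) reedy_scheme \<Rightarrow> ('o2, 'a2, 'z) cat_scheme \<Rightarrow> 'o1
     \<Rightarrow> ('o1, 'a1, 'o2, 'a2) fctr \<Rightarrow> 'o2 \<times> ('a1 \<Rightarrow> 'a2)"
where
  "matching C M a X = lim (matching_cat C a) M (matching_diagram C a X)"

text \<open>The canonical maps \<open>L\<^sub>a X \<rightarrow> X\<^sub>a\<close> and \<open>X\<^sub>a \<rightarrow> M\<^sub>a X\<close>.\<close>

definition latching_map ::
  "('o1, 'a1, 'y) reedy_scheme \<Rightarrow> ('o2, 'a2, 'z) cat_scheme \<Rightarrow> 'o1
     \<Rightarrow> ('o1, 'a1, 'o2, 'a2) fctr \<Rightarrow> 'a2"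
where
  "latching_map C M a X =
     colim_ind (latching_cat C a) M (latching_diagram C a X) (FObj X a) (FArr X)"

definition matching_map ::
  "('o1, 'a1, 'y) reedy_scheme \<Rightarrow> ('o2, 'a2, 'z) cat_scheme \<Rightarrow> 'o1
     \<Rightarrow> ('o1, 'a1, 'o2, 'a2) fctr \<Rightarrow> 'a2"
where
  "matching_map C M a X =
     lim_ind (matching_cat C a) M (matching_diagram C a X) (FObj X a) (FArr X)"

text \<open>The maps \<open>L\<^sub>a X \<rightarrow> L\<^sub>a Y\<close> and \<open>M\<^sub>a X \<rightarrow> M\<^sub>a Y\<close> induced by a natural transformation.\<close>

definition latching_fun ::
  "('o1, 'a1, 'y) reedy_scheme \<Rightarrow> ('o2, 'a2, 'z) cat_scheme \<Rightarrow> 'o1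
     \<Rightarrow> ('o1, 'a1, 'o2, 'a2) nattr \<Rightarrow> 'a2"
where
  "latching_fun C M a = (\<lambda>(X, Y, \<tau>).
     colim_ind (latching_cat C a) M (latching_diagram C a X) (fst (latching C M a Y))
       (\<lambda>f. snd (latching C M a Y) f \<cdot>\<^bsub>M\<^esub> \<tau> (Dom C f)))"

definition matching_fun ::
  "('o1, 'a1, 'y) reedy_scheme \<Rightarrow> ('o2, 'a2, 'z) cat_scheme \<Rightarrow> 'o1
     \<Rightarrow> ('o1, 'a1, 'o2, 'a2) nattr \<Rightarrow> 'a2"
where
  "matching_fun C M a = (\<lambda>(X, Y, \<tau>).
     lim_ind (matching_cat C a) M (matching_diagram C a Y) (fst (matching C M a X))
       (\<lambda>f. \<tau> (Cod C f) \<cdot>\<^bsub>M\<^esub> snd (matching C M a X) f))"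

text \<open>The maps \<open>X\<^sub>a \<amalg> L\<^sub>a Y \<rightarrow> Y\<^sub>a\<close> (pushout over \<open>L\<^sub>a X\<close>) and \<open>X\<^sub>a \<rightarrow> Y\<^sub>a \<times> M\<^sub>a X\<close> (pullback over
  \<open>M\<^sub>a Y\<close>).\<close>

definition relative_latching_map ::
  "('o1, 'a1, 'y) reedy_scheme \<Rightarrow> ('o2, 'a2, 'z) cat_scheme \<Rightarrow> 'o1
     \<Rightarrow> ('o1, 'a1, 'o2, 'a2) nattr \<Rightarrow> 'a2"
where
  "relative_latching_map C M a = (\<lambda>(X, Y, \<tau>).
     pushout_ind M (latching_map C M a X) (latching_fun C M a (X, Y, \<tau>))
       (\<tau> a) (latching_map C M a Y))"

definition relative_matching_map ::
  "('o1, 'a1, 'y) reedy_scheme \<Rightarrow> ('o2, 'a2, 'z) cat_scheme \<Rightarrow> 'o1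
     \<Rightarrow> ('o1, 'a1, 'o2, 'a2) nattr \<Rightarrow> 'a2"
where
  "relative_matching_map C M a = (\<lambda>(X, Y, \<tau>).
     pullback_ind M (matching_map C M a Y) (matching_fun C M a (X, Y, \<tau>))
       (\<tau> a) (matching_map C M a X))"

definition reedy_model ::
  "('o1, 'a1, 'y) reedy_scheme \<Rightarrow> ('o2, 'a2, 'z) model_scheme
     \<Rightarrow> (('o1, 'a1, 'o2, 'a2) fctr, ('o1, 'a1, 'o2, 'a2) nattr) model"
where
  "reedy_model C M = cat.extend (functor_cat C M)
     \<lparr>Weq = {(X, Y, \<tau>). is_nattr C M (X, Y, \<tau>) \<and> (\<forall>a\<in>Obj C. \<tau> a \<in> Weq M)},
      Cof = {t. is_nattr C M t \<and> (\<forall>a\<in>Obj C. relative_latching_map C M a t \<in> Cof M)},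
      Fib = {t. is_nattr C M t \<and> (\<forall>a\<in>Obj C. relative_matching_map C M a t \<in> Fib M)}\<rparr>"


section \<open>(Co)simplicial objects and slices\<close>

text \<open>The object \<open>[n]\<close> is represented by \<open>n\<close>, and \<open>(n, k, f)\<close> is the weakly monotone function \<open>f\<close>
  from \<open>[n]\<close> to \<open>[k]\<close>.\<close>

definition Delta :: "(nat, nat \<times> nat \<times> (nat \<Rightarrow> nat)) reedy" where
  "Delta =
     (let Ar = {(n, k, f). f \<in> {0..n} \<rightarrow>\<^sub>E {0..k} \<and> mono_on {0..n} f} in
      \<lparr>Obj = UNIV,
       Arr = Ar,
       Dom = (\<lambda>(n, k, f). n),
       Cod = (\<lambda>(n, k, f). k),
       Ide = (\<lambda>n. (n, n, \<lambda>i\<in>{0..n}. i)),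
       Cmp = (\<lambda>(k, l, g) (n, k', f). (n, l, \<lambda>i\<in>{0..n}. g (f i))),
       Direct = {(n, k, f) \<in> Ar. inj_on f {0..n}},
       Inverse = {(n, k, f) \<in> Ar. f ` {0..n} = {0..k}}\<rparr>)"

abbreviation cosimplicial where "cosimplicial \<equiv> reedy_model Delta"
abbreviation simplicial where "simplicial \<equiv> reedy_model (op_reedy Delta)"
abbreviation multicosimplicial where
  "multicosimplicial m \<equiv> reedy_model (power_reedy Delta m)"
abbreviation multisimplicial where
  "multisimplicial m \<equiv> reedy_model (power_reedy (op_reedy Delta) m)"

text \<open>The functor from \<open>C\<close> to its \<open>m\<close>-th power which is the identity in coordinate \<open>p\<close> and constant
  at \<open>c i\<close> in each coordinate \<open>i \<noteq> p\<close>; the value \<open>c p\<close> is irrelevant.\<close>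

definition slice_functor ::
  "('o, 'a) reedy \<Rightarrow> nat \<Rightarrow> nat \<Rightarrow> (nat \<Rightarrow> 'o) \<Rightarrow> ('o, 'a, nat \<Rightarrow> 'o, nat \<Rightarrow> 'a) fctr"
where
  "slice_functor C m p c =
     \<lparr>FObj = \<lambda>a\<in>Obj C. \<lambda>i\<in>{..<m}. if i = p then a else c i,
      FArr = \<lambda>f\<in>Arr C. \<lambda>i\<in>{..<m}. if i = p then f else Ide C (c i)\<rparr>"

definition slices ::
  "('o1, 'a1) reedy \<Rightarrow> nat \<Rightarrow> (nat \<Rightarrow> 'o1, nat \<Rightarrow> 'a1, 'o2, 'a2) fctr
     \<Rightarrow> ('o1, 'a1, 'o2, 'a2) fctr set"
where
  "slices C m X =
     {restrict_along C X (slice_functor C m p c) | p c. p < m \<and> (\<forall>i<m. i \<noteq> p \<longrightarrow> c i \<in> Obj C)}"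


section \<open>The index categories are Reedy categories\<close>

lemma Hom_iff: "f \<in> Hom C a b \<longleftrightarrow> f \<in> Arr C \<and> Dom C f = a \<and> Cod C f = b"
  by (simp add: Hom_def)

lemma category_op: "category (C :: ('o,'a) reedy) \<Longrightarrow> category (op_reedy C)"
  unfolding category_def by (simp add: op_reedy_def Hom_def)

lemma Hom_power_iff: "f \<in> Hom (power_reedy C m) a b \<longleftrightarrow> f \<in> {..<m} \<rightarrow>\<^sub>E Arr C \<and> a = (\<lambda>i\<in>{..<m}. Dom C (f i)) \<and> b = (\<lambda>i\<in>{..<m}. Cod C (f i))"
  by (auto simp: power_reedy_def Hom_def)

lemma category_power: assumes "category (C :: ('o,'a) reedy)" shows "category (power_reedy C m)"
proof -
  interpret category C by fact
  show ?thesis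
  proof
    fix f a b assume f: "f \<in> Hom (power_reedy C m) a b"
    show "Cmp (power_reedy C m) f (Ide (power_reedy C m) a) = f" "Cmp (power_reedy C m) (Ide (power_reedy C m) b) f = f"
      using f Cmp_Ide Ide_Cmp
      by (auto simp: Hom_power_iff Hom_iff PiE_iff power_reedy_def intro!: extensionalityI[of _ "{..<m}"])
    fix g c assume g: "g \<in> Hom (power_reedy C m) b c"
    have h: "Dom C (g i) = Cod C (f i)" if "i < m" for i proof -
      have "(\<lambda>i\<in>{..<m}. Dom C (g i)) i = (\<lambda>i\<in>{..<m}. Cod C (f i)) i" using f g by (simp add: Hom_power_iff)
      then show ?thesis using that by simp
    qed
    have fa: "f i \<in> Arr C" "g i \<in> Arr C" if "i < m" for i using that f g by (auto simp: Hom_power_iff)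
    have k: "Cmp C (g i) (f i) \<in> Hom C (Dom C (f i)) (Cod C (g i))" if "i < m" for i
      using Cmp_in[of "f i" "Dom C (f i)" "Cod C (f i)" "g i" "Cod C (g i)"] fa[OF that] h[OF that] by (simp add: Hom_iff)
    show "Cmp (power_reedy C m) g f \<in> Hom (power_reedy C m) a c"
      using k f g unfolding Hom_power_iff by (auto simp: power_reedy_def Hom_iff intro!: restrict_ext)
    fix h d assume hh: "h \<in> Hom (power_reedy C m) c d"
    have h': "Dom C (h i) = Cod C (g i)" if "i < m" for i proof -
      have "(\<lambda>i\<in>{..<m}. Dom C (h i)) i = (\<lambda>i\<in>{..<m}. Cod C (g i)) i" using hh g by (simp add: Hom_power_iff)
      then show ?thesis using that by simp
    qed
    have fa': "h i \<in> Arr C" if "i < m" for i using that hh by (auto simp: Hom_power_iff)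
    show "Cmp (power_reedy C m) (Cmp (power_reedy C m) h g) f = Cmp (power_reedy C m) h (Cmp (power_reedy C m) g f)"
      using Cmp_assoc fa fa' h h' by (auto simp: power_reedy_def Hom_iff intro!: restrict_ext)
  qed (use Dom_in Cod_in Ide_in in \<open>auto simp: power_reedy_def Hom_iff PiE_iff intro!: restrict_ext extensionalityI[of _ "{..<m}"]\<close>)
qed

lemma category_Delta: "category Delta"
proof
  fix f g h :: "nat \<times> nat \<times> (nat \<Rightarrow> nat)" and a b c d
  show "f \<in> Arr Delta \<Longrightarrow> Dom Delta f \<in> Obj Delta" "f \<in> Arr Delta \<Longrightarrow> Cod Delta f \<in> Obj Delta"
    by (simp_all add: Delta_def Let_def)
  show "Ide Delta a \<in> Hom Delta a a" by (auto simp: Delta_def Let_def Hom_def mono_on_def)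
  assume f: "f \<in> Hom Delta a b"
  then show "Cmp Delta f (Ide Delta a) = f" 
    by (cases f) (auto simp: Delta_def Let_def Hom_def fun_eq_iff PiE_iff extensional_def)
  from f show "Cmp Delta (Ide Delta b) f = f" 
    by (cases f) (auto simp: Delta_def Let_def Hom_def fun_eq_iff PiE_iff extensional_def)
  assume g: "g \<in> Hom Delta b c"
  show "Cmp Delta g f \<in> Hom Delta a c" using f g 
    by (cases f; cases g) (auto simp: Delta_def Let_def Hom_def PiE_iff mono_on_def)
  assume h: "h \<in> Hom Delta c d"
  show "Cmp Delta (Cmp Delta h g) f = Cmp Delta h (Cmp Delta g f)" using f g h
    by (cases f; cases g; cases h) (auto simp: Delta_def Let_def Hom_def PiE_iff fun_eq_iff)
qed

lemma reedy_category_op: assumes "reedy_category (C :: ('o,'a) reedy)" shows "reedy_category (op_reedy C)"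
proof -
  interpret reedy_category C by fact
  interpret O: category "op_reedy C" by (rule category_op) unfold_locales
  show ?thesis
  proof
    show "wide_subcategory (op_reedy C) (Direct (op_reedy C))" "wide_subcategory (op_reedy C) (Inverse (op_reedy C))"
      using Direct_sub Inverse_sub unfolding wide_subcategory_def op_reedy_def by auto
    have 1: "Ide C (Cod C f) = f" if "f = Ide C (Dom C f)" "f \<in> Arr C" for f
      using that Ide_in[OF Dom_in[OF that(2)]] by (simp add: Hom_iff)
    have 2: "Ide C (Dom C f) = f" if "f = Ide C (Cod C f)" "f \<in> Arr C" for f
      using that Ide_in[OF Cod_in[OF that(2)]] by (simp add: Hom_iff)
    have s: "f \<in> Arr C" if "f \<in> Direct C \<or> f \<in> Inverse C" for f using that Direct_sub Inverse_sub by (auto simp: wide_subcategory_def)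
    obtain deg :: "'o \<Rightarrow> nat" where d: "\<And>f. f\<in>Direct C \<Longrightarrow> f \<noteq> Ide C (Dom C f) \<Longrightarrow> deg (Dom C f) < deg (Cod C f)"
      "\<And>f. f\<in>Inverse C \<Longrightarrow> f \<noteq> Ide C (Dom C f) \<Longrightarrow> deg (Cod C f) < deg (Dom C f)" using degree by blast
    show "\<exists>deg :: 'o \<Rightarrow> nat.
      (\<forall>f\<in>Direct (op_reedy C). f \<noteq> Ide (op_reedy C) (Dom (op_reedy C) f) \<longrightarrow> deg (Dom (op_reedy C) f) < deg (Cod (op_reedy C) f)) \<and>
      (\<forall>f\<in>Inverse (op_reedy C). f \<noteq> Ide (op_reedy C) (Dom (op_reedy C) f) \<longrightarrow> deg (Cod (op_reedy C) f) < deg (Dom (op_reedy C) f))"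
      apply (rule exI[of _ deg]) using d 1 2 s by (simp add: op_reedy_def) metis
    fix g assume "g \<in> Arr (op_reedy C)"
    then have "\<exists>!(d, e). d \<in> Direct C \<and> e \<in> Inverse C \<and> Dom C d = Cod C e \<and> g = Cmp C d e"
      using factors by (simp add: op_reedy_def)
    then obtain d e where de: "d \<in> Direct C" "e \<in> Inverse C" "Dom C d = Cod C e" "g = Cmp C d e"
      and u: "\<And>d' e'. d' \<in> Direct C \<Longrightarrow> e' \<in> Inverse C \<Longrightarrow> Dom C d' = Cod C e' \<Longrightarrow> g = Cmp C d' e' \<Longrightarrow> d' = d \<and> e' = e"
      by fast
    show "\<exists>!(d, e). d \<in> Direct (op_reedy C) \<and> e \<in> Inverse (op_reedy C) \<and> Dom (op_reedy C) d = Cod (op_reedy C) e \<and> g = Cmp (op_reedy C) d e"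
      proof (rule ex1I[of _ "(e, d)"])
      show "case (e, d) of (d, e) \<Rightarrow> d \<in> Direct (op_reedy C) \<and> e \<in> Inverse (op_reedy C) \<and> Dom (op_reedy C) d = Cod (op_reedy C) e \<and> g = Cmp (op_reedy C) d e"
        using de by (simp add: op_reedy_def)
      fix p assume "case p of (d, e) \<Rightarrow> d \<in> Direct (op_reedy C) \<and> e \<in> Inverse (op_reedy C) \<and> Dom (op_reedy C) d = Cod (op_reedy C) e \<and> g = Cmp (op_reedy C) d e"
      then show "p = (e, d)" using u[of "snd p" "fst p"] by (cases p) (simp add: op_reedy_def)
    qed
  qed
qed

lemma ex1_unique: "\<exists>!x. P x \<Longrightarrow> P a \<Longrightarrow> P b \<Longrightarrow> a = b" by blast

lemma reedy_category_power: assumes "reedy_category (C :: ('o,'a) reedy)" shows "reedy_category (power_reedy C m)"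
proof -
  interpret reedy_category C by fact
  interpret P: category "power_reedy C m" by (rule category_power) unfold_locales
  have wide: "wide_subcategory (power_reedy C m) ({..<m} \<rightarrow>\<^sub>E S)" if S: "wide_subcategory C S" for S
    unfolding wide_subcategory_def
  proof (intro conjI ballI impI)
    fix f g assume fg: "f \<in> {..<m} \<rightarrow>\<^sub>E S" "g \<in> {..<m} \<rightarrow>\<^sub>E S" and e: "Dom (power_reedy C m) g = Cod (power_reedy C m) f"
    have "Dom C (g i) = Cod C (f i)" if "i < m" for i
      using fun_cong[OF e, of i] that by (simp add: power_reedy_def)
    then show "Cmp (power_reedy C m) g f \<in> {..<m} \<rightarrow>\<^sub>E S"
      using S fg by (simp add: power_reedy_def wide_subcategory_def PiE_iff)
  qed (use S in \<open>auto simp: power_reedy_def wide_subcategory_def PiE_iff\<close>)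
  show ?thesis
  proof
    show "wide_subcategory (power_reedy C m) (Direct (power_reedy C m))" "wide_subcategory (power_reedy C m) (Inverse (power_reedy C m))"
      using wide[OF Direct_sub] wide[OF Inverse_sub] by (simp_all add: power_reedy_def)
    obtain deg :: "'o \<Rightarrow> nat" where d: "\<And>f. f\<in>Direct C \<Longrightarrow> f \<noteq> Ide C (Dom C f) \<Longrightarrow> deg (Dom C f) < deg (Cod C f)"
      "\<And>f. f\<in>Inverse C \<Longrightarrow> f \<noteq> Ide C (Dom C f) \<Longrightarrow> deg (Cod C f) < deg (Dom C f)" using degree by blast
    have s: "f \<in> Arr C" if "f \<in> Direct C \<or> f \<in> Inverse C" for f using that Direct_sub Inverse_sub by (auto simp: wide_subcategory_def)
    have d': "f\<in>Direct C \<Longrightarrow> deg (Dom C f) \<le> deg (Cod C f)" "f\<in>Inverse C \<Longrightarrow> deg (Cod C f) \<le> deg (Dom C f)" for f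
      using d[of f] s[of f] Ide_in[of "Dom C f"] Dom_in[of f] by (force simp: Hom_iff)+
    have n: "\<exists>i<m. f i \<noteq> Ide C (Dom C (f i))" if "f \<in> extensional {..<m}" "f \<noteq> (\<lambda>i\<in>{..<m}. Ide C (Dom C (f i)))" for f
      proof (rule ccontr)
      assume "\<not> ?thesis"
      then have "f = (\<lambda>i\<in>{..<m}. Ide C (Dom C (f i)))" using that(1) by (intro extensionalityI[of _ "{..<m}"]) auto
      with that(2) show False by simp
    qed
    show "\<exists>deg :: (nat \<Rightarrow> 'o) \<Rightarrow> nat.
      (\<forall>f\<in>Direct (power_reedy C m). f \<noteq> Ide (power_reedy C m) (Dom (power_reedy C m) f) \<longrightarrow> deg (Dom (power_reedy C m) f) < deg (Cod (power_reedy C m) f)) \<and>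
      (\<forall>f\<in>Inverse (power_reedy C m). f \<noteq> Ide (power_reedy C m) (Dom (power_reedy C m) f) \<longrightarrow> deg (Cod (power_reedy C m) f) < deg (Dom (power_reedy C m) f))"
    proof (intro exI[of _ "\<lambda>a. \<Sum>i<m. deg (a i)"] conjI ballI impI)
      fix f assume f: "f\<in>Direct (power_reedy C m)" "f \<noteq> Ide (power_reedy C m) (Dom (power_reedy C m) f)"
      have "f \<noteq> (\<lambda>i\<in>{..<m}. Ide C (Dom C (f i)))" using f(2) by (auto simp: power_reedy_def fun_eq_iff cong: restrict_cong)
      from n[OF _ this] f(1) obtain i where "i<m" "f i \<noteq> Ide C (Dom C (f i))" by (auto simp: power_reedy_def PiE_iff)
      then show "(\<Sum>i<m. deg (Dom (power_reedy C m) f i)) < (\<Sum>i<m. deg (Cod (power_reedy C m) f i))"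
        using f(1) d d' by (intro sum_strict_mono_ex1 bexI[of _ i]) (auto simp: power_reedy_def PiE_iff)
    next
      fix f assume f: "f\<in>Inverse (power_reedy C m)" "f \<noteq> Ide (power_reedy C m) (Dom (power_reedy C m) f)"
      have "f \<noteq> (\<lambda>i\<in>{..<m}. Ide C (Dom C (f i)))" using f(2) by (auto simp: power_reedy_def fun_eq_iff cong: restrict_cong)
      from n[OF _ this] f(1) obtain i where "i<m" "f i \<noteq> Ide C (Dom C (f i))" by (auto simp: power_reedy_def PiE_iff)
      then show "(\<Sum>i<m. deg (Cod (power_reedy C m) f i)) < (\<Sum>i<m. deg (Dom (power_reedy C m) f i))"
        using f(1) d d' by (intro sum_strict_mono_ex1 bexI[of _ i]) (auto simp: power_reedy_def PiE_iff)
    qed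
    fix g assume "g \<in> Arr (power_reedy C m)"
    then have g: "g \<in> {..<m} \<rightarrow>\<^sub>E Arr C" by (simp add: power_reedy_def)
    have "\<forall>i<m. \<exists>p. (\<lambda>(d, e). d \<in> Direct C \<and> e \<in> Inverse C \<and> Dom C d = Cod C e \<and> g i = Cmp C d e) p" 
      using g factors by (meson PiE_mem ex1_implies_ex lessThan_iff)
    then obtain p where p: "\<And>i. i < m \<Longrightarrow> (\<lambda>(d, e). d \<in> Direct C \<and> e \<in> Inverse C \<and> Dom C d = Cod C e \<and> g i = Cmp C d e) (p i)" by moura
    have u: "d = d' \<and> e = e'" if "i < m" "d \<in> Direct C \<and> e \<in> Inverse C \<and> Dom C d = Cod C e \<and> g i = Cmp C d e" "d' \<in> Direct C \<and> e' \<in> Inverse C \<and> Dom C d' = Cod C e' \<and> g i = Cmp C d' e'" for i d e d' e'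
    proof -
      have "g i \<in> Arr C" using g that(1) by auto
      from ex1_unique[OF factors[OF this], of "(d, e)" "(d', e')"] show ?thesis using that(2,3) by simp
    qed
    show "\<exists>!(d, e). d \<in> Direct (power_reedy C m) \<and> e \<in> Inverse (power_reedy C m) \<and> Dom (power_reedy C m) d = Cod (power_reedy C m) e \<and> g = Cmp (power_reedy C m) d e"
    proof (rule ex1I[of _ "(\<lambda>i\<in>{..<m}. fst (p i), \<lambda>i\<in>{..<m}. snd (p i))"], clarify, intro conjI)
      show "(\<lambda>i\<in>{..<m}. fst (p i)) \<in> Direct (power_reedy C m)" "(\<lambda>i\<in>{..<m}. snd (p i)) \<in> Inverse (power_reedy C m)"
        "Dom (power_reedy C m) (\<lambda>i\<in>{..<m}. fst (p i)) = Cod (power_reedy C m) (\<lambda>i\<in>{..<m}. snd (p i))"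
        "g = (\<lambda>i\<in>{..<m}. fst (p i)) \<cdot>\<^bsub>power_reedy C m\<^esub> (\<lambda>i\<in>{..<m}. snd (p i))"
        using p g by (auto simp: power_reedy_def split_beta fun_eq_iff PiE_iff extensional_def)
      fix y assume y: "case y of (d, e) \<Rightarrow> d \<in> Direct (power_reedy C m) \<and> e \<in> Inverse (power_reedy C m) \<and> Dom (power_reedy C m) d = Cod (power_reedy C m) e \<and> g = Cmp (power_reedy C m) d e"
      obtain d e where de: "y = (d,e)" by force
      have "d i = fst (p i) \<and> e i = snd (p i)" if "i < m" for i
      proof (rule u[OF that])
        show "d i \<in> Direct C \<and> e i \<in> Inverse C \<and> Dom C (d i) = Cod C (e i) \<and> g i = Cmp C (d i) (e i)"
          proof -
          have "Dom (power_reedy C m) d i = Cod (power_reedy C m) e i" "g i = Cmp (power_reedy C m) d e i" using y unfolding de by simp_all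
          then show ?thesis using y that unfolding de by (auto simp: power_reedy_def)
        qed
      qed (use p[OF that] in \<open>auto simp: split_beta\<close>)
      then show "y = (\<lambda>i\<in>{..<m}. fst (p i), \<lambda>i\<in>{..<m}. snd (p i))"
        using y unfolding de by (auto simp: power_reedy_def PiE_iff intro!: extensionalityI[of _ "{..<m}"])
    qed
  qed
qed

lemma reedy_category_Delta: "reedy_category Delta"
proof -
  interpret category Delta by (rule category_Delta)
  have sur: "k \<le> n" if "f ` {0..n} = {0..k}" for f and n k :: nat
    using card_image_le[of "{0..n}" f] that by simp
  have idn: "f = (\<lambda>i\<in>{0..n}. i)" if "f \<in> {0..n} \<rightarrow>\<^sub>E {0..n}" "mono_on {0..n} f" "inj_on f {0..n}" for f and n :: nat
  proof -
    have s: "strict_mono_on {0..n} f" 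
    proof (rule strict_mono_onI)
      fix i j assume "i \<in> {0..n}" "j \<in> {0..n}" "i < j"
      moreover from this have "f i \<le> f j" using that(2) by (simp add: mono_on_def)
      moreover have "f i \<noteq> f j" using calculation that(3) by (metis inj_on_eq_iff less_irrefl)
      ultimately show "f i < f j" by simp
    qed
    have "i \<le> f i" if "i \<le> n" for i using that
    proof (induction i)
      case (Suc i) then have "f i < f (Suc i)" using s by (auto simp: strict_mono_on_def) then show ?case using Suc by simp
    qed simp
    moreover have "f (n - i) \<le> n - i" if "i \<le> n" for i using that
    proof (induction i)
      case 0 then show ?case using \<open>f \<in> {0..n} \<rightarrow>\<^sub>E {0..n}\<close> by (auto simp: PiE_iff)
    next case (Suc i) then have "f (n - Suc i) < f (n - i)" using s by (auto simp: strict_mono_on_def) then show ?case using Suc by simp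
    qed
    then have "f i \<le> i" if "i \<le> n" for i using that by (metis diff_diff_cancel diff_le_self)
    ultimately show ?thesis using that(1) by (intro extensionalityI[of _ "{0..n}"]) (auto simp: PiE_iff intro: antisym)
  qed
  show ?thesis
  proof
    show "wide_subcategory Delta (Direct Delta)"
      unfolding wide_subcategory_def
    proof (intro conjI ballI impI)
      fix f g assume "f \<in> Direct Delta" "g \<in> Direct Delta" "Dom Delta g = Cod Delta f"
      then show "Cmp Delta g f \<in> Direct Delta"
        by (cases f; cases g) (auto simp: Delta_def Let_def PiE_iff mono_on_def inj_on_def)
    qed (auto simp: Delta_def Let_def mono_on_def inj_on_def)
    show "wide_subcategory Delta (Inverse Delta)"
      unfolding wide_subcategory_def
    proof (intro conjI ballI impI)
      fix f g assume "f \<in> Inverse Delta" "g \<in> Inverse Delta" "Dom Delta g = Cod Delta f"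
      then obtain n k l p q where f: "f = (n, k, p)" "p ` {0..n} = {0..k}" "mono_on {0..n} p" "p \<in> {0..n} \<rightarrow>\<^sub>E {0..k}"
        and g: "g = (k, l, q)" "q ` {0..k} = {0..l}" "mono_on {0..k} q" "q \<in> {0..k} \<rightarrow>\<^sub>E {0..l}"
        by (cases f; cases g) (auto simp: Delta_def Let_def)
      have "(\<lambda>i\<in>{0..n}. q (p i)) ` {0..n} = q ` (p ` {0..n})" by (simp add: image_image)
      also have "\<dots> = {0..l}" by (simp only: f g)
      finally show "Cmp Delta g f \<in> Inverse Delta" using f(3,4) g(3,4)
        by (simp add: f(1) g(1) Delta_def Let_def mono_on_def PiE_iff)
    qed (auto simp: Delta_def Let_def mono_on_def)
    show "\<exists>deg :: nat \<Rightarrow> nat.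
      (\<forall>f\<in>Direct Delta. f \<noteq> Ide Delta (Dom Delta f) \<longrightarrow> deg (Dom Delta f) < deg (Cod Delta f)) \<and>
      (\<forall>f\<in>Inverse Delta. f \<noteq> Ide Delta (Dom Delta f) \<longrightarrow> deg (Cod Delta f) < deg (Dom Delta f))"
    proof (intro exI[of _ "\<lambda>n. n"] conjI ballI impI)
      fix g assume g: "g \<in> Direct Delta" "g \<noteq> Ide Delta (Dom Delta g)"
      then obtain n k f where nkf: "g = (n, k, f)" and f: "f \<in> {0..n} \<rightarrow>\<^sub>E {0..k}" "mono_on {0..n} f" "inj_on f {0..n}"
        and ne: "k = n \<longrightarrow> f \<noteq> (\<lambda>i\<in>{0..n}. i)"
        by (cases g) (auto simp: Delta_def Let_def)
      have "f ` {0..n} \<subseteq> {0..k}" using f(1) by auto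
      from card_inj_on_le[OF f(3) this finite_atLeastAtMost] have "n \<le> k" by simp
      then have "n < k" using idn[of f n] f ne by (cases "n = k") auto
      then show "Dom Delta g < Cod Delta g" by (simp add: nkf Delta_def Let_def)
    next
      fix g assume g: "g \<in> Inverse Delta" "g \<noteq> Ide Delta (Dom Delta g)"
      then obtain n k f where nkf: "g = (n, k, f)" and f: "f \<in> {0..n} \<rightarrow>\<^sub>E {0..k}" "mono_on {0..n} f" "f ` {0..n} = {0..k}"
        and ne: "k = n \<longrightarrow> f \<noteq> (\<lambda>i\<in>{0..n}. i)"
        by (cases g) (auto simp: Delta_def Let_def)
      have "k \<le> n" using sur f(3) by auto
      moreover have "n = k \<Longrightarrow> inj_on f {0..n}" using f(3) by (intro eq_card_imp_inj_on) auto
      ultimately have "k < n" using idn[of f n] f ne by (cases "n = k") auto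
      then show "Cod Delta g < Dom Delta g" by (simp add: nkf Delta_def Let_def)
    qed
    fix g assume "g \<in> Arr Delta"
    then obtain n k f where g: "g = (n, k, f)" and f: "f \<in> {0..n} \<rightarrow>\<^sub>E {0..k}" "mono_on {0..n} f"
      by (auto simp: Delta_def Let_def)
    define S where "S = f ` {0..n}"
    define \<rho> where "\<rho> x = card {y\<in>S. y < x}" for x
    define r where "r = card S - 1"
    define d where "d = (\<lambda>j\<in>{0..r}. inv_into S \<rho> j)"
    define e where "e = (\<lambda>i\<in>{0..n}. \<rho> (f i))"
    have S: "finite S" "S \<noteq> {}" "S \<subseteq> {0..k}" using f by (auto simp: S_def)
    then have r: "card S = Suc r" by (simp add: r_def card_gt_0_iff)
    have mono: "\<rho> x < \<rho> y" if "x \<in> S" "x < y" for x y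
      unfolding \<rho>_def using that S by (intro psubset_card_mono) auto
    have inj: "inj_on \<rho> S" by (rule inj_onI) (metis mono less_irrefl linorder_neqE_nat)
    have lt: "\<rho> x < card S" if "x \<in> S" for x
      unfolding \<rho>_def using that S by (intro psubset_card_mono) auto
    have im: "\<rho> ` S = {0..r}"
      by (rule card_subset_eq) (use lt r inj in \<open>auto simp: card_image less_Suc_eq_le\<close>)
    have inv: "inv_into S \<rho> j \<in> S" "\<rho> (inv_into S \<rho> j) = j" if "j \<le> r" for j
      using im that by (auto intro!: inv_into_into f_inv_into_f)
    have mono': "\<rho> x \<le> \<rho> y" if "x \<le> y" for x y
      unfolding \<rho>_def using that S by (intro card_mono) auto
    have 1: "(r, k, d) \<in> Direct Delta"
    proof -
      have "inv_into S \<rho> i \<le> inv_into S \<rho> j" if "i \<le> j" "j \<le> r" for i j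
        using mono[OF inv(1), of j "inv_into S \<rho> i"] inv[of i] inv[of j] that by (metis le_trans linorder_not_le)
      moreover have "inj_on d {0..r}" by (rule inj_onI) (metis d_def inv(2) atLeastAtMost_iff restrict_apply')
      moreover have "inv_into S \<rho> j \<le> k" if "j \<le> r" for j using inv(1)[OF that] S(3) by auto
      ultimately show ?thesis by (auto simp: Delta_def d_def Let_def mono_on_def)
    qed
    have 2: "(n, r, e) \<in> Inverse Delta"
    proof -
      have "e ` {0..n} = {0..r}" unfolding im[symmetric] S_def e_def by (auto simp: image_iff)
      moreover have "mono_on {0..n} e" using f(2) mono' by (auto simp: mono_on_def e_def)
      moreover have "e \<in> {0..n} \<rightarrow>\<^sub>E {0..r}" using im by (auto simp: e_def S_def)
      ultimately show ?thesis by (simp add: Delta_def Let_def)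
    qed
    have "f i = d (e i)" if "i \<le> n" for i
    proof -
      have "f i \<in> S" using that by (auto simp: S_def)
      then show ?thesis using that im inv_into_f_f[OF inj, of "f i"] by (auto simp: d_def e_def)
    qed
    then have 3: "g = Cmp Delta (r, k, d) (n, r, e)"
      using f(1) by (auto simp: g Delta_def Let_def fun_eq_iff PiE_iff extensional_def)
    have 4: "p = (r, k, d) \<and> q = (n, r, e)"
      if p: "p \<in> Direct Delta" and q: "q \<in> Inverse Delta" and pq: "Dom Delta p = Cod Delta q" and c: "g = Cmp Delta p q" for p q
    proof -
      obtain l d' e' where p': "p = (l, k, d')" and q': "q = (n, l, e')"
        using pq c by (cases p; cases q) (auto simp: g Delta_def Let_def)
      have d': "d' \<in> {0..l} \<rightarrow>\<^sub>E {0..k}" "mono_on {0..l} d'" "inj_on d' {0..l}"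
        and e': "e' \<in> {0..n} \<rightarrow>\<^sub>E {0..l}" "mono_on {0..n} e'" "e' ` {0..n} = {0..l}"
        using p q by (auto simp: p' q' Delta_def Let_def)
      have fi: "f i = d' (e' i)" if "i \<le> n" for i using c that by (simp add: g p' q' Delta_def Let_def)
      have "S = d' ` (e' ` {0..n})" unfolding S_def image_image by (rule image_cong) (auto simp: fi)
      then have S': "S = d' ` {0..l}" using e'(3) by simp
      then have l: "l = r" using r d'(3) by (simp add: card_image)
      have sm: "d' i < d' j \<longleftrightarrow> i < j" if "i \<le> l" "j \<le> l" for i j
        using d'(2,3) that unfolding mono_on_def inj_on_def
        by (metis atLeastAtMost_iff le0 linorder_not_le order_le_less)
      have rho: "\<rho> (d' j) = j" if "j \<le> l" for j
      proof -
        have "{y\<in>S. y < d' j} = d' ` {..<j}" unfolding S' using sm that by auto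
        then show ?thesis unfolding \<rho>_def using d'(3) that
          by (simp add: card_image inj_on_subset subset_iff)
      qed
      have "e' = e"
      proof (rule extensionalityI[of _ "{0..n}"])
        fix i assume i: "i \<in> {0..n}"
        then have "e' i \<le> l" using e'(1) by (auto simp: PiE_iff)
        then show "e' i = e i" using i fi[of i] rho[of "e' i"] by (simp add: e_def)
      qed (use e' in \<open>auto simp: e_def PiE_iff\<close>)
      moreover have "d' = d"
      proof (rule extensionalityI[of _ "{0..l}"])
        fix j assume j: "j \<in> {0..l}"
        then have "d' j \<in> S" using S' by auto
        then show "d' j = d j" using rho[of j] inv_into_f_f[OF inj, of "d' j"] j l by (simp add: d_def)
      qed (use d' l in \<open>auto simp: d_def PiE_iff\<close>)
      ultimately show ?thesis using p' q' l by simp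
    qed
    show "\<exists>!(d, e). d \<in> Direct Delta \<and> e \<in> Inverse Delta \<and> Dom Delta d = Cod Delta e \<and> g = Cmp Delta d e"
    proof (rule ex1I[of _ "((r, k, d), (n, r, e))"])
      have "Dom Delta (r, k, d) = Cod Delta (n, r, e)" by (simp add: Delta_def Let_def)
      with 1 2 3 show "case ((r, k, d), (n, r, e)) of (d, e) \<Rightarrow> d \<in> Direct Delta \<and> e \<in> Inverse Delta \<and> Dom Delta d = Cod Delta e \<and> g = Cmp Delta d e"
        by (simp only: prod.case)
      fix p assume "case p of (d, e) \<Rightarrow> d \<in> Direct Delta \<and> e \<in> Inverse Delta \<and> Dom Delta d = Cod Delta e \<and> g = Cmp Delta d e"
      then show "p = ((r, k, d), (n, r, e))" using 4[of "fst p" "snd p"] by (cases p) (simp only: prod.case fst_conv snd_conv)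
    qed
  qed
qed

end

theory Submission
  imports Defs "HOL-Library.Countable_Set"
begin

text \<open>
  Cofibrations are the maps with the left lifting property against trivial fibrations
  (\<open>cofibration_iff_lifting\<close>), and a map out of a latching object is a compatible family of maps out
  of the values of the diagram. So Reedy cofibrancy of \<open>X\<close> can be restated with neither latching
  objects nor pushouts (\<open>cofibrant_iff_latching_lifting\<close>): for every object \<open>a\<close> and every trivial
  fibration \<open>q : E \<rightarrow> B\<close>, a compatible family of maps \<open>X\<^sub>d \<rightarrow> E\<close>, indexed by the non-identity direct
  arrows \<open>d \<rightarrow> a\<close> and lying over a given map \<open>X\<^sub>a \<rightarrow> B\<close>, extends to a map \<open>X\<^sub>a \<rightarrow> E\<close> over it. This is the
  predicate \<open>latching_lifting\<close>.

  In this form the property propagates from the family of all non-identity direct arrows into \<open>\<alpha>\<close> to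
  every sieve \<open>A\<close> of direct arrows into \<open>\<alpha>\<close> (\<open>sieve_extension\<close>): a compatible family on \<open>A\<close> is
  enlarged degree by degree, each new value being a lift at the domain of the new arrow, until the
  identity of \<open>\<alpha>\<close> is reached.

  Now let \<open>S\<close> be a slice of a diagram \<open>X\<close> on \<open>C\<^sup>m\<close>, with free coordinate \<open>p\<close>, and let \<open>\<alpha>\<close> be the image
  of \<open>a\<close> under the slice functor \<open>G\<close>. The direct arrows into \<open>\<alpha>\<close> whose coordinate \<open>p\<close> is not an
  identity form a sieve. Each such \<open>\<psi>\<close> is \<open>G (\<psi> p)\<close> after an arrow that is the identity in
  coordinate \<open>p\<close>, so a family for \<open>S\<close> at \<open>a\<close> pulls back to a family for \<open>X\<close> on this sieve. The
  extension of the latter to \<open>X\<^sub>\<alpha> = S\<^sub>a\<close> is the lift needed for \<open>S\<close> (\<open>slice_latching_lifting\<close>).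

  This treats cofibrant diagrams over an arbitrary Reedy category. The fibrant case is the same
  statement for the opposite model category and the opposite Reedy category, since matching objects
  are latching objects there (\<open>fibrant_iff_cofibrant_op\<close>). Both cases are then applied to
  \<open>\<Delta>\<close> and to its opposite.
\<close>

section \<open>Colimits over countable index categories\<close>

lemma (in category) is_cocone_Cmp:
  assumes J: "category J" "is_functor J C F"
    and l: "is_cocone J C F l \<iota>" and h: "h \<in> Hom C l x"
  shows "is_cocone J C F x (\<lambda>j. h \<cdot> \<iota> j)"
proof -
  interpret J: category J by fact
  show ?thesis unfolding is_cocone_def
  proof (intro conjI ballI)
    show "x \<in> Obj C" using h Cod_in by (auto simp: Hom_iff)
    show "h \<cdot> \<iota> j \<in> Hom C (FObj F j) x" if "j \<in> Obj J" for j
      using l h that by (auto simp: is_cocone_def intro: Cmp_in)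
    fix u assume u: "u \<in> Arr J"
    have "(h \<cdot> \<iota> (Cod J u)) \<cdot> FArr F u = h \<cdot> (\<iota> (Cod J u) \<cdot> FArr F u)"
      using l h u J(2) J.Cod_in J.Dom_in by (intro Cmp_assoc) (auto simp: is_cocone_def is_functor_def)
    then show "(h \<cdot> \<iota> (Cod J u)) \<cdot> FArr F u = h \<cdot> \<iota> (Dom J u)"
      using l u by (simp add: is_cocone_def)
  qed
qed

lemma (in category) colimit_arrows_eq:
  assumes J: "category J" "is_functor J C F" and l: "is_colimit J C F l \<iota>"
    and h: "h \<in> Hom C l x" "h' \<in> Hom C l x" "\<And>j. j \<in> Obj J \<Longrightarrow> h \<cdot> \<iota> j = h' \<cdot> \<iota> j"
  shows "h = h'"
proof -
  have "is_cocone J C F x (\<lambda>j. h \<cdot> \<iota> j)"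
    using is_cocone_Cmp[OF J _ h(1)] l by (simp add: is_colimit_def)
  then have "\<exists>!k. k \<in> Hom C l x \<and> (\<forall>j\<in>Obj J. k \<cdot> \<iota> j = h \<cdot> \<iota> j)"
    using l by (simp add: is_colimit_def)
  then show ?thesis using h by (metis (no_types, lifting))
qed

lemma (in category) pushout_arrows_eq:
  assumes po: "is_pushout C f g r p q" and f: "f \<in> Hom C l y" and g: "g \<in> Hom C l z"
    and h: "h \<in> Hom C r x" "h' \<in> Hom C r x" "h \<cdot> p = h' \<cdot> p" "h \<cdot> q = h' \<cdot> q"
  shows "h = h'"
proof -
  have pq: "p \<in> Hom C y r" "q \<in> Hom C z r" "p \<cdot> f = q \<cdot> g"
    using po f g by (auto simp: is_pushout_def Hom_iff)
  have "(h \<cdot> p) \<cdot> f = (h \<cdot> q) \<cdot> g"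
    using Cmp_assoc[OF f pq(1) h(1)] Cmp_assoc[OF g pq(2) h(1)] pq(3) by simp
  then have "\<exists>!k. k \<in> Hom C r x \<and> k \<cdot> p = h \<cdot> p \<and> k \<cdot> q = h \<cdot> q"
    using po Cmp_in[OF pq(1) h(1)] Cmp_in[OF pq(2) h(1)] f g by (simp add: is_pushout_def Hom_iff)
  then show ?thesis using h by metis
qed

lemma (in category) initial_arrow:
  assumes "is_initial C z" "x \<in> Obj C"
  obtains h where "h \<in> Hom C z x"
  using assms unfolding is_initial_def by (meson ex1_implies_ex)

lemma (in category) initial_arrows_eq:
  assumes "is_initial C z" "h \<in> Hom C z x" "h' \<in> Hom C z x"
  shows "h = h'"
  using assms Cod_in unfolding is_initial_def by (metis Hom_iff)

lemma is_colimit_colim: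
  assumes "\<exists>l \<iota>. is_colimit J C F l \<iota>"
  shows "is_colimit J C F (fst (colim J C F)) (snd (colim J C F))"
proof -
  have "\<exists>p. (\<lambda>(l, \<iota>). is_colimit J C F l \<iota>) p" using assms by auto
  then have "case colim J C F of (l, \<iota>) \<Rightarrow> is_colimit J C F l \<iota>"
    unfolding colim_def by (rule someI_ex)
  then show ?thesis by (simp add: split_beta)
qed

lemma colim_ind_props:
  assumes "\<exists>l \<iota>. is_colimit J C F l \<iota>" and "is_cocone J C F x \<rho>"
  shows "colim_ind J C F x \<rho> \<in> Hom C (fst (colim J C F)) x"
    and "\<And>j. j \<in> Obj J \<Longrightarrow> colim_ind J C F x \<rho> \<cdot>\<^bsub>C\<^esub> snd (colim J C F) j = \<rho> j"
proof -
  have "\<exists>!h. h \<in> Hom C (fst (colim J C F)) x \<and> (\<forall>j\<in>Obj J. h \<cdot>\<^bsub>C\<^esub> snd (colim J C F) j = \<rho> j)"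
    using is_colimit_colim[OF assms(1)] assms(2) by (simp add: is_colimit_def)
  from theI'[OF this]
  show "colim_ind J C F x \<rho> \<in> Hom C (fst (colim J C F)) x"
    "\<And>j. j \<in> Obj J \<Longrightarrow> colim_ind J C F x \<rho> \<cdot>\<^bsub>C\<^esub> snd (colim J C F) j = \<rho> j"
    by (simp_all add: colim_ind_def)
qed

lemma pushout_ind_props:
  assumes "\<exists>r p q. is_pushout C f g r p q"
    and uv: "u \<in> Hom C (Cod C f) x" "v \<in> Hom C (Cod C g) x" "u \<cdot>\<^bsub>C\<^esub> f = v \<cdot>\<^bsub>C\<^esub> g"
  obtains r p q where "is_pushout C f g r p q" "pushout_ind C f g u v \<in> Hom C r x"
    "pushout_ind C f g u v \<cdot>\<^bsub>C\<^esub> p = u" "pushout_ind C f g u v \<cdot>\<^bsub>C\<^esub> q = v"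
proof -
  define t where "t = (SOME (r, p, q). is_pushout C f g r p q)"
  obtain r p q where t: "t = (r, p, q)" by (cases t)
  have "\<exists>t. (\<lambda>(r, p, q). is_pushout C f g r p q) t" using assms(1) by auto
  from someI_ex[OF this] have po: "is_pushout C f g r p q" by (simp add: t t_def[symmetric])
  have "pushout_ind C f g u v = (THE h. h \<in> Hom C r (Cod C u) \<and> h \<cdot>\<^bsub>C\<^esub> p = u \<and> h \<cdot>\<^bsub>C\<^esub> q = v)"
    by (simp add: pushout_ind_def t_def[symmetric] t)
  moreover have "\<exists>!h. h \<in> Hom C r x \<and> h \<cdot>\<^bsub>C\<^esub> p = u \<and> h \<cdot>\<^bsub>C\<^esub> q = v"
    using po uv by (simp add: is_pushout_def)
  from theI'[OF this] have "(THE h. h \<in> Hom C r x \<and> h \<cdot>\<^bsub>C\<^esub> p = u \<and> h \<cdot>\<^bsub>C\<^esub> q = v) \<in> Hom C r x"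
    "(THE h. h \<in> Hom C r x \<and> h \<cdot>\<^bsub>C\<^esub> p = u \<and> h \<cdot>\<^bsub>C\<^esub> q = v) \<cdot>\<^bsub>C\<^esub> p = u"
    "(THE h. h \<in> Hom C r x \<and> h \<cdot>\<^bsub>C\<^esub> p = u \<and> h \<cdot>\<^bsub>C\<^esub> q = v) \<cdot>\<^bsub>C\<^esub> q = v" by auto
  moreover have "Cod C u = x" using uv(1) by (simp add: Hom_iff)
  ultimately show thesis using that[OF po] by simp
qed

lemma countable_embeds:
  assumes "infinite (UNIV :: 'u set)" "countable S"
  obtains \<phi> :: "'a \<Rightarrow> 'u" where "inj_on \<phi> S"
proof -
  obtain e :: "nat \<Rightarrow> 'u" where "inj e" using infinite_countable_subset[OF assms(1)] by auto
  then have "inj_on (e \<circ> to_nat_on S) S"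
    using inj_on_to_nat_on[OF assms(2)] by (auto intro!: comp_inj_on inj_on_subset[OF \<open>inj e\<close>])
  then show thesis by (rule that)
qed

text \<open>A model category has colimits over index categories carried by the universe \<open>'u\<close>. An infinite universe
contains a copy of every countable category, and cocones, hence colimits, are transported along the
renaming of objects and arrows.\<close>

lemma countable_colimit_exists:
  fixes J :: "('j, 'k) cat" and C :: "('o, 'a, 'z) cat_scheme"
  assumes inf: "infinite (UNIV :: 'u set)" and colim: "has_small_colimits (U :: 'u itself) C"
    and J: "category J" "countable (Obj J)" "countable (Arr J)" and F: "is_functor J C F"
  shows "\<exists>l \<iota>. is_colimit J C F l \<iota>"
proof -
  interpret J: category J by fact
  obtain \<phi> :: "'j \<Rightarrow> 'u" where \<phi>: "inj_on \<phi> (Obj J)" using countable_embeds[OF inf J(2)] .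
  obtain \<psi> :: "'k \<Rightarrow> 'u" where \<psi>: "inj_on \<psi> (Arr J)" using countable_embeds[OF inf J(3)] .
  define \<phi>' where "\<phi>' = inv_into (Obj J) \<phi>"
  define \<psi>' where "\<psi>' = inv_into (Arr J) \<psi>"
  have [simp]: "\<phi>' (\<phi> j) = j" if "j \<in> Obj J" for j using \<phi> that by (simp add: \<phi>'_def)
  have [simp]: "\<psi>' (\<psi> f) = f" if "f \<in> Arr J" for f using \<psi> that by (simp add: \<psi>'_def)
  have \<phi>_eq: "\<phi> a = \<phi> b \<longleftrightarrow> a = b" if "a \<in> Obj J" "b \<in> Obj J" for a b
    using \<phi> that by (auto simp: inj_on_def)
  define K :: "('u, 'u) cat" where
    "K = \<lparr>Obj = \<phi> ` Obj J, Arr = \<psi> ` Arr J, Dom = \<lambda>u. \<phi> (Dom J (\<psi>' u)), Cod = \<lambda>u. \<phi> (Cod J (\<psi>' u)),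
          Ide = \<lambda>a. \<psi> (Ide J (\<phi>' a)), Cmp = \<lambda>g f. \<psi> (\<psi>' g \<cdot>\<^bsub>J\<^esub> \<psi>' f)\<rparr>"
  define G where "G = \<lparr>FObj = \<lambda>u\<in>Obj K. FObj F (\<phi>' u), FArr = \<lambda>u\<in>Arr K. FArr F (\<psi>' u)\<rparr>"
  have HomE: "\<exists>f\<in>Arr J. u = \<psi> f \<and> x = \<phi> (Dom J f) \<and> y = \<phi> (Cod J f)" if "u \<in> Hom K x y" for u x y
    using that by (auto simp: K_def Hom_iff)
  have cmp: "g \<cdot>\<^bsub>J\<^esub> f \<in> Arr J" "Dom J (g \<cdot>\<^bsub>J\<^esub> f) = Dom J f" "Cod J (g \<cdot>\<^bsub>J\<^esub> f) = Cod J g"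
    if "f \<in> Arr J" "g \<in> Arr J" "Dom J g = Cod J f" for f g
    using J.Cmp_in[of f _ _ g] that by (auto simp: Hom_iff)
  have ide: "Ide J a \<in> Arr J" "Dom J (Ide J a) = a" "Cod J (Ide J a) = a" if "a \<in> Obj J" for a
    using J.Ide_in[OF that] by (auto simp: Hom_iff)
  note [simp] = cmp ide J.Dom_in J.Cod_in \<phi>_eq
  have K: "category K"
  proof
    fix f a b assume "f \<in> Hom K a b"
    then obtain f' where f: "f' \<in> Arr J" "f = \<psi> f'" "a = \<phi> (Dom J f')" "b = \<phi> (Cod J f')"
      using HomE by blast
    show "f \<cdot>\<^bsub>K\<^esub> Ide K a = f" "Ide K b \<cdot>\<^bsub>K\<^esub> f = f"
      using f J.Cmp_Ide[of f'] J.Ide_Cmp[of f'] by (simp_all add: K_def Hom_iff)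
    fix g c assume "g \<in> Hom K b c"
    then obtain g' where g: "g' \<in> Arr J" "g = \<psi> g'" "b = \<phi> (Dom J g')" "c = \<phi> (Cod J g')"
      using HomE by blast
    have fg: "Dom J g' = Cod J f'" using f g by simp
    then show "g \<cdot>\<^bsub>K\<^esub> f \<in> Hom K a c" using f g by (simp add: K_def Hom_iff)
    fix h d assume "h \<in> Hom K c d"
    then obtain h' where h: "h' \<in> Arr J" "h = \<psi> h'" "c = \<phi> (Dom J h')" "d = \<phi> (Cod J h')"
      using HomE by blast
    have gh: "Dom J h' = Cod J g'" using h g by simp
    show "(h \<cdot>\<^bsub>K\<^esub> g) \<cdot>\<^bsub>K\<^esub> f = h \<cdot>\<^bsub>K\<^esub> g \<cdot>\<^bsub>K\<^esub> f"
      using f g h fg gh J.Cmp_assoc[of f' _ _ g' _ h'] by (simp add: K_def Hom_iff)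
  qed (auto simp: K_def Hom_iff)
  have G: "is_functor K C G"
    using F unfolding is_functor_def by (auto simp: G_def K_def PiE_iff)
  then obtain l \<iota> where l: "is_colimit K C G l \<iota>"
    using colim K unfolding has_small_colimits_def by blast
  have cocone: "is_cocone J C F x (\<lambda>j. \<rho> (\<phi> j)) \<longleftrightarrow> is_cocone K C G x \<rho>" for x \<rho>
    unfolding is_cocone_def by (auto simp: G_def K_def)
  have cocone': "is_cocone K C G x (\<lambda>u. \<rho> (\<phi>' u)) \<longleftrightarrow> is_cocone J C F x \<rho>" for x \<rho>
    unfolding is_cocone_def by (auto simp: G_def K_def)
  have "is_colimit J C F l (\<lambda>j. \<iota> (\<phi> j))"
    unfolding is_colimit_def
  proof (intro conjI allI impI)
    show "is_cocone J C F l (\<lambda>j. \<iota> (\<phi> j))" using l by (simp add: cocone is_colimit_def)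
    fix x \<rho> assume "is_cocone J C F x \<rho>"
    then have "is_cocone K C G x (\<lambda>u. \<rho> (\<phi>' u))" by (simp add: cocone')
    then have "\<exists>!h. h \<in> Hom C l x \<and> (\<forall>u\<in>Obj K. h \<cdot>\<^bsub>C\<^esub> \<iota> u = \<rho> (\<phi>' u))"
      using l by (simp add: is_colimit_def)
    then show "\<exists>!h. h \<in> Hom C l x \<and> (\<forall>j\<in>Obj J. h \<cdot>\<^bsub>C\<^esub> \<iota> (\<phi> j) = \<rho> j)"
      by (simp add: K_def cong: conj_cong ball_cong)
  qed
  then show ?thesis by blast
qed

text \<open>An initial object is a colimit of the empty diagram.\<close>

lemma (in category) initial_exists:
  assumes "has_small_colimits (U :: 'u itself) C"
  shows "\<exists>z. is_initial C z"
proof -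
  define J :: "('u, 'u) cat" where "J = \<lparr>Obj = {}, Arr = {}, Dom = id, Cod = id, Ide = id, Cmp = \<lambda>g f. f\<rparr>"
  define F where "F = \<lparr>FObj = (\<lambda>_. undefined) :: 'u \<Rightarrow> 'o, FArr = (\<lambda>_. undefined) :: 'u \<Rightarrow> 'a\<rparr>"
  have "category J" by (simp add: category_def J_def Hom_def)
  moreover have "is_functor J C F" by (simp add: is_functor_def J_def F_def extensional_def)
  ultimately obtain z \<iota> where "is_colimit J C F z \<iota>"
    using assms unfolding has_small_colimits_def by blast
  then have "is_initial C z"
    unfolding is_initial_def is_colimit_def is_cocone_def by (simp add: J_def)
  then show ?thesis by blast
qed


section \<open>Cofibrations and lifting\<close>

text \<open>The retract argument: a map that lifts against the second half of its own factorization into a cofibration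
and a trivial fibration is a retract of the first half.\<close>

lemma (in model_category) cofibration_iff_lifting:
  assumes f: "f \<in> Arr M"
  shows "f \<in> Cof M \<longleftrightarrow> (\<forall>q\<in>Fib M \<inter> Weq M. has_lifting M f q)"
proof (intro iffI ballI)
  show "has_lifting M f q" if "f \<in> Cof M" "q \<in> Fib M \<inter> Weq M" for q using that lifting(1) by blast
  assume l: "\<forall>q\<in>Fib M \<inter> Weq M. has_lifting M f q"
  obtain i q where i: "i \<in> Cof M" and q: "q \<in> Fib M \<inter> Weq M" and iq: "Dom M q = Cod M i" "f = q \<cdot> i"
    using factorization(1)[OF f] by blast
  have arr: "i \<in> Arr M" "q \<in> Arr M" using i q Cof_Arr Fib_Arr by auto
  then have ends: "Dom M f = Dom M i" "Cod M f = Cod M q"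
    using Cmp_in[of i "Dom M i" "Cod M i" q "Cod M q"] iq by (auto simp: Hom_iff)
  have iH: "i \<in> Hom M (Dom M f) (Cod M i)" and qH: "q \<in> Hom M (Cod M i) (Cod M f)"
    using arr ends iq by (auto simp: Hom_iff)
  have fH: "f \<in> Hom M (Dom M f) (Cod M f)" using f by (simp add: Hom_iff)
  have id: "Ide M (Cod M f) \<in> Hom M (Cod M f) (Cod M f)" "Ide M (Dom M f) \<in> Hom M (Dom M f) (Dom M f)"
    using Ide_in Cod_in Dom_in f by auto
  \<comment> \<open>The square with top \<open>i\<close> and bottom the identity; its lift splits \<open>q\<close>.\<close>
  have "q \<cdot> i = Ide M (Cod M f) \<cdot> f" using Ide_Cmp[OF fH] iq by simp
  then obtain h where h: "h \<in> Hom M (Cod M f) (Cod M i)" "h \<cdot> f = i" "q \<cdot> h = Ide M (Cod M f)"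
    using l q iH id(1) iq ends unfolding has_lifting_def by metis
  have "is_retract M f i"
    unfolding is_retract_def
  proof (intro conjI bexI)
    show "Ide M (Dom M f) \<cdot> Ide M (Dom M f) = Ide M (Dom M f)" using id Ide_Cmp by blast
    show "q \<cdot> h = Ide M (Cod M f)" by fact
    show "i \<cdot> Ide M (Dom M f) = h \<cdot> f" using h iH Cmp_Ide by simp
    show "f \<cdot> Ide M (Dom M f) = q \<cdot> i" using iq fH Cmp_Ide by metis
  qed (use f arr h id iH qH ends in auto)
  with i retracts(2) show "f \<in> Cof M" by blast
qed


section \<open>Latching categories\<close>

lemma Obj_latching_cat: "f \<in> Obj (latching_cat C a) \<longleftrightarrow> f \<in> Direct C \<and> Cod C f = a \<and> f \<noteq> Ide C a"
  by (simp add: latching_cat_def Let_def)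

lemma Arr_latching_cat:
  "(f, g, h) \<in> Arr (latching_cat C a) \<longleftrightarrow> f \<in> Obj (latching_cat C a) \<and> g \<in> Obj (latching_cat C a) \<and>
     h \<in> Direct C \<and> h \<in> Hom C (Dom C f) (Dom C g) \<and> g \<cdot>\<^bsub>C\<^esub> h = f"
  by (auto simp: latching_cat_def Let_def)

lemma Dom_latching_cat [simp]: "Dom (latching_cat C a) (f, g, h) = f"
  and Cod_latching_cat [simp]: "Cod (latching_cat C a) (f, g, h) = g"
  and Ide_latching_cat [simp]: "Ide (latching_cat C a) f = (f, f, Ide C (Dom C f))"
  and Cmp_latching_cat [simp]: "(g', k, h') \<cdot>\<^bsub>latching_cat C a\<^esub> (f, g, h) = (f, k, h' \<cdot>\<^bsub>C\<^esub> h)"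
  by (simp_all add: latching_cat_def Let_def)

context reedy_category
begin

lemma Direct_Arr: "f \<in> Direct C \<Longrightarrow> f \<in> Arr C"
  and Direct_Ide: "a \<in> Obj C \<Longrightarrow> Ide C a \<in> Direct C"
  and Direct_Cmp: "f \<in> Direct C \<Longrightarrow> g \<in> Direct C \<Longrightarrow> Dom C g = Cod C f \<Longrightarrow> g \<cdot> f \<in> Direct C"
  using Direct_sub by (auto simp: wide_subcategory_def)

lemma Arr_Hom: "f \<in> Arr C \<Longrightarrow> f \<in> Hom C (Dom C f) (Cod C f)"
  by (simp add: Hom_iff)

lemma Ide_simps [simp]:
  assumes "a \<in> Obj C"
  shows "Ide C a \<in> Arr C" "Dom C (Ide C a) = a" "Cod C (Ide C a) = a"
  using Ide_in[OF assms] by (auto simp: Hom_iff)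

lemma Cmp_simps [simp]:
  assumes "f \<in> Arr C" "g \<in> Arr C" "Dom C g = Cod C f"
  shows "g \<cdot> f \<in> Arr C" "Dom C (g \<cdot> f) = Dom C f" "Cod C (g \<cdot> f) = Cod C g"
  using Cmp_in[of f _ _ g] assms by (auto simp: Hom_iff)

lemma direct_degree:
  obtains deg :: "'o \<Rightarrow> nat" where
    "\<And>f. f \<in> Direct C \<Longrightarrow> f \<noteq> Ide C (Cod C f) \<Longrightarrow> deg (Dom C f) < deg (Cod C f)"
proof -
  obtain deg :: "'o \<Rightarrow> nat" where
    d: "\<And>f. f \<in> Direct C \<Longrightarrow> f \<noteq> Ide C (Dom C f) \<Longrightarrow> deg (Dom C f) < deg (Cod C f)"
    using degree by blast
  have "f = Ide C (Cod C f)" if "f = Ide C (Dom C f)" "f \<in> Direct C" for f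
    using that Ide_simps(3)[OF Dom_in] Direct_Arr by metis
  then show thesis using d that by metis
qed

text \<open>Along a composite of direct arrows the degree can only grow, strictly so at a non-identity. Hence a
composite with endpoints of equal degree consists of identities. This makes the arrows with
non-identity coordinate \<open>p\<close> a sieve.\<close>

lemma direct_split_identity:
  assumes "f \<in> Direct C" "g \<in> Direct C" "Dom C g = Cod C f" "g \<cdot> f = Ide C a" "a \<in> Obj C"
  shows "g = Ide C a"
proof (rule ccontr)
  assume ne: "g \<noteq> Ide C a"
  obtain deg :: "'o \<Rightarrow> nat" where
    d: "\<And>f. f \<in> Direct C \<Longrightarrow> f \<noteq> Ide C (Cod C f) \<Longrightarrow> deg (Dom C f) < deg (Cod C f)"
    using direct_degree by blast
  have e: "Dom C f = a" "Cod C g = a"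
    using Cmp_simps[of f g] assms Ide_simps[of a] Direct_Arr by auto
  have "deg (Dom C g) < deg a" using d[of g] ne e assms by simp
  moreover have "deg a \<le> deg (Cod C f)" using d[of f] e Ide_simps(2)[OF Cod_in] assms Direct_Arr
    by (cases "f = Ide C (Cod C f)") (metis order_refl, metis less_imp_le)
  ultimately show False using assms by simp
qed

lemma Hom_latching_cat:
  "u \<in> Hom (latching_cat C a) f g \<longleftrightarrow> (\<exists>h. u = (f, g, h) \<and> f \<in> Obj (latching_cat C a) \<and>
     g \<in> Obj (latching_cat C a) \<and> h \<in> Direct C \<and> h \<in> Hom C (Dom C f) (Dom C g) \<and> g \<cdot> h = f)"
  by (cases u) (auto simp: Hom_def[of "latching_cat C a"] Arr_latching_cat)

lemma latching_Obj:
  assumes "f \<in> Obj (latching_cat C a)"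
  shows "f \<in> Hom C (Dom C f) a" "Dom C f \<in> Obj C"
proof -
  have "f \<in> Arr C" "Cod C f = a" using assms by (simp_all add: Obj_latching_cat Direct_Arr)
  then show "f \<in> Hom C (Dom C f) a" "Dom C f \<in> Obj C" by (simp_all add: Hom_iff Dom_in)
qed

lemma category_latching: "category (latching_cat C a)"
proof
  fix f g u v w x y z
  show "u \<in> Arr (latching_cat C a) \<Longrightarrow> Dom (latching_cat C a) u \<in> Obj (latching_cat C a)"
    "u \<in> Arr (latching_cat C a) \<Longrightarrow> Cod (latching_cat C a) u \<in> Obj (latching_cat C a)"
    by (cases u; simp add: Arr_latching_cat)+
  show "Ide (latching_cat C a) f \<in> Hom (latching_cat C a) f f" if f: "f \<in> Obj (latching_cat C a)"
  proof -
    have "f \<in> Arr C" using f by (simp add: Obj_latching_cat Direct_Arr)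
    then show ?thesis
      using f Direct_Ide[OF Dom_in] Ide_in[OF Dom_in] Cmp_Ide[OF Arr_Hom] by (simp add: Hom_latching_cat)
  qed
  assume "u \<in> Hom (latching_cat C a) x y"
  then obtain h where u: "u = (x, y, h)" "x \<in> Obj (latching_cat C a)" "y \<in> Obj (latching_cat C a)"
    "h \<in> Direct C" "h \<in> Hom C (Dom C x) (Dom C y)" "y \<cdot> h = x" unfolding Hom_latching_cat by blast
  show "u \<cdot>\<^bsub>latching_cat C a\<^esub> Ide (latching_cat C a) x = u"
    "Ide (latching_cat C a) y \<cdot>\<^bsub>latching_cat C a\<^esub> u = u"
    using Cmp_Ide[OF u(5)] Ide_Cmp[OF u(5)] by (simp_all add: u(1))
  assume "v \<in> Hom (latching_cat C a) y z"
  then obtain k where v: "v = (y, z, k)" "z \<in> Obj (latching_cat C a)"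
    "k \<in> Direct C" "k \<in> Hom C (Dom C y) (Dom C z)" "z \<cdot> k = y" unfolding Hom_latching_cat by blast
  have "z \<in> Hom C (Dom C z) a" using v(2) by (simp add: Obj_latching_cat Hom_iff Direct_Arr)
  from Cmp_assoc[OF u(5) v(4) this] have "z \<cdot> (k \<cdot> h) = x" using u v by simp
  moreover have "k \<cdot> h \<in> Direct C" using u v by (intro Direct_Cmp) (auto simp: Hom_iff)
  ultimately show "v \<cdot>\<^bsub>latching_cat C a\<^esub> u \<in> Hom (latching_cat C a) x z"
    using u v Cmp_in[OF u(5) v(4)] by (simp add: Hom_latching_cat)
  assume "w \<in> Hom (latching_cat C a) z f"
  then obtain l where w: "w = (z, f, l)" "l \<in> Hom C (Dom C z) (Dom C f)" unfolding Hom_latching_cat by blast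
  show "(w \<cdot>\<^bsub>latching_cat C a\<^esub> v) \<cdot>\<^bsub>latching_cat C a\<^esub> u = w \<cdot>\<^bsub>latching_cat C a\<^esub> v \<cdot>\<^bsub>latching_cat C a\<^esub> u"
    using Cmp_assoc[OF u(5) v(4) w(2)] by (simp add: u(1) v(1) w(1))
qed

lemma countable_latching:
  assumes "countable (Arr C)"
  shows "countable (Obj (latching_cat C a))" "countable (Arr (latching_cat C a))"
proof -
  show *: "countable (Obj (latching_cat C a))"
    by (rule countable_subset[OF _ assms]) (auto simp: Obj_latching_cat Direct_Arr)
  show "countable (Arr (latching_cat C a))"
    by (rule countable_subset[of _ "Obj (latching_cat C a) \<times> Obj (latching_cat C a) \<times> Arr C"])
      (use * assms in \<open>auto simp: Arr_latching_cat Direct_Arr intro!: countable_SIGMA\<close>)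
qed

end

lemma is_functorD:
  assumes "is_functor C D F"
  shows "a \<in> Obj C \<Longrightarrow> FObj F a \<in> Obj D"
    and "f \<in> Hom C a b \<Longrightarrow> FArr F f \<in> Hom D (FObj F a) (FObj F b)"
    and "a \<in> Obj C \<Longrightarrow> FArr F (Ide C a) = Ide D (FObj F a)"
    and "f \<in> Hom C a b \<Longrightarrow> g \<in> Hom C b c \<Longrightarrow>
      FArr F (g \<cdot>\<^bsub>C\<^esub> f) = FArr F g \<cdot>\<^bsub>D\<^esub> FArr F f"
  using assms by (auto simp: is_functor_def Hom_def[of C])

lemma is_nattrD:
  assumes "is_nattr C D (F, G, \<tau>)"
  shows "is_functor C D F" "is_functor C D G" "\<tau> \<in> extensional (Obj C)"
    and "a \<in> Obj C \<Longrightarrow> \<tau> a \<in> Hom D (FObj F a) (FObj G a)"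
    and "f \<in> Arr C \<Longrightarrow> FArr G f \<cdot>\<^bsub>D\<^esub> \<tau> (Dom C f) = \<tau> (Cod C f) \<cdot>\<^bsub>D\<^esub> FArr F f"
  using assms unfolding is_nattr_def by blast+

text \<open>\<open>G\<close> behaves like a functor from \<open>J\<close> to \<open>C\<close> but may take any value off the carriers; the forgetful functor
of a latching category is of this kind.\<close>

lemma is_functor_restrict_along:
  assumes "category J"
    and G: "\<And>a. a \<in> Obj J \<Longrightarrow> FObj G a \<in> Obj C"
      "\<And>f. f \<in> Arr J \<Longrightarrow> FArr G f \<in> Hom C (FObj G (Dom J f)) (FObj G (Cod J f))"
      "\<And>a. a \<in> Obj J \<Longrightarrow> FArr G (Ide J a) = Ide C (FObj G a)"
      "\<And>f g. f \<in> Arr J \<Longrightarrow> g \<in> Arr J \<Longrightarrow> Dom J g = Cod J f \<Longrightarrow>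
        FArr G (g \<cdot>\<^bsub>J\<^esub> f) = FArr G g \<cdot>\<^bsub>C\<^esub> FArr G f"
    and X: "is_functor C D X"
  shows "is_functor J D (restrict_along J X G)"
proof -
  interpret category J by fact
  have "Ide J a \<in> Arr J" if "a \<in> Obj J" for a using Ide_in[OF that] by (simp add: Hom_iff)
  moreover have "g \<cdot>\<^bsub>J\<^esub> f \<in> Arr J" if "f \<in> Arr J" "g \<in> Arr J" "Dom J g = Cod J f" for f g
    using Cmp_in[of f _ _ g] that by (auto simp: Hom_iff)
  moreover have "FArr G f \<in> Arr C" "Dom C (FArr G f) = FObj G (Dom J f)" "Cod C (FArr G f) = FObj G (Cod J f)"
    if "f \<in> Arr J" for f using G(2)[OF that] by (simp_all add: Hom_iff)
  moreover have "FObj X \<in> Obj C \<rightarrow>\<^sub>E Obj D" "\<And>f. f \<in> Arr C \<Longrightarrow> FArr X f \<in> Hom D (FObj X (Dom C f)) (FObj X (Cod C f))"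
    "\<And>a. a \<in> Obj C \<Longrightarrow> FArr X (Ide C a) = Ide D (FObj X a)"
    "\<And>f g. f \<in> Arr C \<Longrightarrow> g \<in> Arr C \<Longrightarrow> Dom C g = Cod C f \<Longrightarrow>
      FArr X (g \<cdot>\<^bsub>C\<^esub> f) = FArr X g \<cdot>\<^bsub>D\<^esub> FArr X f"
    using X by (simp_all add: is_functor_def)
  moreover have "FArr X (FArr G f) \<in> Hom D (FObj X (FObj G (Dom J f))) (FObj X (FObj G (Cod J f)))"
    if "f \<in> Arr J" for f using calculation(3-5)[OF that] calculation(7)[of "FArr G f"] by simp
  ultimately show ?thesis
    using G(1,3,4) Dom_in Cod_in by (simp add: is_functor_def restrict_along_def PiE_iff)
qed

lemma FObj_latching_diagram [simp]:
  "f \<in> Obj (latching_cat C a) \<Longrightarrow> FObj (latching_diagram C a X) f = FObj X (Dom C f)"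
  by (simp add: latching_diagram_def restrict_along_def)

lemma FArr_latching_diagram [simp]:
  "(f, g, h) \<in> Arr (latching_cat C a) \<Longrightarrow> FArr (latching_diagram C a X) (f, g, h) = FArr X h"
  by (simp add: latching_diagram_def restrict_along_def)

lemma (in reedy_category) is_functor_latching_diagram:
  assumes "is_functor C M X"
  shows "is_functor (latching_cat C a) M (latching_diagram C a X)"
  unfolding latching_diagram_def
  by (rule is_functor_restrict_along[OF category_latching _ _ _ _ assms])
    (auto simp: Obj_latching_cat Arr_latching_cat Direct_Arr Dom_in)

text \<open>The left lifting property of the latching map \<open>L\<^sub>a X \<rightarrow> X\<^sub>a\<close> against \<open>q\<close>, with the maps out of
\<open>L\<^sub>a X\<close> replaced by the cocones that they represent.\<close>

definition latching_lifting ::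
  "('o1, 'a1, 'y) reedy_scheme \<Rightarrow> ('o2, 'a2, 'z) cat_scheme \<Rightarrow> ('o1, 'a1, 'o2, 'a2) fctr
     \<Rightarrow> 'o1 \<Rightarrow> 'a2 \<Rightarrow> bool"
where
  "latching_lifting C M X a q \<longleftrightarrow>
     (\<forall>k b. is_cocone (latching_cat C a) M (latching_diagram C a X) (Dom M q) k \<longrightarrow>
        b \<in> Hom M (FObj X a) (Cod M q) \<longrightarrow>
        (\<forall>f\<in>Obj (latching_cat C a). q \<cdot>\<^bsub>M\<^esub> k f = b \<cdot>\<^bsub>M\<^esub> FArr X f) \<longrightarrow>
        (\<exists>e\<in>Hom M (FObj X a) (Dom M q). q \<cdot>\<^bsub>M\<^esub> e = b \<and>
          (\<forall>f\<in>Obj (latching_cat C a). e \<cdot>\<^bsub>M\<^esub> FArr X f = k f)))"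


section \<open>Reedy cofibrant diagrams\<close>

lemma reedy_model_simps [simp]:
  "Obj (reedy_model C M) = {F. is_functor C M F}"
  "Arr (reedy_model C M) = {t. is_nattr C M t}"
  "Dom (reedy_model C M) t = fst t"
  "Cod (reedy_model C M) t = fst (snd t)"
  "Cof (reedy_model C M) = {t. is_nattr C M t \<and> (\<forall>a\<in>Obj C. relative_latching_map C M a t \<in> Cof M)}"
  "Fib (reedy_model C M) = {t. is_nattr C M t \<and> (\<forall>a\<in>Obj C. relative_matching_map C M a t \<in> Fib M)}"
  by (simp_all add: reedy_model_def functor_cat_def cat.extend_def split_beta)

lemma Hom_reedy_model:
  "t \<in> Hom (reedy_model C M) F G \<longleftrightarrow> (\<exists>\<tau>. t = (F, G, \<tau>) \<and> is_nattr C M (F, G, \<tau>))"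
  by (cases t) (auto simp: Hom_iff)

text \<open>Countability of \<open>C\<close> makes the latching categories small relative to the universe \<open>'u\<close>, so that latching
objects exist.\<close>

locale reedy_diagrams = C: reedy_category C + M: model_category U M
  for C :: "('c, 'd) reedy" and U :: "'u itself" and M :: "('o, 'a) model" +
  assumes infinite_universe: "infinite (UNIV :: 'u set)"
    and countable_Arr: "countable (Arr C)"
begin

lemma latching_exists:
  "is_functor C M X \<Longrightarrow> \<exists>l \<iota>. is_colimit (latching_cat C a) M (latching_diagram C a X) l \<iota>"
  by (rule countable_colimit_exists[OF infinite_universe M.colimits])
    (rule C.category_latching C.countable_latching C.is_functor_latching_diagram countable_Arr | assumption)+

lemma is_colimit_latching:
  "is_functor C M X \<Longrightarrow>
     is_colimit (latching_cat C a) M (latching_diagram C a X) (fst (latching C M a X)) (snd (latching C M a X))"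
  unfolding latching_def by (intro is_colimit_colim latching_exists)

lemma latching_arrows_eq:
  assumes "is_functor C M X"
    and "h \<in> Hom M (fst (latching C M a X)) x" "h' \<in> Hom M (fst (latching C M a X)) x"
      "\<And>f. f \<in> Obj (latching_cat C a) \<Longrightarrow>
        h \<cdot>\<^bsub>M\<^esub> snd (latching C M a X) f = h' \<cdot>\<^bsub>M\<^esub> snd (latching C M a X) f"
  shows "h = h'"
  using M.colimit_arrows_eq[OF C.category_latching C.is_functor_latching_diagram is_colimit_latching] assms by blast

lemma latching_leg:
  assumes "is_functor C M X" "f \<in> Obj (latching_cat C a)"
  shows "snd (latching C M a X) f \<in> Hom M (FObj X (Dom C f)) (fst (latching C M a X))"
  using is_colimit_latching[OF assms(1)] assms(2) by (auto simp: is_colimit_def is_cocone_def)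

lemma latching_cocone:
  assumes X: "is_functor C M X" and a: "a \<in> Obj C"
  shows "is_cocone (latching_cat C a) M (latching_diagram C a X) (FObj X a) (FArr X)"
  unfolding is_cocone_def
proof (intro conjI ballI)
  show "FObj X a \<in> Obj M" using X a by (auto simp: is_functor_def)
  show "FArr X f \<in> Hom M (FObj (latching_diagram C a X) f) (FObj X a)" if "f \<in> Obj (latching_cat C a)" for f
  proof -
    from is_functorD(2)[OF X C.latching_Obj(1)[OF that]] show ?thesis using that by simp
  qed
  fix u assume u: "u \<in> Arr (latching_cat C a)"
  obtain f g h where u': "u = (f, g, h)" by (cases u)
  have "FArr X (g \<cdot>\<^bsub>C\<^esub> h) = FArr X g \<cdot>\<^bsub>M\<^esub> FArr X h"
  proof (rule is_functorD(4)[OF X])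
    show "h \<in> Hom C (Dom C f) (Dom C g)" using u by (simp add: u' Arr_latching_cat)
    show "g \<in> Hom C (Dom C g) a" using u by (intro C.latching_Obj) (simp add: u' Arr_latching_cat)
  qed
  then show "FArr X (Cod (latching_cat C a) u) \<cdot>\<^bsub>M\<^esub> FArr (latching_diagram C a X) u = FArr X (Dom (latching_cat C a) u)"
    using u by (simp add: u' Arr_latching_cat)
qed

lemma latching_map_props:
  assumes X: "is_functor C M X" and a: "a \<in> Obj C"
  shows "latching_map C M a X \<in> Hom M (fst (latching C M a X)) (FObj X a)"
    and "\<And>f. f \<in> Obj (latching_cat C a) \<Longrightarrow>
      latching_map C M a X \<cdot>\<^bsub>M\<^esub> snd (latching C M a X) f = FArr X f"
  using colim_ind_props[OF latching_exists[OF X] latching_cocone[OF X a]]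
  unfolding latching_map_def latching_def by auto

text \<open>A cocone on a diagram of initial objects consists of the unique maps, which are automatically compatible.\<close>

lemma initial_latching:
  assumes X: "is_functor C M X" and i: "\<And>a. a \<in> Obj C \<Longrightarrow> is_initial M (FObj X a)"
  shows "is_initial M (fst (latching C M a X))"
  unfolding is_initial_def
proof (intro conjI ballI)
  let ?L = "fst (latching C M a X)"
  show "?L \<in> Obj M" using is_colimit_latching[OF X, of a] by (auto simp: is_colimit_def is_cocone_def)
  fix x assume x: "x \<in> Obj M"
  have "\<exists>h. h \<in> Hom M (FObj X (Dom C f)) x" if "f \<in> Obj (latching_cat C a)" for f
    using M.initial_arrow[OF i[OF C.latching_Obj(2)[OF that]] x] by blast
  then obtain \<rho> where \<rho>: "\<rho> f \<in> Hom M (FObj X (Dom C f)) x" if "f \<in> Obj (latching_cat C a)" for f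
    by metis
  have "is_cocone (latching_cat C a) M (latching_diagram C a X) x \<rho>"
    unfolding is_cocone_def
  proof (intro conjI ballI)
    fix u assume u: "u \<in> Arr (latching_cat C a)"
    obtain f g h where u': "u = (f, g, h)" by (cases u)
    have f: "f \<in> Obj (latching_cat C a)" and g: "g \<in> Obj (latching_cat C a)"
      and h: "h \<in> Arr C" "Dom C h = Dom C f" "Cod C h = Dom C g"
      using u C.Direct_Arr by (auto simp: u' Arr_latching_cat Hom_iff)
    have "FArr X h \<in> Hom M (FObj X (Dom C f)) (FObj X (Dom C g))"
      using h by (intro is_functorD(2)[OF X]) (simp add: Hom_iff)
    from M.Cmp_in[OF this \<rho>[OF g]] have "\<rho> g \<cdot>\<^bsub>M\<^esub> FArr X h = \<rho> f"
      by (rule M.initial_arrows_eq[OF i[OF C.latching_Obj(2)[OF f]] _ \<rho>[OF f]])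
    then show "\<rho> (Cod (latching_cat C a) u) \<cdot>\<^bsub>M\<^esub> FArr (latching_diagram C a X) u = \<rho> (Dom (latching_cat C a) u)"
      using u by (simp add: u')
  qed (use x \<rho> in auto)
  then obtain h where "h \<in> Hom M ?L x"
    using is_colimit_latching[OF X, of a] unfolding is_colimit_def by blast
  moreover have "g = h" if "g \<in> Hom M ?L x" "h \<in> Hom M ?L x" for g h
  proof (rule latching_arrows_eq[OF X that])
    fix f assume f: "f \<in> Obj (latching_cat C a)"
    show "g \<cdot>\<^bsub>M\<^esub> snd (latching C M a X) f = h \<cdot>\<^bsub>M\<^esub> snd (latching C M a X) f"
      using M.initial_arrows_eq[OF i[OF C.latching_Obj(2)[OF f]]
          M.Cmp_in[OF latching_leg[OF X f] that(1)] M.Cmp_in[OF latching_leg[OF X f] that(2)]] .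
  qed
  ultimately show "\<exists>!h. h \<in> Hom M ?L x" by blast
qed

text \<open>Because \<open>I\<close> is initial at every object, \<open>I\<^sub>a\<close> and \<open>L\<^sub>a I\<close> are initial as well, and the pushout of \<open>I\<^sub>a\<close> and
\<open>L\<^sub>a X\<close> over \<open>L\<^sub>a I\<close> maps out exactly as \<open>L\<^sub>a X\<close> does. The relative latching map of \<open>I \<rightarrow> X\<close> thus has the
same lifting properties as \<open>L\<^sub>a X \<rightarrow> X\<^sub>a\<close>, and a lifting problem for the latter is given by a cocone.\<close>

lemma relative_latching_map_lifting:
  assumes t: "is_nattr C M (I, X, \<tau>)" and i: "\<And>a. a \<in> Obj C \<Longrightarrow> is_initial M (FObj I a)"
    and a: "a \<in> Obj C"
  shows "relative_latching_map C M a (I, X, \<tau>) \<in> Arr M"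
    and "q \<in> Arr M \<Longrightarrow> has_lifting M (relative_latching_map C M a (I, X, \<tau>)) q \<longleftrightarrow> latching_lifting C M X a q"
proof -
  have I: "is_functor C M I" and X: "is_functor C M X"
    and \<tau>: "\<And>a. a \<in> Obj C \<Longrightarrow> \<tau> a \<in> Hom M (FObj I a) (FObj X a)"
    using t by (auto simp: is_nattr_def)
  let ?J = "latching_cat C a"
  define LI where "LI = fst (latching C M a I)"
  define LX where "LX = fst (latching C M a X)"
  define \<iota> where "\<iota> = snd (latching C M a X)"
  define lI where "lI = latching_map C M a I"
  define lX where "lX = latching_map C M a X"
  define g where "g = latching_fun C M a (I, X, \<tau>)"
  have initLI: "is_initial M LI" unfolding LI_def by (rule initial_latching[OF I i])
  have colX: "is_colimit ?J M (latching_diagram C a X) LX \<iota>"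
    unfolding LX_def \<iota>_def by (rule is_colimit_latching[OF X])
  have leg: "\<iota> f \<in> Hom M (FObj X (Dom C f)) LX" if "f \<in> Obj ?J" for f
    unfolding \<iota>_def LX_def by (rule latching_leg[OF X that])
  have lI: "lI \<in> Hom M LI (FObj I a)" unfolding lI_def LI_def by (rule latching_map_props[OF I a])
  have lXf: "lX \<cdot>\<^bsub>M\<^esub> \<iota> f = FArr X f" if "f \<in> Obj ?J" for f
    using latching_map_props(2)[OF X a that] unfolding lX_def \<iota>_def .
  have lX: "lX \<in> Hom M LX (FObj X a)" unfolding lX_def LX_def by (rule latching_map_props[OF X a])
  have g: "g \<in> Hom M LI LX"
  proof -
    have "is_cocone ?J M (latching_diagram C a I) LX (\<lambda>f. \<iota> f \<cdot>\<^bsub>M\<^esub> \<tau> (Dom C f))"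
      unfolding is_cocone_def
    proof (intro conjI ballI)
      show "LX \<in> Obj M" using colX by (auto simp: is_colimit_def is_cocone_def)
      note D = C.latching_Obj(2)
      have k: "\<iota> f \<cdot>\<^bsub>M\<^esub> \<tau> (Dom C f) \<in> Hom M (FObj I (Dom C f)) LX" if "f \<in> Obj ?J" for f
        using M.Cmp_in[OF \<tau>[OF D[OF that]] leg[OF that]] .
      then show "\<iota> f \<cdot>\<^bsub>M\<^esub> \<tau> (Dom C f) \<in> Hom M (FObj (latching_diagram C a I) f) LX" if "f \<in> Obj ?J" for f
        using that by simp
      fix u assume u: "u \<in> Arr ?J"
      obtain f f' h where u': "u = (f, f', h)" by (cases u)
      have f: "f \<in> Obj ?J" "f' \<in> Obj ?J" "h \<in> Arr C" "Dom C h = Dom C f" "Cod C h = Dom C f'"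
        using u C.Direct_Arr by (auto simp: u' Arr_latching_cat Hom_iff)
      have "FArr I h \<in> Hom M (FObj I (Dom C f)) (FObj I (Dom C f'))"
        using f by (intro is_functorD(2)[OF I]) (simp add: Hom_iff)
      from M.Cmp_in[OF this k[OF f(2)]]
      have "(\<iota> f' \<cdot>\<^bsub>M\<^esub> \<tau> (Dom C f')) \<cdot>\<^bsub>M\<^esub> FArr I h = \<iota> f \<cdot>\<^bsub>M\<^esub> \<tau> (Dom C f)"
        using M.initial_arrows_eq[OF i[OF D[OF f(1)]]] k[OF f(1)] by blast
      then show "(\<iota> (Cod ?J u) \<cdot>\<^bsub>M\<^esub> \<tau> (Dom C (Cod ?J u))) \<cdot>\<^bsub>M\<^esub> FArr (latching_diagram C a I) u
          = \<iota> (Dom ?J u) \<cdot>\<^bsub>M\<^esub> \<tau> (Dom C (Dom ?J u))"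
        using u by (simp add: u')
    qed
    from colim_ind_props(1)[OF latching_exists[OF I] this] show ?thesis
      by (simp add: g_def latching_fun_def LI_def LX_def \<iota>_def latching_def)
  qed
  have "LX \<in> Obj M" using lX M.Dom_in by (auto simp: Hom_iff)
  then obtain z where z: "z \<in> Hom M (FObj I a) LX" using M.initial_arrow[OF i[OF a]] by blast
  \<comment> \<open>\<open>L\<^sub>a X\<close> itself serves as a pushout, so the chosen pushout is one indeed.\<close>
  have "is_pushout M lI g LX z (Ide M LX)"
    unfolding is_pushout_def
  proof (intro conjI allI ballI impI)
    have id: "Ide M LX \<in> Hom M LX LX" using \<open>LX \<in> Obj M\<close> M.Ide_in by blast
    then show "z \<in> Hom M (Cod M lI) LX" "Ide M LX \<in> Hom M (Cod M g) LX" using z lI g by (auto simp: Hom_iff)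
    show "z \<cdot>\<^bsub>M\<^esub> lI = Ide M LX \<cdot>\<^bsub>M\<^esub> g"
      using M.initial_arrows_eq[OF initLI M.Cmp_in[OF lI z] M.Cmp_in[OF g id]] .
    fix x u v assume "u \<in> Hom M (Cod M lI) x" "v \<in> Hom M (Cod M g) x"
    then have u: "u \<in> Hom M (FObj I a) x" and v: "v \<in> Hom M LX x" using lI g by (auto simp: Hom_iff)
    have "v \<cdot>\<^bsub>M\<^esub> z = u" using M.initial_arrows_eq[OF i[OF a] M.Cmp_in[OF z v] u] .
    then show "\<exists>!h. h \<in> Hom M LX x \<and> h \<cdot>\<^bsub>M\<^esub> z = u \<and> h \<cdot>\<^bsub>M\<^esub> Ide M LX = v"
      using v M.Cmp_Ide[OF v] by (intro ex1I[of _ v]) (simp, metis M.Cmp_Ide)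
  qed
  then have ex: "\<exists>r p q. is_pushout M lI g r p q" by blast
  have comm: "\<tau> a \<cdot>\<^bsub>M\<^esub> lI = lX \<cdot>\<^bsub>M\<^esub> g"
    using M.initial_arrows_eq[OF initLI M.Cmp_in[OF lI \<tau>[OF a]] M.Cmp_in[OF g lX]] .
  define h where "h = relative_latching_map C M a (I, X, \<tau>)"
  have h_eq: "h = pushout_ind M lI g (\<tau> a) lX"
    by (simp add: h_def relative_latching_map_def lI_def g_def lX_def)
  have cods: "Cod M lI = FObj I a" "Cod M g = LX" using lI g by (auto simp: Hom_iff)
  obtain r j s where po: "is_pushout M lI g r j s"
    and h: "h \<in> Hom M r (FObj X a)" "h \<cdot>\<^bsub>M\<^esub> s = lX"
    using pushout_ind_props[OF ex, of "\<tau> a" "FObj X a" lX] \<tau>[OF a] lX comm unfolding cods h_eq by metis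
  have j: "j \<in> Hom M (FObj I a) r" and s: "s \<in> Hom M LX r" using po by (auto simp: is_pushout_def cods)
  \<comment> \<open>Maps out of the pushout are determined on \<open>L\<^sub>a X\<close>, the other leg starting at an initial object.\<close>
  have po_eq: "u = v" if "u \<in> Hom M r x" "v \<in> Hom M r x" "u \<cdot>\<^bsub>M\<^esub> s = v \<cdot>\<^bsub>M\<^esub> s" for u v x
    using M.pushout_arrows_eq[OF po lI g that(1,2) _ that(3)]
      M.initial_arrows_eq[OF i[OF a] M.Cmp_in[OF j that(1)] M.Cmp_in[OF j that(2)]] by blast
  have L_eq: "u = v" if "u \<in> Hom M LX x" "v \<in> Hom M LX x" "\<And>f. f \<in> Obj ?J \<Longrightarrow> u \<cdot>\<^bsub>M\<^esub> \<iota> f = v \<cdot>\<^bsub>M\<^esub> \<iota> f" for u v x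
    using latching_arrows_eq[OF X, of u a x v] that unfolding LX_def \<iota>_def by blast
  have dom_h: "Dom M h = r" "Cod M h = FObj X a" using h by (auto simp: Hom_iff)
  show "relative_latching_map C M a (I, X, \<tau>) \<in> Arr M" using h by (simp add: h_def[symmetric] Hom_iff)
  show "has_lifting M (relative_latching_map C M a (I, X, \<tau>)) q \<longleftrightarrow> latching_lifting C M X a q"
    if q: "q \<in> Arr M"
    unfolding h_def[symmetric]
  proof
    have qH: "q \<in> Hom M (Dom M q) (Cod M q)" using q by (simp add: Hom_iff)
    assume lift: "has_lifting M h q"
    show "latching_lifting C M X a q"
      unfolding latching_lifting_def
    proof (intro allI impI)
      fix k b assume k: "is_cocone ?J M (latching_diagram C a X) (Dom M q) k"
        and b: "b \<in> Hom M (FObj X a) (Cod M q)"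
        and kb: "\<forall>f\<in>Obj ?J. q \<cdot>\<^bsub>M\<^esub> k f = b \<cdot>\<^bsub>M\<^esub> FArr X f"
      obtain w where w: "w \<in> Hom M LX (Dom M q)" "\<And>f. f \<in> Obj ?J \<Longrightarrow> w \<cdot>\<^bsub>M\<^esub> \<iota> f = k f"
        using colX k unfolding is_colimit_def by blast
      obtain t where t: "t \<in> Hom M (FObj I a) (Dom M q)"
        using M.initial_arrow[OF i[OF a] M.Dom_in[OF q]] .
      have "t \<cdot>\<^bsub>M\<^esub> lI = w \<cdot>\<^bsub>M\<^esub> g"
        using M.initial_arrows_eq[OF initLI M.Cmp_in[OF lI t] M.Cmp_in[OF g w(1)]] .
      then obtain v where v: "v \<in> Hom M r (Dom M q)" "v \<cdot>\<^bsub>M\<^esub> s = w"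
        using po t w(1) unfolding is_pushout_def cods by metis
      have "(q \<cdot>\<^bsub>M\<^esub> v) \<cdot>\<^bsub>M\<^esub> s = (b \<cdot>\<^bsub>M\<^esub> h) \<cdot>\<^bsub>M\<^esub> s"
      proof (rule L_eq)
        fix f assume f: "f \<in> Obj ?J"
        have "q \<cdot>\<^bsub>M\<^esub> w \<cdot>\<^bsub>M\<^esub> \<iota> f = b \<cdot>\<^bsub>M\<^esub> lX \<cdot>\<^bsub>M\<^esub> \<iota> f"
          using kb f w(2)[OF f] lXf[OF f] by simp
        then show "((q \<cdot>\<^bsub>M\<^esub> v) \<cdot>\<^bsub>M\<^esub> s) \<cdot>\<^bsub>M\<^esub> \<iota> f = ((b \<cdot>\<^bsub>M\<^esub> h) \<cdot>\<^bsub>M\<^esub> s) \<cdot>\<^bsub>M\<^esub> \<iota> f"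
          using M.Cmp_assoc[OF s v(1) qH] M.Cmp_assoc[OF s h(1) b] v(2) h(2)
            M.Cmp_assoc[OF leg[OF f] w(1) qH] M.Cmp_assoc[OF leg[OF f] lX b] by simp
      qed (rule M.Cmp_in[OF s M.Cmp_in[OF v(1) qH]] M.Cmp_in[OF s M.Cmp_in[OF h(1) b]])+
      then have "q \<cdot>\<^bsub>M\<^esub> v = b \<cdot>\<^bsub>M\<^esub> h"
        by (rule po_eq[OF M.Cmp_in[OF v(1) qH] M.Cmp_in[OF h(1) b]])
      then obtain e where e: "e \<in> Hom M (FObj X a) (Dom M q)" "e \<cdot>\<^bsub>M\<^esub> h = v" "q \<cdot>\<^bsub>M\<^esub> e = b"
        using lift v(1) b unfolding has_lifting_def dom_h by blast
      have "e \<cdot>\<^bsub>M\<^esub> FArr X f = k f" if f: "f \<in> Obj ?J" for f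
        using M.Cmp_assoc[OF leg[OF f] s h(1)] M.Cmp_assoc[OF leg[OF f] s v(1)] M.Cmp_assoc[OF leg[OF f] lX e(1)]
          M.Cmp_assoc[OF s h(1) e(1)] lXf[OF f] w(2)[OF f] v(2) h(2) e(2) by simp
      then show "\<exists>e\<in>Hom M (FObj X a) (Dom M q). q \<cdot>\<^bsub>M\<^esub> e = b \<and> (\<forall>f\<in>Obj ?J. e \<cdot>\<^bsub>M\<^esub> FArr X f = k f)"
        using e by blast
    qed
  next
    have qH: "q \<in> Hom M (Dom M q) (Cod M q)" using q by (simp add: Hom_iff)
    assume lift: "latching_lifting C M X a q"
    show "has_lifting M h q"
      unfolding has_lifting_def dom_h
    proof (intro ballI impI)
      fix u v assume u: "u \<in> Hom M r (Dom M q)" and v: "v \<in> Hom M (FObj X a) (Cod M q)"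
        and uv: "q \<cdot>\<^bsub>M\<^esub> u = v \<cdot>\<^bsub>M\<^esub> h"
      have us: "u \<cdot>\<^bsub>M\<^esub> s \<in> Hom M LX (Dom M q)" by (rule M.Cmp_in[OF s u])
      have "is_cocone ?J M (latching_diagram C a X) (Dom M q) (\<lambda>f. (u \<cdot>\<^bsub>M\<^esub> s) \<cdot>\<^bsub>M\<^esub> \<iota> f)"
        using M.is_cocone_Cmp[OF C.category_latching C.is_functor_latching_diagram[OF X] _ us] colX
        by (simp add: is_colimit_def)
      moreover have "q \<cdot>\<^bsub>M\<^esub> (u \<cdot>\<^bsub>M\<^esub> s) \<cdot>\<^bsub>M\<^esub> \<iota> f = v \<cdot>\<^bsub>M\<^esub> FArr X f" if f: "f \<in> Obj ?J" for f
        using M.Cmp_assoc[OF leg[OF f] us qH] M.Cmp_assoc[OF s u qH] M.Cmp_assoc[OF s h(1) v]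
          M.Cmp_assoc[OF leg[OF f] lX v] lXf[OF f] h(2) uv by simp
      ultimately obtain e where e: "e \<in> Hom M (FObj X a) (Dom M q)" "q \<cdot>\<^bsub>M\<^esub> e = v"
        "\<And>f. f \<in> Obj ?J \<Longrightarrow> e \<cdot>\<^bsub>M\<^esub> FArr X f = (u \<cdot>\<^bsub>M\<^esub> s) \<cdot>\<^bsub>M\<^esub> \<iota> f"
        using lift v unfolding latching_lifting_def by meson
      have "e \<cdot>\<^bsub>M\<^esub> lX = u \<cdot>\<^bsub>M\<^esub> s"
      proof (rule L_eq[OF M.Cmp_in[OF lX e(1)] us])
        fix f assume f: "f \<in> Obj ?J"
        show "(e \<cdot>\<^bsub>M\<^esub> lX) \<cdot>\<^bsub>M\<^esub> \<iota> f = (u \<cdot>\<^bsub>M\<^esub> s) \<cdot>\<^bsub>M\<^esub> \<iota> f"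
          using M.Cmp_assoc[OF leg[OF f] lX e(1)] lXf[OF f] e(3)[OF f] by simp
      qed
      then have "(e \<cdot>\<^bsub>M\<^esub> h) \<cdot>\<^bsub>M\<^esub> s = u \<cdot>\<^bsub>M\<^esub> s" using M.Cmp_assoc[OF s h(1) e(1)] h(2) by simp
      then have "e \<cdot>\<^bsub>M\<^esub> h = u" by (rule po_eq[OF M.Cmp_in[OF h(1) e(1)] u])
      then show "\<exists>e\<in>Hom M (FObj X a) (Dom M q). e \<cdot>\<^bsub>M\<^esub> h = u \<and> q \<cdot>\<^bsub>M\<^esub> e = v" using e by blast
    qed
  qed
qed

end


definition constant_functor :: "('x, 'y, 'z) cat_scheme \<Rightarrow> ('o, 'a, 'w) cat_scheme \<Rightarrow> 'o \<Rightarrow> ('x, 'y, 'o, 'a) fctr"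
where
  "constant_functor C M z = \<lparr>FObj = \<lambda>a\<in>Obj C. z, FArr = \<lambda>f\<in>Arr C. Ide M z\<rparr>"

context reedy_diagrams
begin

lemma is_functor_constant: "z \<in> Obj M \<Longrightarrow> is_functor C M (constant_functor C M z)"
  using M.Ide_in[of z] M.Cmp_Ide[of "Ide M z" z z] C.Dom_in C.Cod_in
  by (auto simp: is_functor_def constant_functor_def)

lemma is_nattr_constant:
  assumes z: "is_initial M z" and X: "is_functor C M X"
    and \<tau>: "\<And>a. a \<in> Obj C \<Longrightarrow> \<tau> a \<in> Hom M z (FObj X a)" "\<tau> \<in> extensional (Obj C)"
  shows "is_nattr C M (constant_functor C M z, X, \<tau>)"
proof -
  have z': "z \<in> Obj M" using z by (simp add: is_initial_def)
  have "FArr X f \<cdot>\<^bsub>M\<^esub> \<tau> (Dom C f) = \<tau> (Cod C f) \<cdot>\<^bsub>M\<^esub> FArr (constant_functor C M z) f" if f: "f \<in> Arr C" for f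
  proof -
    have "FArr X f \<in> Hom M (FObj X (Dom C f)) (FObj X (Cod C f))"
      using f by (intro is_functorD(2)[OF X]) (simp add: Hom_iff)
    from M.Cmp_in[OF \<tau>(1)[OF C.Dom_in[OF f]] this] have "FArr X f \<cdot>\<^bsub>M\<^esub> \<tau> (Dom C f) = \<tau> (Cod C f)"
      using M.initial_arrows_eq[OF z] \<tau>(1)[OF C.Cod_in[OF f]] by blast
    then show ?thesis using M.Cmp_Ide[OF \<tau>(1)[OF C.Cod_in[OF f]]] f by (simp add: constant_functor_def)
  qed
  then show ?thesis
    using is_functor_constant[OF z'] X \<tau> by (auto simp: is_nattr_def constant_functor_def)
qed

lemma nattr_from_constant:
  assumes z: "is_initial M z" and X: "is_functor C M X"
  obtains \<tau> where "is_nattr C M (constant_functor C M z, X, \<tau>)"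
proof -
  have "\<exists>h. h \<in> Hom M z (FObj X a)" if "a \<in> Obj C" for a
    using M.initial_arrow[OF z is_functorD(1)[OF X that]] by blast
  then obtain \<tau> where "\<tau> a \<in> Hom M z (FObj X a)" if "a \<in> Obj C" for a by metis
  then have "is_nattr C M (constant_functor C M z, X, \<lambda>a\<in>Obj C. \<tau> a)"
    by (intro is_nattr_constant[OF z X]) auto
  then show thesis by (rule that)
qed

lemma is_initial_constant_functor:
  assumes z: "is_initial M z"
  shows "is_initial (reedy_model C M) (constant_functor C M z)"
  unfolding is_initial_def
proof (intro conjI ballI)
  show "constant_functor C M z \<in> Obj (reedy_model C M)"
    using z is_functor_constant by (simp add: is_initial_def)
  fix X assume "X \<in> Obj (reedy_model C M)"
  then have X: "is_functor C M X" by simp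
  obtain \<tau> where \<tau>: "is_nattr C M (constant_functor C M z, X, \<tau>)" using nattr_from_constant[OF z X] .
  have "\<sigma> = \<tau>" if \<sigma>: "is_nattr C M (constant_functor C M z, X, \<sigma>)" for \<sigma>
  proof (rule extensionalityI[of _ "Obj C"])
    fix a assume "a \<in> Obj C"
    then have "\<sigma> a \<in> Hom M z (FObj X a)" "\<tau> a \<in> Hom M z (FObj X a)"
      using is_nattrD(4)[OF \<sigma>] is_nattrD(4)[OF \<tau>] by (simp_all add: constant_functor_def)
    then show "\<sigma> a = \<tau> a" by (rule M.initial_arrows_eq[OF z])
  qed (fact is_nattrD(3)[OF \<sigma>] is_nattrD(3)[OF \<tau>])+
  then show "\<exists>!t. t \<in> Hom (reedy_model C M) (constant_functor C M z) X"
    using \<tau> unfolding Hom_reedy_model by blast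
qed

text \<open>An initial diagram is isomorphic to the constant one at an initial object of \<open>M\<close>, so its values are
retracts of that object, and a retract of an initial object is initial.\<close>

lemma initial_functor_pointwise:
  assumes I: "is_initial (reedy_model C M) I" and a: "a \<in> Obj C"
  shows "is_initial M (FObj I a)"
proof -
  have IF: "is_functor C M I" using I by (simp add: is_initial_def)
  obtain z where z: "is_initial M z" using M.initial_exists[OF M.colimits] ..
  let ?K = "constant_functor C M z"
  have K: "is_functor C M ?K" using z is_functor_constant by (simp add: is_initial_def)
  obtain \<tau> where \<tau>: "is_nattr C M (?K, I, \<tau>)" using nattr_from_constant[OF z IF] .
  have "\<exists>!t. t \<in> Hom (reedy_model C M) I ?K" using I K by (simp add: is_initial_def)
  then obtain \<sigma> where \<sigma>: "is_nattr C M (I, ?K, \<sigma>)" unfolding Hom_reedy_model by blast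
  have \<sigma>a: "\<sigma> a \<in> Hom M (FObj I a) z" and \<tau>a: "\<tau> a \<in> Hom M z (FObj I a)" if "a \<in> Obj C" for a
    using is_nattrD(4)[OF \<sigma> that] is_nattrD(4)[OF \<tau> that] that by (simp_all add: constant_functor_def)
  have id: "is_nattr C M (I, I, \<lambda>a\<in>Obj C. Ide M (FObj I a))"
  proof -
    have "FArr I f \<cdot>\<^bsub>M\<^esub> Ide M (FObj I (Dom C f)) = Ide M (FObj I (Cod C f)) \<cdot>\<^bsub>M\<^esub> FArr I f"
      if "f \<in> Arr C" for f
      using M.Cmp_Ide M.Ide_Cmp is_functorD(2)[OF IF C.Arr_Hom[OF that]] by metis
    then show ?thesis
      using IF is_functorD(1)[OF IF] M.Ide_in C.Dom_in C.Cod_in by (simp add: is_nattr_def)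
  qed
  have cmp: "is_nattr C M (I, I, \<lambda>a\<in>Obj C. \<tau> a \<cdot>\<^bsub>M\<^esub> \<sigma> a)"
  proof -
    have "FArr I f \<cdot>\<^bsub>M\<^esub> \<tau> (Dom C f) \<cdot>\<^bsub>M\<^esub> \<sigma> (Dom C f) = (\<tau> (Cod C f) \<cdot>\<^bsub>M\<^esub> \<sigma> (Cod C f)) \<cdot>\<^bsub>M\<^esub> FArr I f"
      if f: "f \<in> Arr C" for f
    proof -
      have d: "Dom C f \<in> Obj C" "Cod C f \<in> Obj C" using C.Dom_in C.Cod_in f by auto
      note If = is_functorD(2)[OF IF C.Arr_Hom[OF f]]
      have \<tau>n: "FArr I f \<cdot>\<^bsub>M\<^esub> \<tau> (Dom C f) = \<tau> (Cod C f)" and \<sigma>n: "\<sigma> (Cod C f) \<cdot>\<^bsub>M\<^esub> FArr I f = \<sigma> (Dom C f)"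
        using is_nattrD(5)[OF \<tau> f] is_nattrD(5)[OF \<sigma> f] M.Cmp_Ide[OF \<tau>a[OF d(2)]] M.Ide_Cmp[OF \<sigma>a[OF d(1)]] f
        by (simp_all add: constant_functor_def)
      show ?thesis
        using M.Cmp_assoc[OF \<sigma>a[OF d(1)] \<tau>a[OF d(1)] If] M.Cmp_assoc[OF If \<sigma>a[OF d(2)] \<tau>a[OF d(2)]] \<tau>n \<sigma>n
        by simp
    qed
    then show ?thesis
      using IF M.Cmp_in[OF \<sigma>a \<tau>a] C.Dom_in C.Cod_in by (simp add: is_nattr_def)
  qed
  have "\<exists>!t. t \<in> Hom (reedy_model C M) I I" using I by (simp add: is_initial_def)
  \<comment> \<open>The round trip from \<open>I\<close> through the constant diagram is an endomorphism of an initial object.\<close>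
  with id cmp have "(\<lambda>a\<in>Obj C. \<tau> a \<cdot>\<^bsub>M\<^esub> \<sigma> a) = (\<lambda>a\<in>Obj C. Ide M (FObj I a))"
    unfolding Hom_reedy_model by blast
  from fun_cong[OF this, of a] have split: "\<tau> a \<cdot>\<^bsub>M\<^esub> \<sigma> a = Ide M (FObj I a)" using a by simp
  have "\<exists>!h. h \<in> Hom M (FObj I a) x" if x: "x \<in> Obj M" for x
  proof -
    obtain h where h: "h \<in> Hom M z x" using M.initial_arrow[OF z x] .
    have "g = h \<cdot>\<^bsub>M\<^esub> \<sigma> a" if g: "g \<in> Hom M (FObj I a) x" for g
    proof -
      have "g \<cdot>\<^bsub>M\<^esub> \<tau> a = h" by (rule M.initial_arrows_eq[OF z M.Cmp_in[OF \<tau>a[OF a] g] h])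
      then show ?thesis using M.Cmp_assoc[OF \<sigma>a[OF a] \<tau>a[OF a] g] split M.Cmp_Ide[OF g] by simp
    qed
    then show ?thesis using M.Cmp_in[OF \<sigma>a[OF a] h] by blast
  qed
  then show ?thesis using is_functorD(1)[OF IF a] by (simp add: is_initial_def)
qed

text \<open>The definition of cofibrancy lets one choose the initial diagram. By \<open>relative_latching_map_lifting\<close> the
choice does not affect the condition, so in one direction any given initial diagram will do and in the
other the constant one.\<close>

theorem cofibrant_iff_latching_lifting:
  "cofibrant (reedy_model C M) X \<longleftrightarrow> is_functor C M X \<and>
     (\<forall>a\<in>Obj C. \<forall>q\<in>Fib M \<inter> Weq M. latching_lifting C M X a q)"
proof -
  have key: "(I, X, \<tau>) \<in> Cof (reedy_model C M) \<longleftrightarrow>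
      (\<forall>a\<in>Obj C. \<forall>q\<in>Fib M \<inter> Weq M. latching_lifting C M X a q)"
    if I: "is_initial (reedy_model C M) I" and t: "is_nattr C M (I, X, \<tau>)" for I \<tau>
  proof -
    have "relative_latching_map C M a (I, X, \<tau>) \<in> Cof M \<longleftrightarrow> (\<forall>q\<in>Fib M \<inter> Weq M. latching_lifting C M X a q)"
      if a: "a \<in> Obj C" for a
    proof -
      have q: "q \<in> Arr M" if "q \<in> Fib M \<inter> Weq M" for q using that M.Fib_Arr by blast
      note r = relative_latching_map_lifting[OF t _ a]
      show ?thesis
        using M.cofibration_iff_lifting[OF r(1)] r(2)[OF _ q]
        initial_functor_pointwise[OF I] by blast
    qed
    then show ?thesis using t by simp
  qed
  obtain z where z: "is_initial M z" using M.initial_exists[OF M.colimits] ..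
  show ?thesis
  proof
    assume "cofibrant (reedy_model C M) X"
    then obtain I \<tau> where I: "is_initial (reedy_model C M) I" "is_nattr C M (I, X, \<tau>)"
      "(I, X, \<tau>) \<in> Cof (reedy_model C M)"
      unfolding cofibrant_def Hom_reedy_model by blast
    show "is_functor C M X \<and> (\<forall>a\<in>Obj C. \<forall>q\<in>Fib M \<inter> Weq M. latching_lifting C M X a q)"
      using key[OF I(1,2)] I(3) is_nattrD(2)[OF I(2)] by blast
  next
    assume X: "is_functor C M X \<and> (\<forall>a\<in>Obj C. \<forall>q\<in>Fib M \<inter> Weq M. latching_lifting C M X a q)"
    then obtain \<tau> where t: "is_nattr C M (constant_functor C M z, X, \<tau>)" using nattr_from_constant[OF z] by blast
    from key[OF is_initial_constant_functor[OF z] t] X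
    have "(constant_functor C M z, X, \<tau>) \<in> Cof (reedy_model C M)" by blast
    moreover have "X \<in> Obj (reedy_model C M)" using X by simp
    ultimately show "cofibrant (reedy_model C M) X"
      using is_initial_constant_functor[OF z] t unfolding cofibrant_def Hom_reedy_model by blast
  qed
qed

end


section \<open>Extending maps from sieves of direct arrows\<close>

text \<open>For the sieve of all non-identity direct arrows into \<open>\<alpha>\<close> this is the hypothesis at \<open>\<alpha>\<close>. For a general
sieve \<open>A\<close> the family is first enlarged: once it is defined on all arrows whose domain has degree less
than \<open>n\<close>, an arrow \<open>\<psi>\<close> whose domain has degree \<open>n\<close> receives a value by lifting at its domain, because
all composites of \<open>\<psi>\<close> with non-identity direct arrows are already treated. Past the degree of \<open>\<alpha>\<close> the
family contains the identity of \<open>\<alpha>\<close>, and the value there is the required map.\<close>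

lemma (in reedy_category) sieve_extension:
  fixes X :: "('o, 'a, 'x, 'y) fctr"
  assumes M: "category M" and X: "is_functor C M X" and q: "q \<in> Arr M"
    and lift: "\<And>a. a \<in> Obj C \<Longrightarrow> latching_lifting C M X a q"
    and \<alpha>: "\<alpha> \<in> Obj C"
    and A: "\<And>\<psi>. \<psi> \<in> A \<Longrightarrow> \<psi> \<in> Direct C \<and> Cod C \<psi> = \<alpha>"
      "\<And>\<psi> \<phi>. \<psi> \<in> A \<Longrightarrow> \<phi> \<in> Direct C \<Longrightarrow> Cod C \<phi> = Dom C \<psi> \<Longrightarrow> \<psi> \<cdot> \<phi> \<in> A"
    and b: "b \<in> Hom M (FObj X \<alpha>) (Cod M q)"
    and e: "\<And>\<psi>. \<psi> \<in> A \<Longrightarrow> e \<psi> \<in> Hom M (FObj X (Dom C \<psi>)) (Dom M q)"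
      "\<And>\<psi>. \<psi> \<in> A \<Longrightarrow> q \<cdot>\<^bsub>M\<^esub> e \<psi> = b \<cdot>\<^bsub>M\<^esub> FArr X \<psi>"
      "\<And>\<psi> \<phi>. \<psi> \<in> A \<Longrightarrow> \<phi> \<in> Direct C \<Longrightarrow> Cod C \<phi> = Dom C \<psi> \<Longrightarrow>
        e \<psi> \<cdot>\<^bsub>M\<^esub> FArr X \<phi> = e (\<psi> \<cdot> \<phi>)"
  shows "\<exists>d\<in>Hom M (FObj X \<alpha>) (Dom M q). q \<cdot>\<^bsub>M\<^esub> d = b \<and>
    (\<forall>\<psi>\<in>A. d \<cdot>\<^bsub>M\<^esub> FArr X \<psi> = e \<psi>)"
proof -
  interpret M: category M by fact
  obtain deg :: "'o \<Rightarrow> nat" where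
    deg: "\<And>f. f \<in> Direct C \<Longrightarrow> f \<noteq> Ide C (Cod C f) \<Longrightarrow> deg (Dom C f) < deg (Cod C f)"
    using direct_degree by blast
  define W where "W = {\<psi> \<in> Direct C. Cod C \<psi> = \<alpha>}"
  \<comment> \<open>The sieves of the induction, and the compatible families over \<open>b\<close> on a set of arrows.\<close>
  define B where "B n = A \<union> {\<psi> \<in> W. deg (Dom C \<psi>) < n}" for n
  define lifts where "lifts T d \<longleftrightarrow>
      (\<forall>\<psi>\<in>T. d \<psi> \<in> Hom M (FObj X (Dom C \<psi>)) (Dom M q) \<and> q \<cdot>\<^bsub>M\<^esub> d \<psi> = b \<cdot>\<^bsub>M\<^esub> FArr X \<psi> \<and>
        (\<forall>\<phi>\<in>Direct C. Cod C \<phi> = Dom C \<psi> \<longrightarrow> d \<psi> \<cdot>\<^bsub>M\<^esub> FArr X \<phi> = d (\<psi> \<cdot> \<phi>)))" for T d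
  have qH: "q \<in> Hom M (Dom M q) (Cod M q)" using q by (simp add: Hom_iff)
  have AW: "A \<subseteq> W" using A(1) by (auto simp: W_def)
  have W: "\<psi> \<cdot> \<phi> \<in> W" "Dom C (\<psi> \<cdot> \<phi>) = Dom C \<phi>" if "\<psi> \<in> W" "\<phi> \<in> Direct C" "Cod C \<phi> = Dom C \<psi>" for \<psi> \<phi>
    using that Direct_Cmp[of \<phi> \<psi>] Cmp_simps[of \<phi> \<psi>] Direct_Arr by (auto simp: W_def)
  have WH: "\<psi> \<in> Hom C (Dom C \<psi>) \<alpha>" "Dom C \<psi> \<in> Obj C" if "\<psi> \<in> W" for \<psi>
    using that Direct_Arr Dom_in by (auto simp: W_def Hom_iff)
  have DH: "\<phi> \<in> Hom C (Dom C \<phi>) (Cod C \<phi>)" if "\<phi> \<in> Direct C" for \<phi>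
    using that Direct_Arr by (simp add: Hom_iff)
  have step: "\<exists>d'. lifts (B (Suc n)) d' \<and> (\<forall>\<psi>\<in>A. d' \<psi> = e \<psi>)"
    if d: "lifts (B n) d" "\<forall>\<psi>\<in>A. d \<psi> = e \<psi>" for n d
  proof -
    have BW: "B k \<subseteq> W" for k using AW by (auto simp: B_def)
    have sieve: "\<psi> \<cdot> \<phi> \<in> B n" if "\<psi> \<in> B n" "\<phi> \<in> Direct C" "Cod C \<phi> = Dom C \<psi>" for \<psi> \<phi>
    proof (cases "\<psi> \<in> A")
      case False
      then have \<psi>: "\<psi> \<in> W" "deg (Dom C \<psi>) < n" using that by (auto simp: B_def)
      have "deg (Dom C \<phi>) \<le> deg (Dom C \<psi>)"
        using deg[OF that(2)] that(3) Ide_simps(2)[OF WH(2)[OF \<psi>(1)]]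
        by (cases "\<phi> = Ide C (Dom C \<psi>)") auto
      then show ?thesis using W[OF \<psi>(1) that(2,3)] \<psi>(2) by (simp add: B_def)
    qed (use A(2) that in \<open>auto simp: B_def\<close>)
    have lower: "\<psi> \<cdot> \<phi> \<in> B n" if "\<psi> \<in> B (Suc n)" "\<phi> \<in> Obj (latching_cat C (Dom C \<psi>))" for \<psi> \<phi>
    proof (cases "\<psi> \<in> A")
      case True then show ?thesis using A(2) that by (auto simp: B_def Obj_latching_cat)
    next
      case False
      then have "\<psi> \<in> W" "deg (Dom C \<psi>) \<le> n" using that by (auto simp: B_def)
      moreover have "\<phi> \<in> Direct C" "Cod C \<phi> = Dom C \<psi>" "deg (Dom C \<phi>) < deg (Dom C \<psi>)"
        using that(2) deg[of \<phi>] by (auto simp: Obj_latching_cat)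
      ultimately show ?thesis using W[of \<psi> \<phi>] by (simp add: B_def)
    qed
    have "\<exists>c. c \<in> Hom M (FObj X (Dom C \<psi>)) (Dom M q) \<and> q \<cdot>\<^bsub>M\<^esub> c = b \<cdot>\<^bsub>M\<^esub> FArr X \<psi> \<and>
        (\<forall>\<phi>\<in>Obj (latching_cat C (Dom C \<psi>)). c \<cdot>\<^bsub>M\<^esub> FArr X \<phi> = d (\<psi> \<cdot> \<phi>))"
      if \<psi>: "\<psi> \<in> B (Suc n)" for \<psi>
    proof -
      let ?J = "latching_cat C (Dom C \<psi>)"
      have \<psi>W: "\<psi> \<in> W" using BW \<psi> by blast
      note X\<psi> = is_functorD(2)[OF X WH(1)[OF \<psi>W]]
      have J: "\<phi> \<in> Direct C" "Cod C \<phi> = Dom C \<psi>" "Dom C (\<psi> \<cdot> \<phi>) = Dom C \<phi>"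
        "d (\<psi> \<cdot> \<phi>) \<in> Hom M (FObj X (Dom C \<phi>)) (Dom M q)"
        "q \<cdot>\<^bsub>M\<^esub> d (\<psi> \<cdot> \<phi>) = b \<cdot>\<^bsub>M\<^esub> FArr X (\<psi> \<cdot> \<phi>)" if "\<phi> \<in> Obj ?J" for \<phi>
      proof -
        show *: "\<phi> \<in> Direct C" "Cod C \<phi> = Dom C \<psi>" using that by (auto simp: Obj_latching_cat)
        show **: "Dom C (\<psi> \<cdot> \<phi>) = Dom C \<phi>" using W[OF \<psi>W *] by simp
        show "d (\<psi> \<cdot> \<phi>) \<in> Hom M (FObj X (Dom C \<phi>)) (Dom M q)"
          "q \<cdot>\<^bsub>M\<^esub> d (\<psi> \<cdot> \<phi>) = b \<cdot>\<^bsub>M\<^esub> FArr X (\<psi> \<cdot> \<phi>)"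
          using d(1) lower[OF \<psi> that] ** unfolding lifts_def by metis+
      qed
      have "is_cocone ?J M (latching_diagram C (Dom C \<psi>) X) (Dom M q) (\<lambda>\<phi>. d (\<psi> \<cdot> \<phi>))"
        unfolding is_cocone_def
      proof (intro conjI ballI)
        show "Dom M q \<in> Obj M" using M.Dom_in[OF q] .
        show "d (\<psi> \<cdot> \<phi>) \<in> Hom M (FObj (latching_diagram C (Dom C \<psi>) X) \<phi>) (Dom M q)"
          if "\<phi> \<in> Obj ?J" for \<phi> using J(4)[OF that] that by simp
        fix u assume u: "u \<in> Arr ?J"
        obtain \<phi> \<phi>' h where u': "u = (\<phi>, \<phi>', h)" by (cases u)
        have h: "\<phi>' \<in> Obj ?J" "h \<in> Direct C" "Cod C h = Dom C \<phi>'" "\<phi>' \<cdot> h = \<phi>"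
          using u by (auto simp: u' Arr_latching_cat Hom_iff)
        have "d (\<psi> \<cdot> \<phi>') \<cdot>\<^bsub>M\<^esub> FArr X h = d ((\<psi> \<cdot> \<phi>') \<cdot> h)"
          using d(1) lower[OF \<psi> h(1)] h J(3)[OF h(1)] unfolding lifts_def by metis
        also have "(\<psi> \<cdot> \<phi>') \<cdot> h = \<psi> \<cdot> \<phi>"
          using Cmp_assoc[OF _ _ WH(1)[OF \<psi>W], of h _ _ \<phi>'] DH[OF h(2)] DH[OF J(1)[OF h(1)]] J(2)[OF h(1)] h
          by simp
        finally show "d (\<psi> \<cdot> Cod ?J u) \<cdot>\<^bsub>M\<^esub> FArr (latching_diagram C (Dom C \<psi>) X) u = d (\<psi> \<cdot> Dom ?J u)"
          using u by (simp add: u')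
      qed
      moreover have "b \<cdot>\<^bsub>M\<^esub> FArr X \<psi> \<in> Hom M (FObj X (Dom C \<psi>)) (Cod M q)"
        by (rule M.Cmp_in[OF X\<psi> b])
      moreover have "q \<cdot>\<^bsub>M\<^esub> d (\<psi> \<cdot> \<phi>) = (b \<cdot>\<^bsub>M\<^esub> FArr X \<psi>) \<cdot>\<^bsub>M\<^esub> FArr X \<phi>" if \<phi>: "\<phi> \<in> Obj ?J" for \<phi>
      proof -
        have \<phi>H: "\<phi> \<in> Hom C (Dom C \<phi>) (Dom C \<psi>)" using latching_Obj(1)[OF \<phi>] .
        show ?thesis
          using J(5)[OF \<phi>] is_functorD(4)[OF X \<phi>H WH(1)[OF \<psi>W]]
            M.Cmp_assoc[OF is_functorD(2)[OF X \<phi>H] X\<psi> b] by simp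
      qed
      ultimately show ?thesis
        using lift[OF WH(2)[OF \<psi>W]] unfolding latching_lifting_def by blast
    qed
    then obtain c where c: "\<And>\<psi>. \<psi> \<in> B (Suc n) \<Longrightarrow> c \<psi> \<in> Hom M (FObj X (Dom C \<psi>)) (Dom M q)"
      "\<And>\<psi>. \<psi> \<in> B (Suc n) \<Longrightarrow> q \<cdot>\<^bsub>M\<^esub> c \<psi> = b \<cdot>\<^bsub>M\<^esub> FArr X \<psi>"
      "\<And>\<psi> \<phi>. \<psi> \<in> B (Suc n) \<Longrightarrow> \<phi> \<in> Obj (latching_cat C (Dom C \<psi>)) \<Longrightarrow> c \<psi> \<cdot>\<^bsub>M\<^esub> FArr X \<phi> = d (\<psi> \<cdot> \<phi>)"
      by metis
    \<comment> \<open>Old values are kept, so the new family still agrees with \<open>e\<close> on \<open>A\<close>.\<close>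
    define d' where "d' \<psi> = (if \<psi> \<in> B n then d \<psi> else c \<psi>)" for \<psi>
    have "lifts (B (Suc n)) d'"
      unfolding lifts_def
    proof (intro ballI conjI impI)
      fix \<psi> assume \<psi>: "\<psi> \<in> B (Suc n)"
      then have \<psi>W: "\<psi> \<in> W" using BW by blast
      show d'H: "d' \<psi> \<in> Hom M (FObj X (Dom C \<psi>)) (Dom M q)" "q \<cdot>\<^bsub>M\<^esub> d' \<psi> = b \<cdot>\<^bsub>M\<^esub> FArr X \<psi>"
        using d(1) c \<psi> by (auto simp: d'_def lifts_def)
      fix \<phi> assume \<phi>: "\<phi> \<in> Direct C" "Cod C \<phi> = Dom C \<psi>"
      show "d' \<psi> \<cdot>\<^bsub>M\<^esub> FArr X \<phi> = d' (\<psi> \<cdot> \<phi>)"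
      proof (cases "\<psi> \<in> B n")
        case True
        then show ?thesis using d(1) sieve[OF True \<phi>] \<phi> by (simp add: d'_def lifts_def)
      next
        case False
        show ?thesis
        proof (cases "\<phi> = Ide C (Dom C \<psi>)")
          case True
          then show ?thesis
            using Cmp_Ide[OF WH(1)[OF \<psi>W]] is_functorD(3)[OF X WH(2)[OF \<psi>W]] M.Cmp_Ide[OF d'H(1)] by simp
        next
          case ne: False
          then have "\<phi> \<in> Obj (latching_cat C (Dom C \<psi>))" using \<phi> by (simp add: Obj_latching_cat)
          then show ?thesis using c(3)[OF \<psi>] lower[OF \<psi>] False by (simp add: d'_def)
        qed
      qed
    qed
    moreover have "\<forall>\<psi>\<in>A. d' \<psi> = e \<psi>" using d(2) by (simp add: d'_def B_def)
    ultimately show ?thesis by blast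
  qed
  have "\<exists>d. lifts (B n) d \<and> (\<forall>\<psi>\<in>A. d \<psi> = e \<psi>)" for n
  proof (induction n)
    case 0
    have "lifts (B 0) e" using e by (simp add: lifts_def B_def)
    then show ?case by blast
  qed (use step in blast)
  then obtain d where d: "lifts (B (Suc (deg \<alpha>))) d" "\<forall>\<psi>\<in>A. d \<psi> = e \<psi>" by blast
  have id: "Ide C \<alpha> \<in> B (Suc (deg \<alpha>))" using \<alpha> Direct_Ide by (simp add: B_def W_def)
  have "d (Ide C \<alpha>) \<in> Hom M (FObj X \<alpha>) (Dom M q)" "q \<cdot>\<^bsub>M\<^esub> d (Ide C \<alpha>) = b"
    using d(1) id \<alpha> is_functorD(3)[OF X \<alpha>] M.Cmp_Ide[OF b] by (auto simp: lifts_def)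
  moreover have "d (Ide C \<alpha>) \<cdot>\<^bsub>M\<^esub> FArr X \<psi> = e \<psi>" if "\<psi> \<in> A" for \<psi>
  proof -
    have "d (Ide C \<alpha>) \<cdot>\<^bsub>M\<^esub> FArr X \<psi> = d (Ide C \<alpha> \<cdot> \<psi>)"
      using d(1) id \<alpha> A(1)[OF that] by (simp add: lifts_def)
    then show ?thesis using Ide_Cmp[OF WH(1)] AW that d(2) by auto
  qed
  ultimately show ?thesis by blast
qed


section \<open>Slices of cofibrant diagrams\<close>

locale reedy_slice = reedy_category C for C :: "('o, 'a) reedy" (structure) +
  fixes m p :: nat and c :: "nat \<Rightarrow> 'o"
  assumes p: "p < m" and c: "\<And>i. i < m \<Longrightarrow> i \<noteq> p \<Longrightarrow> c i \<in> Obj C"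
begin

abbreviation P where "P \<equiv> power_reedy C m"
abbreviation G where "G \<equiv> slice_functor C m p c"

lemma reedy_category_P: "reedy_category P"
  by (rule reedy_category_power) (rule reedy_category_axioms)

lemma slice_functor_Obj: "a \<in> Obj C \<Longrightarrow> FObj G a \<in> Obj P"
  using c by (auto simp: slice_functor_def power_reedy_def)

lemma slice_functor_Hom: "f \<in> Hom C a b \<Longrightarrow> FArr G f \<in> Hom P (FObj G a) (FObj G b)"
  using c Dom_in Cod_in
  by (auto simp: slice_functor_def Hom_power_iff Hom_iff[of _ C] intro!: restrict_ext)

lemma slice_functor_Ide: "a \<in> Obj C \<Longrightarrow> FArr G (Ide C a) = Ide P (FObj G a)"
  by (auto simp: slice_functor_def power_reedy_def intro!: restrict_ext)

lemma slice_functor_Cmp: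
  "f \<in> Hom C a b \<Longrightarrow> g \<in> Hom C b d \<Longrightarrow> FArr G (g \<cdot> f) = FArr G g \<cdot>\<^bsub>P\<^esub> FArr G f"
  using c Cmp_Ide[OF Ide_in]
  by (auto simp: slice_functor_def power_reedy_def Hom_iff intro!: restrict_ext)

lemma slice_functor_Direct: "f \<in> Direct C \<Longrightarrow> FArr G f \<in> Direct P"
  using c Direct_Ide Direct_Arr by (auto simp: slice_functor_def power_reedy_def)

lemma is_functor_slice:
  assumes "is_functor P M X"
  shows "is_functor C M (restrict_along C X G)"
proof (rule is_functor_restrict_along[OF _ _ _ _ _ assms])
  show "FArr G f \<in> Hom P (FObj G (Dom C f)) (FObj G (Cod C f))" if "f \<in> Arr C" for f
    using that by (intro slice_functor_Hom) (simp add: Hom_iff)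
  show "FArr G (g \<cdot> f) = FArr G g \<cdot>\<^bsub>P\<^esub> FArr G f" if "f \<in> Arr C" "g \<in> Arr C" "Dom C g = Cod C f" for f g
    using that by (intro slice_functor_Cmp) (auto simp: Hom_iff)
qed (use slice_functor_Obj slice_functor_Ide category_axioms in auto)

text \<open>The factor of a direct arrow \<open>\<psi>\<close> into \<open>FObj G a\<close> that moves the fixed coordinates only: \<open>\<psi>\<close> is
  \<open>FArr G (\<psi> p)\<close> after \<open>transverse \<psi>\<close>.\<close>

definition transverse :: "(nat \<Rightarrow> 'a) \<Rightarrow> nat \<Rightarrow> 'a" where
  "transverse \<psi> = (\<lambda>i\<in>{..<m}. if i = p then Ide C (Dom C (\<psi> p)) else \<psi> i)"

lemma power_DirectD:
  assumes "\<psi> \<in> Direct P" "i < m"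
  shows "\<psi> i \<in> Direct C" "\<psi> i \<in> Arr C" "Dom C (\<psi> i) \<in> Obj C" "Dom P \<psi> i = Dom C (\<psi> i)" "Cod P \<psi> i = Cod C (\<psi> i)"
proof -
  show "\<psi> i \<in> Direct C" using assms by (auto simp: power_reedy_def)
  then show "\<psi> i \<in> Arr C" by (rule Direct_Arr)
  then show "Dom C (\<psi> i) \<in> Obj C" by (rule Dom_in)
qed (use assms in \<open>simp_all add: power_reedy_def\<close>)

lemma slice_functor_apply:
  assumes "a \<in> Obj C" "i < m"
  shows "FObj G a i = (if i = p then a else c i)"
  using assms by (simp add: slice_functor_def)

lemma transverse:
  assumes \<psi>: "\<psi> \<in> Direct P" "Cod P \<psi> = FObj G a" and a: "a \<in> Obj C"
  shows "\<psi> p \<in> Hom C (Dom C (\<psi> p)) a"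
    and "transverse \<psi> \<in> Direct P"
    and "transverse \<psi> \<in> Hom P (Dom P \<psi>) (FObj G (Dom C (\<psi> p)))"
    and "FArr G (\<psi> p) \<cdot>\<^bsub>P\<^esub> transverse \<psi> = \<psi>"
proof -
  note D = power_DirectD[OF \<psi>(1)]
  have cod: "Cod C (\<psi> i) = (if i = p then a else c i)" if "i < m" for i
    using fun_cong[OF \<psi>(2), of i] D(5)[OF that] slice_functor_apply[OF a that] by simp
  show "\<psi> p \<in> Hom C (Dom C (\<psi> p)) a" using cod[OF p] D(2)[OF p] by (simp add: Hom_iff)
  show *: "transverse \<psi> \<in> Direct P"
    using D(1) Direct_Ide[OF D(3)[OF p]] by (auto simp: transverse_def power_reedy_def)
  have "Dom P (transverse \<psi>) = Dom P \<psi>"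
    using D(3)[OF p] by (auto simp: transverse_def power_reedy_def intro!: restrict_ext)
  moreover have "Cod P (transverse \<psi>) = FObj G (Dom C (\<psi> p))"
    using D(3)[OF p] cod by (auto simp: transverse_def power_reedy_def slice_functor_def intro!: restrict_ext)
  moreover have "transverse \<psi> \<in> Arr P" using * reedy_category.Direct_Arr[OF reedy_category_P] by blast
  ultimately show "transverse \<psi> \<in> Hom P (Dom P \<psi>) (FObj G (Dom C (\<psi> p)))" by (simp add: Hom_iff)
  show "FArr G (\<psi> p) \<cdot>\<^bsub>P\<^esub> transverse \<psi> = \<psi>"
  proof (rule extensionalityI[of _ "{..<m}"])
    show "(FArr G (\<psi> p) \<cdot>\<^bsub>P\<^esub> transverse \<psi>) i = \<psi> i" if "i \<in> {..<m}" for i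
    proof -
      have i: "i < m" using that by simp
      have "\<psi> i \<in> Hom C (Dom C (\<psi> i)) (Cod C (\<psi> i))" using D(2)[OF i] by (rule Arr_Hom)
      then show ?thesis
        using i D(2)[OF p] cod[OF i] Cmp_Ide[of "\<psi> i"] Ide_Cmp[of "\<psi> i"]
        by (auto simp: transverse_def slice_functor_def power_reedy_def)
    qed
    show "FArr G (\<psi> p) \<cdot>\<^bsub>P\<^esub> transverse \<psi> \<in> extensional {..<m}" by (simp add: power_reedy_def)
    show "\<psi> \<in> extensional {..<m}" using \<psi>(1) by (simp add: power_reedy_def PiE_iff)
  qed
qed

text \<open>Precomposing \<open>\<psi>\<close> with \<open>\<phi>\<close> changes the coordinate \<open>p\<close> of \<open>\<psi>\<close> by \<open>\<phi> p\<close> and the transverse factor by the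
rest of \<open>\<phi>\<close>. Since the two kinds of movement commute, families pulled back along \<open>transverse\<close> stay
compatible.\<close>

lemma transverse_Cmp:
  assumes \<psi>: "\<psi> \<in> Direct P" "Cod P \<psi> = FObj G a" and a: "a \<in> Obj C"
    and \<phi>: "\<phi> \<in> Direct P" "Cod P \<phi> = Dom P \<psi>"
  shows "\<phi> p \<in> Direct C" "\<phi> p \<in> Hom C (Dom C (\<phi> p)) (Dom C (\<psi> p))"
    and "(\<psi> \<cdot>\<^bsub>P\<^esub> \<phi>) p = \<psi> p \<cdot> \<phi> p"
    and "transverse \<psi> \<cdot>\<^bsub>P\<^esub> \<phi> = FArr G (\<phi> p) \<cdot>\<^bsub>P\<^esub> transverse (\<psi> \<cdot>\<^bsub>P\<^esub> \<phi>)"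
proof -
  note D = power_DirectD[OF \<psi>(1)] and E = power_DirectD[OF \<phi>(1)]
  have cd: "Cod C (\<phi> i) = Dom C (\<psi> i)" if "i < m" for i
    using fun_cong[OF \<phi>(2), of i] D(4)[OF that] E(5)[OF that] by simp
  show "\<phi> p \<in> Direct C" by (rule E(1)[OF p])
  show \<phi>p: "\<phi> p \<in> Hom C (Dom C (\<phi> p)) (Dom C (\<psi> p))" using E(2)[OF p] cd[OF p] by (simp add: Hom_iff)
  show eq: "(\<psi> \<cdot>\<^bsub>P\<^esub> \<phi>) p = \<psi> p \<cdot> \<phi> p" using p by (simp add: power_reedy_def)
  have dom: "Dom C (\<psi> p \<cdot> \<phi> p) = Dom C (\<phi> p)" using Cmp_simps(2)[OF E(2)[OF p] D(2)[OF p]] cd[OF p] by simp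
  have "(transverse \<psi> \<cdot>\<^bsub>P\<^esub> \<phi>) i = (FArr G (\<phi> p) \<cdot>\<^bsub>P\<^esub> transverse (\<psi> \<cdot>\<^bsub>P\<^esub> \<phi>)) i" if i: "i < m" for i
  proof (cases "i = p")
    case True
    then show ?thesis using i E(2)[OF p] Cmp_Ide[OF \<phi>p] Ide_Cmp[OF \<phi>p] dom
      by (simp add: transverse_def slice_functor_def power_reedy_def)
  next
    case False
    have "Cod C (\<psi> i) = c i"
      using fun_cong[OF \<psi>(2), of i] D(5)[OF i] slice_functor_apply[OF a i] False by simp
    then have "\<psi> i \<cdot> \<phi> i \<in> Hom C (Dom C (\<phi> i)) (c i)"
      using Cmp_simps[OF E(2)[OF i] D(2)[OF i]] cd[OF i] by (simp add: Hom_iff)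
    from Ide_Cmp[OF this] show ?thesis
      using i False E(2)[OF p] by (simp add: transverse_def slice_functor_def power_reedy_def)
  qed
  then show "transverse \<psi> \<cdot>\<^bsub>P\<^esub> \<phi> = FArr G (\<phi> p) \<cdot>\<^bsub>P\<^esub> transverse (\<psi> \<cdot>\<^bsub>P\<^esub> \<phi>)"
    by (intro extensionalityI[of _ "{..<m}"]) (auto simp: power_reedy_def)
qed

lemma transverse_slice_functor:
  assumes "f \<in> Arr C"
  shows "transverse (FArr G f) = Ide P (FObj G (Dom C f))"
  using assms p Dom_in[OF assms]
  by (auto simp: transverse_def slice_functor_def power_reedy_def intro!: restrict_ext)

text \<open>A family \<open>k\<close> for the slice at \<open>a\<close> gives \<open>k (\<psi> p)\<close> after \<open>X (transverse \<psi>)\<close> on the sieve of those \<open>\<psi>\<close>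
with \<open>\<psi> p\<close> not an identity. On the arrows \<open>FArr G f\<close> the transverse factor is an identity, so the
extension of this family restricts to \<open>k\<close>.\<close>

lemma slice_latching_lifting:
  assumes M: "category M" and X: "is_functor P M X" and q: "q \<in> Arr M"
    and lift: "\<And>\<alpha>. \<alpha> \<in> Obj P \<Longrightarrow> latching_lifting P M X \<alpha> q"
    and a: "a \<in> Obj C"
  shows "latching_lifting C M (restrict_along C X G) a q"
  unfolding latching_lifting_def
proof (intro allI impI)
  let ?S = "restrict_along C X G" and ?J = "latching_cat C a"
  interpret M: category M by fact
  interpret P: reedy_category P by (rule reedy_category_P)
  have SO: "FObj ?S d = FObj X (FObj G d)" if "d \<in> Obj C" for d using that by (simp add: restrict_along_def)
  have SA: "FArr ?S f = FArr X (FArr G f)" if "f \<in> Arr C" for f using that by (simp add: restrict_along_def)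
  fix k b
  assume k: "is_cocone ?J M (latching_diagram C a ?S) (Dom M q) k"
    and b: "b \<in> Hom M (FObj ?S a) (Cod M q)"
    and kb: "\<forall>f\<in>Obj ?J. q \<cdot>\<^bsub>M\<^esub> k f = b \<cdot>\<^bsub>M\<^esub> FArr ?S f"
  have qH: "q \<in> Hom M (Dom M q) (Cod M q)" using q by (simp add: Hom_iff)
  have b': "b \<in> Hom M (FObj X (FObj G a)) (Cod M q)" using b SO[OF a] by simp
  have kH: "k f \<in> Hom M (FObj X (FObj G (Dom C f))) (Dom M q)" if "f \<in> Obj ?J" for f
    using k that SO[OF latching_Obj(2)[OF that]] by (auto simp: is_cocone_def)
  have kq: "q \<cdot>\<^bsub>M\<^esub> k f = b \<cdot>\<^bsub>M\<^esub> FArr X (FArr G f)" if "f \<in> Obj ?J" for f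
    using kb SA latching_Obj(1)[OF that] that by (simp add: Hom_iff)
  have kc: "k g \<cdot>\<^bsub>M\<^esub> FArr X (FArr G h) = k f" if u: "(f, g, h) \<in> Arr ?J" for f g h
  proof -
    have "k (Cod ?J (f, g, h)) \<cdot>\<^bsub>M\<^esub> FArr (latching_diagram C a ?S) (f, g, h) = k (Dom ?J (f, g, h))"
      using k u unfolding is_cocone_def by blast
    then show ?thesis using u SA[of h] by (simp add: Arr_latching_cat Hom_iff)
  qed
  define A where "A = {\<psi> \<in> Direct P. Cod P \<psi> = FObj G a \<and> \<psi> p \<noteq> Ide C a}"
  define e where "e \<psi> = k (\<psi> p) \<cdot>\<^bsub>M\<^esub> FArr X (transverse \<psi>)" for \<psi>
  have A: "\<psi> \<in> Direct P" "Cod P \<psi> = FObj G a" "\<psi> p \<in> Obj ?J" if "\<psi> \<in> A" for \<psi>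
  proof -
    show *: "\<psi> \<in> Direct P" "Cod P \<psi> = FObj G a" using that by (auto simp: A_def)
    show "\<psi> p \<in> Obj ?J"
      using power_DirectD(1)[OF *(1) p] transverse(1)[OF * a] that by (simp add: A_def Obj_latching_cat Hom_iff)
  qed
  \<comment> \<open>\<open>A\<close> is a sieve, and \<open>\<phi> p\<close> is an arrow of the latching category of \<open>C\<close> at \<open>a\<close>.\<close>
  have step: "(\<psi> \<cdot>\<^bsub>P\<^esub> \<phi>) p \<in> Obj ?J" "((\<psi> \<cdot>\<^bsub>P\<^esub> \<phi>) p, \<psi> p, \<phi> p) \<in> Arr ?J"
    if \<psi>: "\<psi> \<in> A" and \<phi>: "\<phi> \<in> Direct P" "Cod P \<phi> = Dom P \<psi>" for \<psi> \<phi>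
  proof -
    note t = transverse_Cmp[OF A(1,2)[OF \<psi>] a \<phi>]
    have f: "\<psi> p \<in> Direct C" "Cod C (\<psi> p) = a" "\<psi> p \<noteq> Ide C a" using A(3)[OF \<psi>] by (auto simp: Obj_latching_cat)
    have comp: "Dom C (\<psi> p) = Cod C (\<phi> p)" using t(2) by (simp add: Hom_iff)
    have "\<psi> p \<cdot> \<phi> p \<noteq> Ide C a" using direct_split_identity[OF t(1) f(1) comp _ a] f(3) by blast
    then show *: "(\<psi> \<cdot>\<^bsub>P\<^esub> \<phi>) p \<in> Obj ?J"
      using t(1,3) f Direct_Cmp[OF t(1) f(1) comp] Cmp_simps(3)[OF Direct_Arr[OF t(1)] Direct_Arr[OF f(1)] comp]
      by (simp add: Obj_latching_cat)
    show "((\<psi> \<cdot>\<^bsub>P\<^esub> \<phi>) p, \<psi> p, \<phi> p) \<in> Arr ?J"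
      using * A(3)[OF \<psi>] t Cmp_simps(2)[OF Direct_Arr[OF t(1)] Direct_Arr[OF f(1)] comp]
      by (simp add: Arr_latching_cat)
  qed
  have "\<exists>d\<in>Hom M (FObj X (FObj G a)) (Dom M q). q \<cdot>\<^bsub>M\<^esub> d = b \<and> (\<forall>\<psi>\<in>A. d \<cdot>\<^bsub>M\<^esub> FArr X \<psi> = e \<psi>)"
  proof (rule P.sieve_extension[OF M X q lift slice_functor_Obj[OF a] _ _ b'])
    fix \<psi> assume \<psi>: "\<psi> \<in> A"
    show "\<psi> \<in> Direct P \<and> Cod P \<psi> = FObj G a" using A[OF \<psi>] by blast
    note t = transverse[OF A(1,2)[OF \<psi>] a]
    note Xt = is_functorD(2)[OF X t(3)]
    show "e \<psi> \<in> Hom M (FObj X (Dom P \<psi>)) (Dom M q)"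
      unfolding e_def by (rule M.Cmp_in[OF Xt kH[OF A(3)[OF \<psi>]]])
    note GH = slice_functor_Hom[OF t(1)]
    show "q \<cdot>\<^bsub>M\<^esub> e \<psi> = b \<cdot>\<^bsub>M\<^esub> FArr X \<psi>"
      using M.Cmp_assoc[OF Xt kH[OF A(3)[OF \<psi>]] qH] M.Cmp_assoc[OF Xt is_functorD(2)[OF X GH] b']
        is_functorD(4)[OF X t(3) GH] t(4) kq[OF A(3)[OF \<psi>]] by (simp add: e_def)
    fix \<phi> assume \<phi>: "\<phi> \<in> Direct P" "Cod P \<phi> = Dom P \<psi>"
    note t' = transverse_Cmp[OF A(1,2)[OF \<psi>] a \<phi>]
    have \<phi>H: "\<phi> \<in> Hom P (Dom P \<phi>) (Dom P \<psi>)" using \<phi> P.Direct_Arr by (simp add: Hom_iff)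
    have comp: "Dom P \<psi> = Cod P \<phi>" using \<phi> by simp
    have \<psi>\<phi>: "\<psi> \<cdot>\<^bsub>P\<^esub> \<phi> \<in> Direct P" "Cod P (\<psi> \<cdot>\<^bsub>P\<^esub> \<phi>) = FObj G a" "Dom P (\<psi> \<cdot>\<^bsub>P\<^esub> \<phi>) = Dom P \<phi>"
      using P.Direct_Cmp[OF \<phi>(1) A(1)[OF \<psi>] comp]
        P.Cmp_simps[OF P.Direct_Arr[OF \<phi>(1)] P.Direct_Arr[OF A(1)[OF \<psi>]] comp] A(2)[OF \<psi>] by auto
    have "(\<psi> \<cdot>\<^bsub>P\<^esub> \<phi>) p \<noteq> Ide C a" using step(1)[OF \<psi> \<phi>] by (simp add: Obj_latching_cat)
    then show "\<psi> \<cdot>\<^bsub>P\<^esub> \<phi> \<in> A" using \<psi>\<phi> by (simp add: A_def)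
    note s = transverse[OF \<psi>\<phi>(1,2) a]
    have dom: "Dom C ((\<psi> \<cdot>\<^bsub>P\<^esub> \<phi>) p) = Dom C (\<phi> p)"
      using step(2)[OF \<psi> \<phi>] by (simp add: Arr_latching_cat Hom_iff)
    have sH: "transverse (\<psi> \<cdot>\<^bsub>P\<^esub> \<phi>) \<in> Hom P (Dom P \<phi>) (FObj G (Dom C (\<phi> p)))" using s(3) dom \<psi>\<phi>(3) by simp
    note G\<phi> = slice_functor_Hom[OF t'(2)]
    have "e \<psi> \<cdot>\<^bsub>M\<^esub> FArr X \<phi> = k (\<psi> p) \<cdot>\<^bsub>M\<^esub> FArr X (transverse \<psi> \<cdot>\<^bsub>P\<^esub> \<phi>)"
      using M.Cmp_assoc[OF is_functorD(2)[OF X \<phi>H] Xt kH[OF A(3)[OF \<psi>]]] is_functorD(4)[OF X \<phi>H t(3)]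
      by (simp add: e_def)
    also have "\<dots> = (k (\<psi> p) \<cdot>\<^bsub>M\<^esub> FArr X (FArr G (\<phi> p))) \<cdot>\<^bsub>M\<^esub> FArr X (transverse (\<psi> \<cdot>\<^bsub>P\<^esub> \<phi>))"
      using t'(4) is_functorD(4)[OF X sH G\<phi>]
        M.Cmp_assoc[OF is_functorD(2)[OF X sH] is_functorD(2)[OF X G\<phi>] kH[OF A(3)[OF \<psi>]]] by simp
    also have "\<dots> = e (\<psi> \<cdot>\<^bsub>P\<^esub> \<phi>)" using kc[OF step(2)[OF \<psi> \<phi>]] by (simp add: e_def)
    finally show "e \<psi> \<cdot>\<^bsub>M\<^esub> FArr X \<phi> = e (\<psi> \<cdot>\<^bsub>P\<^esub> \<phi>)" .
  qed
  then obtain d where d: "d \<in> Hom M (FObj X (FObj G a)) (Dom M q)" "q \<cdot>\<^bsub>M\<^esub> d = b"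
    "\<And>\<psi>. \<psi> \<in> A \<Longrightarrow> d \<cdot>\<^bsub>M\<^esub> FArr X \<psi> = e \<psi>" by blast
  have "d \<cdot>\<^bsub>M\<^esub> FArr ?S f = k f" if f: "f \<in> Obj ?J" for f
  proof -
    note fH = latching_Obj(1)[OF f] and D = latching_Obj(2)[OF f]
    have fA: "f \<in> Arr C" using fH by (simp add: Hom_iff)
    have fp: "FArr G f p = f" using fA p by (simp add: slice_functor_def)
    have "FArr G f \<in> A"
      using slice_functor_Direct[of f] slice_functor_Hom[OF fH] f fp by (simp add: A_def Obj_latching_cat Hom_iff)
    from d(3)[OF this] have "d \<cdot>\<^bsub>M\<^esub> FArr ?S f = k f \<cdot>\<^bsub>M\<^esub> FArr X (Ide P (FObj G (Dom C f)))"
      using SA[OF fA] by (simp add: e_def fp transverse_slice_functor[OF fA])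
    then show ?thesis using is_functorD(3)[OF X slice_functor_Obj[OF D]] M.Cmp_Ide[OF kH[OF f]] by simp
  qed
  then show "\<exists>d\<in>Hom M (FObj ?S a) (Dom M q). q \<cdot>\<^bsub>M\<^esub> d = b \<and> (\<forall>f\<in>Obj ?J. d \<cdot>\<^bsub>M\<^esub> FArr ?S f = k f)"
    using d SO[OF a] by auto
qed

end

lemma countable_tuples:
  assumes "countable A"
  shows "countable ({..<m :: nat} \<rightarrow>\<^sub>E A)"
proof (rule countable_image_inj_on)
  let ?T = "\<lambda>f. map f [0..<m]"
  show "inj_on ?T ({..<m} \<rightarrow>\<^sub>E A)"
  proof (rule inj_onI)
    fix f g assume fg: "f \<in> {..<m} \<rightarrow>\<^sub>E A" "g \<in> {..<m} \<rightarrow>\<^sub>E A" "?T f = ?T g"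
    then show "f = g" by (intro PiE_ext[OF fg(1,2)]) simp
  qed
  have "?T ` ({..<m} \<rightarrow>\<^sub>E A) \<subseteq> lists A"
  proof (rule image_subsetI)
    fix f assume f: "f \<in> {..<m} \<rightarrow>\<^sub>E A"
    have "f i \<in> A" if "i < m" for i using PiE_mem[OF f] that by simp
    then show "?T f \<in> lists A" by (simp add: in_lists_conv_set subset_iff)
  qed
  then show "countable (?T ` ({..<m} \<rightarrow>\<^sub>E A))"
    using countable_lists[OF assms] by (rule countable_subset)
qed

text \<open>Both cofibrancy conditions quantify over the same trivial fibrations, so \<open>slice_latching_lifting\<close>
can be applied to one of them at a time.\<close>

theorem cofibrant_slice:
  fixes C :: "('c, 'd) reedy" and M :: "('o, 'a) model" and U :: "'u itself"
  assumes inf: "infinite (UNIV :: 'u set)" and M: "model_category U M"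
    and C: "reedy_category C" "countable (Arr C)"
    and X: "cofibrant (reedy_model (power_reedy C m) M) X" and S: "S \<in> slices C m X"
  shows "cofibrant (reedy_model C M) S"
proof -
  interpret M: model_category U M by fact
  obtain p c where pc: "p < m" "\<And>i. i < m \<Longrightarrow> i \<noteq> p \<Longrightarrow> c i \<in> Obj C"
    and S: "S = restrict_along C X (slice_functor C m p c)"
    using S unfolding slices_def by blast
  interpret S: reedy_slice C m p c
    using C(1) pc by (simp add: reedy_slice_def reedy_slice_axioms_def)
  have "countable (Arr (power_reedy C m))"
    using C(2) by (simp add: power_reedy_def countable_tuples)
  then have P: "reedy_diagrams (power_reedy C m) U M"
    using S.reedy_category_P M inf by (simp add: reedy_diagrams_def reedy_diagrams_axioms_def)
  have C': "reedy_diagrams C U M"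
    using C M inf by (simp add: reedy_diagrams_def reedy_diagrams_axioms_def)
  have X': "is_functor (power_reedy C m) M X"
    "\<And>a q. a \<in> Obj (power_reedy C m) \<Longrightarrow> q \<in> Fib M \<inter> Weq M \<Longrightarrow> latching_lifting (power_reedy C m) M X a q"
    using X unfolding reedy_diagrams.cofibrant_iff_latching_lifting[OF P] by blast+
  have "latching_lifting C M S a q" if "a \<in> Obj C" "q \<in> Fib M \<inter> Weq M" for a q
    unfolding S using that M.Fib_Arr
    by (intro S.slice_latching_lifting[OF M.category_axioms X'(1)] X'(2)) auto
  then show ?thesis
    unfolding reedy_diagrams.cofibrant_iff_latching_lifting[OF C'] using S.is_functor_slice[OF X'(1)] S by blast
qed


section \<open>Duality\<close>

definition op_cat :: "('o, 'a) cat \<Rightarrow> ('o, 'a) cat" where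
  "op_cat C = \<lparr>Obj = Obj C, Arr = Arr C, Dom = Cod C, Cod = Dom C, Ide = Ide C, Cmp = (\<lambda>g f. f \<cdot>\<^bsub>C\<^esub> g)\<rparr>"

definition op_model :: "('o, 'a) model \<Rightarrow> ('o, 'a) model" where
  "op_model M = \<lparr>Obj = Obj M, Arr = Arr M, Dom = Cod M, Cod = Dom M, Ide = Ide M, Cmp = (\<lambda>g f. f \<cdot>\<^bsub>M\<^esub> g),
     Weq = Weq M, Cof = Fib M, Fib = Cof M\<rparr>"

lemma op_cat_simps [simp]:
  "Obj (op_cat C) = Obj C" "Arr (op_cat C) = Arr C" "Dom (op_cat C) = Cod C" "Cod (op_cat C) = Dom C"
  "Ide (op_cat C) = Ide C" "g \<cdot>\<^bsub>op_cat C\<^esub> f = f \<cdot>\<^bsub>C\<^esub> g" "op_cat (op_cat C) = C"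
  by (simp_all add: op_cat_def)

lemma op_reedy_simps [simp]:
  "Obj (op_reedy C) = Obj C" "Arr (op_reedy C) = Arr C" "Dom (op_reedy C) = Cod C" "Cod (op_reedy C) = Dom C"
  "Ide (op_reedy C) = Ide C" "g \<cdot>\<^bsub>op_reedy C\<^esub> f = f \<cdot>\<^bsub>C\<^esub> g" "op_reedy (op_reedy C) = C"
  "Direct (op_reedy C) = Inverse C" "Inverse (op_reedy C) = Direct C"
  by (simp_all add: op_reedy_def)

lemma op_model_simps [simp]:
  "Obj (op_model M) = Obj M" "Arr (op_model M) = Arr M" "Dom (op_model M) = Cod M" "Cod (op_model M) = Dom M"
  "Ide (op_model M) = Ide M" "g \<cdot>\<^bsub>op_model M\<^esub> f = f \<cdot>\<^bsub>M\<^esub> g" "op_model (op_model M) = M"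
  "Weq (op_model M) = Weq M" "Cof (op_model M) = Fib M" "Fib (op_model M) = Cof M"
  by (simp_all add: op_model_def)

lemma Hom_op [simp]:
  "Hom (op_cat J) a b = Hom J b a" "Hom (op_reedy C) a b = Hom C b a" "Hom (op_model M) a b = Hom M b a"
  by (auto simp: Hom_def)

lemma category_op_cat: "category J \<Longrightarrow> category (op_cat J)"
  unfolding category_def by (simp add: op_cat_def Hom_def del: Hom_op)

lemma category_op_model: "category M \<Longrightarrow> category (op_model M)"
  unfolding category_def by (simp add: op_model_def Hom_def del: Hom_op)

lemma is_functor_op:
  "is_functor (op_cat J) (op_model M) F \<longleftrightarrow> is_functor J M F"
  "is_functor (op_reedy C) (op_model M) X \<longleftrightarrow> is_functor C M X"
  unfolding is_functor_def by auto

lemma is_limit_op: "is_limit J (op_model M) F l \<pi> \<longleftrightarrow> is_colimit (op_cat J) M F l \<pi>"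
  and is_colimit_op: "is_colimit J (op_model M) F l \<pi> \<longleftrightarrow> is_limit (op_cat J) M F l \<pi>"
  unfolding is_limit_def is_colimit_def is_cone_def is_cocone_def by simp_all

lemma has_small_limits_op: "has_small_colimits U M \<Longrightarrow> has_small_limits U (op_model M)"
  and has_small_colimits_op: "has_small_limits U M \<Longrightarrow> has_small_colimits U (op_model M)"
  unfolding has_small_limits_def has_small_colimits_def is_limit_op is_colimit_op
  by (metis category_op_cat is_functor_op(1) op_cat_simps(7))+

lemma has_lifting_op: "has_lifting (op_model M) i p \<longleftrightarrow> has_lifting M p i"
proof
  show "has_lifting M p i" if l: "has_lifting (op_model M) i p"
    unfolding has_lifting_def
  proof (intro ballI impI)
    fix u v assume "u \<in> Hom M (Dom M p) (Dom M i)" "v \<in> Hom M (Cod M p) (Cod M i)"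
      "i \<cdot>\<^bsub>M\<^esub> u = v \<cdot>\<^bsub>M\<^esub> p"
    then show "\<exists>h\<in>Hom M (Cod M p) (Dom M i). h \<cdot>\<^bsub>M\<^esub> p = u \<and> i \<cdot>\<^bsub>M\<^esub> h = v"
      using l[unfolded has_lifting_def, rule_format, of v u] by auto
  qed
  show "has_lifting (op_model M) i p" if l: "has_lifting M p i"
    unfolding has_lifting_def op_model_simps Hom_op
  proof (intro ballI impI)
    fix u v assume "u \<in> Hom M (Cod M p) (Cod M i)" "v \<in> Hom M (Dom M p) (Dom M i)"
      "u \<cdot>\<^bsub>M\<^esub> p = i \<cdot>\<^bsub>M\<^esub> v"
    then show "\<exists>h\<in>Hom M (Cod M p) (Dom M i). i \<cdot>\<^bsub>M\<^esub> h = u \<and> h \<cdot>\<^bsub>M\<^esub> p = v"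
      using l[unfolded has_lifting_def, rule_format, of v u] by auto
  qed
qed

lemma is_retract_op: "is_retract (op_model M) f g \<longleftrightarrow> is_retract M f g"
proof -
  have "is_retract (op_model N) f g" if "is_retract N f g" for N :: "('a, 'b) model"
  proof -
    obtain i r j s where "f \<in> Arr N" "g \<in> Arr N" "i \<in> Hom N (Dom N f) (Dom N g)" "r \<in> Hom N (Dom N g) (Dom N f)"
      "j \<in> Hom N (Cod N f) (Cod N g)" "s \<in> Hom N (Cod N g) (Cod N f)"
      "r \<cdot>\<^bsub>N\<^esub> i = Ide N (Dom N f)" "s \<cdot>\<^bsub>N\<^esub> j = Ide N (Cod N f)"
      "g \<cdot>\<^bsub>N\<^esub> i = j \<cdot>\<^bsub>N\<^esub> f" "f \<cdot>\<^bsub>N\<^esub> r = s \<cdot>\<^bsub>N\<^esub> g"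
      using \<open>is_retract N f g\<close> unfolding is_retract_def by blast
    then show ?thesis
      unfolding is_retract_def op_model_simps Hom_op
      by (intro conjI bexI[of _ s] bexI[of _ j] bexI[of _ r] bexI[of _ i]) simp_all
  qed
  from this[of M] this[of "op_model M"] show ?thesis by auto
qed

lemma model_category_op:
  assumes "model_category U M"
  shows "model_category U (op_model M)"
proof -
  interpret model_category U M by fact
  interpret O: category "op_model M" by (rule category_op_model) unfold_locales
  show ?thesis
  proof
    fix f g a b c i p
    show "Weq (op_model M) \<subseteq> Arr (op_model M)" "Cof (op_model M) \<subseteq> Arr (op_model M)"
      "Fib (op_model M) \<subseteq> Arr (op_model M)"
      using Weq_Arr Cof_Arr Fib_Arr by simp_all
    show "has_small_limits U (op_model M)" "has_small_colimits U (op_model M)"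
      using limits colimits by (simp_all add: has_small_limits_op has_small_colimits_op)
    show "is_retract (op_model M) f g \<Longrightarrow> g \<in> Weq (op_model M) \<Longrightarrow> f \<in> Weq (op_model M)"
      "is_retract (op_model M) f g \<Longrightarrow> g \<in> Cof (op_model M) \<Longrightarrow> f \<in> Cof (op_model M)"
      "is_retract (op_model M) f g \<Longrightarrow> g \<in> Fib (op_model M) \<Longrightarrow> f \<in> Fib (op_model M)"
      using retracts[of f g] by (simp_all add: is_retract_op)
    show "i \<in> Cof (op_model M) \<Longrightarrow> p \<in> Fib (op_model M) \<inter> Weq (op_model M) \<Longrightarrow> has_lifting (op_model M) i p"
      "i \<in> Cof (op_model M) \<inter> Weq (op_model M) \<Longrightarrow> p \<in> Fib (op_model M) \<Longrightarrow> has_lifting (op_model M) i p"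
      using lifting[of p i] by (simp_all add: has_lifting_op)
    show "f \<in> Arr (op_model M) \<Longrightarrow> \<exists>i\<in>Cof (op_model M). \<exists>p\<in>Fib (op_model M) \<inter> Weq (op_model M).
        Dom (op_model M) p = Cod (op_model M) i \<and> f = p \<cdot>\<^bsub>op_model M\<^esub> i"
      using factorization(2)[of f] by simp metis
    show "f \<in> Arr (op_model M) \<Longrightarrow> \<exists>i\<in>Cof (op_model M) \<inter> Weq (op_model M). \<exists>p\<in>Fib (op_model M).
        Dom (op_model M) p = Cod (op_model M) i \<and> f = p \<cdot>\<^bsub>op_model M\<^esub> i"
      using factorization(1)[of f] by simp metis
  next
    fix f g a b c
    assume "f \<in> Hom (op_model M) a b" "g \<in> Hom (op_model M) b c"
    then have *: "g \<in> Hom M c b" "f \<in> Hom M b a" by simp_all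
    show "f \<in> Weq (op_model M) \<Longrightarrow> g \<in> Weq (op_model M) \<Longrightarrow> g \<cdot>\<^bsub>op_model M\<^esub> f \<in> Weq (op_model M)"
      "f \<in> Weq (op_model M) \<Longrightarrow> g \<cdot>\<^bsub>op_model M\<^esub> f \<in> Weq (op_model M) \<Longrightarrow> g \<in> Weq (op_model M)"
      "g \<in> Weq (op_model M) \<Longrightarrow> g \<cdot>\<^bsub>op_model M\<^esub> f \<in> Weq (op_model M) \<Longrightarrow> f \<in> Weq (op_model M)"
      using two_of_three[OF *] by simp_all
  qed
qed

lemma Obj_matching_cat: "Obj (matching_cat C a) = Obj (latching_cat (op_reedy C) a)"
  by (simp add: matching_cat_def latching_cat_def)

lemma Arr_matching_cat: "(f, g, h) \<in> Arr (matching_cat C a) \<longleftrightarrow> (g, f, h) \<in> Arr (latching_cat (op_reedy C) a)"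
  by (auto simp: matching_cat_def latching_cat_def Let_def Hom_def)

text \<open>The matching category of \<open>C\<close> and the latching category of \<open>op_reedy C\<close> have the same objects, while an
arrow \<open>(f, g, h)\<close> of one is the arrow \<open>(g, f, h)\<close> of the other. The two categories are therefore only
opposite up to this renaming, and duality is stated for their cones rather than as an equality.\<close>

lemma is_cone_matching:
  "is_cone (matching_cat C a) M (matching_diagram C a X) x \<rho> \<longleftrightarrow>
     is_cocone (latching_cat (op_reedy C) a) (op_model M) (latching_diagram (op_reedy C) a X) x \<rho>"
proof -
  let ?K = "matching_cat C a" and ?L = "latching_cat (op_reedy C) a"
  have legs: "FObj (matching_diagram C a X) f = FObj X (Cod C f)" if "f \<in> Obj ?L" for f
    using that by (simp add: matching_diagram_def restrict_along_def Obj_matching_cat)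
  have arrs: "FArr (matching_diagram C a X) (f, g, h) = FArr X h"
    if "(g, f, h) \<in> Arr ?L" for f g h
    using that by (simp add: matching_diagram_def restrict_along_def Arr_matching_cat)
  have ends: "Dom ?K (f, g, h) = f" "Cod ?K (f, g, h) = g" for f g h
    by (simp_all add: matching_cat_def Let_def)
  have "(\<forall>u\<in>Arr ?K. FArr (matching_diagram C a X) u \<cdot>\<^bsub>M\<^esub> \<rho> (Dom ?K u) = \<rho> (Cod ?K u)) \<longleftrightarrow>
      (\<forall>g f h. (g, f, h) \<in> Arr ?L \<longrightarrow> FArr X h \<cdot>\<^bsub>M\<^esub> \<rho> f = \<rho> g)"
    unfolding Ball_def split_paired_All using arrs ends by (auto simp: Arr_matching_cat)
  moreover have "(\<forall>u\<in>Arr ?L. \<rho> (Cod ?L u) \<cdot>\<^bsub>op_model M\<^esub> FArr (latching_diagram (op_reedy C) a X) u = \<rho> (Dom ?L u)) \<longleftrightarrow>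
      (\<forall>g f h. (g, f, h) \<in> Arr ?L \<longrightarrow> FArr X h \<cdot>\<^bsub>M\<^esub> \<rho> f = \<rho> g)"
    unfolding Ball_def split_paired_All by auto
  ultimately show ?thesis
    unfolding is_cone_def is_cocone_def Obj_matching_cat by (simp add: legs)
qed

lemma is_limit_matching:
  "is_limit (matching_cat C a) M (matching_diagram C a X) l \<pi> \<longleftrightarrow>
     is_colimit (latching_cat (op_reedy C) a) (op_model M) (latching_diagram (op_reedy C) a X) l \<pi>"
  unfolding is_limit_def is_colimit_def is_cone_matching Obj_matching_cat by simp

text \<open>This is an equality, not just an isomorphism, of chosen objects: both sides choose from the same predicate.\<close>

lemma matching_op: "matching C M a X = latching (op_reedy C) (op_model M) a X"
  unfolding matching_def latching_def lim_def colim_def is_limit_matching ..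

lemma lim_ind_matching:
  "lim_ind (matching_cat C a) M (matching_diagram C a X) x \<rho> =
     colim_ind (latching_cat (op_reedy C) a) (op_model M) (latching_diagram (op_reedy C) a X) x \<rho>"
  using matching_op[of C M a X]
  unfolding lim_ind_def colim_ind_def matching_def latching_def Obj_matching_cat by simp

lemma relative_matching_map_op:
  "relative_matching_map C M a (X, Y, \<tau>) = relative_latching_map (op_reedy C) (op_model M) a (Y, X, \<tau>)"
proof -
  have maps: "matching_map C M a Z = latching_map (op_reedy C) (op_model M) a Z" for Z
    by (simp add: matching_map_def latching_map_def lim_ind_matching)
  have "matching_fun C M a (X, Y, \<tau>) = latching_fun (op_reedy C) (op_model M) a (Y, X, \<tau>)"
    by (simp add: matching_fun_def latching_fun_def lim_ind_matching matching_op)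
  moreover have "pullback_ind M f g u v = pushout_ind (op_model M) f g u v" for f g u v
    by (simp add: pullback_ind_def pushout_ind_def is_pullback_def is_pushout_def)
  ultimately show ?thesis
    by (simp add: relative_matching_map_def relative_latching_map_def maps)
qed

lemma is_nattr_op: "is_nattr (op_reedy C) (op_model M) (F, G, \<tau>) \<longleftrightarrow> is_nattr C M (G, F, \<tau>)"
  unfolding is_nattr_def by (auto simp: is_functor_op)

text \<open>Reversing a transformation \<open>(F, G, \<tau>)\<close> to \<open>(G, F, \<tau>)\<close> exchanges terminal with initial diagrams and
fibrations with cofibrations, whereas the diagrams themselves are the same functors on both sides.\<close>

theorem fibrant_iff_cofibrant_op:
  "fibrant (reedy_model C M) X \<longleftrightarrow> cofibrant (reedy_model (op_reedy C) (op_model M)) X"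
proof -
  let ?N = "reedy_model C M" and ?O = "reedy_model (op_reedy C) (op_model M)"
  have swap: "(F, G, \<tau>) \<in> Hom ?N F' G' \<longleftrightarrow> (G, F, \<tau>) \<in> Hom ?O G' F'" for F G F' G' \<tau>
    by (auto simp: Hom_reedy_model is_nattr_op)
  have uniq: "(\<exists>!t. t \<in> Hom ?N F G) \<longleftrightarrow> (\<exists>!t. t \<in> Hom ?O G F)" for F G
    unfolding Hom_reedy_model is_nattr_op by auto
  have terminal: "is_terminal ?N T \<longleftrightarrow> is_initial ?O T" for T
    unfolding is_terminal_def is_initial_def uniq by (simp add: is_functor_op)
  have fib: "(F, G, \<tau>) \<in> Fib ?N \<longleftrightarrow> (G, F, \<tau>) \<in> Cof ?O" for F G \<tau>
    by (simp add: is_nattr_op relative_matching_map_op)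
  have "(\<exists>f. f \<in> Hom ?N X T \<and> f \<in> Fib ?N) \<longleftrightarrow> (\<exists>f. f \<in> Hom ?O T X \<and> f \<in> Cof ?O)" for T
    using fib unfolding Hom_reedy_model is_nattr_op by blast
  then show ?thesis
    unfolding fibrant_def cofibrant_def terminal by (simp add: is_functor_op)
qed

lemma power_reedy_op: "power_reedy (op_reedy C) m = op_reedy (power_reedy C m)"
  by (simp add: power_reedy_def op_reedy_def)

lemma slices_op: "slices (op_reedy C) m X = slices C m X"
  unfolding slices_def slice_functor_def restrict_along_def op_reedy_simps ..

text \<open>Taking opposites commutes with powers and leaves the set of slices unchanged, so this is
\<open>cofibrant_slice\<close> for \<open>op_reedy C\<close> and \<open>op_model M\<close>.\<close>

theorem fibrant_slice:
  fixes C :: "('c, 'd) reedy" and M :: "('o, 'a) model" and U :: "'u itself"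
  assumes inf: "infinite (UNIV :: 'u set)" and M: "model_category U M"
    and C: "reedy_category C" "countable (Arr C)"
    and X: "fibrant (reedy_model (power_reedy C m) M) X" and S: "S \<in> slices C m X"
  shows "fibrant (reedy_model C M) S"
  unfolding fibrant_iff_cofibrant_op
proof (rule cofibrant_slice[OF inf model_category_op[OF M] reedy_category_op[OF C(1)]])
  show "cofibrant (reedy_model (power_reedy (op_reedy C) m) (op_model M)) X"
    using X by (simp add: fibrant_iff_cofibrant_op power_reedy_op)
qed (use C S in \<open>simp_all add: slices_op\<close>)

lemma countable_Arr_Delta: "countable (Arr Delta)"
proof (rule countable_subset)
  show "Arr Delta \<subseteq> (SIGMA n:UNIV. SIGMA k:UNIV. {0..n} \<rightarrow>\<^sub>E {0..k})"
    by (auto simp: Delta_def)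
  show "countable (SIGMA n:UNIV. SIGMA k:UNIV. {0..n :: nat} \<rightarrow>\<^sub>E {0..k :: nat})"
  proof (intro countable_SIGMA)
    show "countable ({0..n :: nat} \<rightarrow>\<^sub>E {0..k :: nat})" for n k
      by (rule countable_finite[OF finite_PiE]) simp_all
  qed simp_all
qed

theorem corollary3p22:
  fixes M :: "('o, 'a) model" and m :: nat
  assumes "infinite (UNIV :: 'u set)"
    and "model_category TYPE('u) M"
    and "m > 0"
  shows "(\<forall>X. cofibrant (multicosimplicial m M) X \<longrightarrow>
             (\<forall>S\<in>slices Delta m X. cofibrant (cosimplicial M) S)) \<and>
         (\<forall>X. fibrant (multicosimplicial m M) X \<longrightarrow>
             (\<forall>S\<in>slices Delta m X. fibrant (cosimplicial M) S)) \<and>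
         (\<forall>X. cofibrant (multisimplicial m M) X \<longrightarrow>
             (\<forall>S\<in>slices (op_reedy Delta) m X. cofibrant (simplicial M) S)) \<and>
         (\<forall>X. fibrant (multisimplicial m M) X \<longrightarrow>
             (\<forall>S\<in>slices (op_reedy Delta) m X. fibrant (simplicial M) S))"
proof -
  have op: "reedy_category (op_reedy Delta)" "countable (Arr (op_reedy Delta))"
    using reedy_category_op[OF reedy_category_Delta] countable_Arr_Delta by simp_all
  note Delta = reedy_category_Delta countable_Arr_Delta
  show ?thesis
    using cofibrant_slice[OF assms(1,2) Delta] fibrant_slice[OF assms(1,2) Delta]
      cofibrant_slice[OF assms(1,2) op] fibrant_slice[OF assms(1,2) op] by blast
qed

end
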